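(* The invariant $\tau$ of knot projections is strictly stronger than the invariant $|\tau|$; that is, $\tau(P)=\tau(P')$ implies $|\tau(P)|=|\tau(P')|$ for all knot projections $P,P'$, while there exist knot projections $P,P'$ with $|\tau(P)|=|\tau(P')|$ but $\tau(P)\neq\tau(P')$, where circle arrangements are compared up to isotopy of the sphere.
   Context: A knot projection is the image of a generic immersion of a circle into the 2-sphere $S^2$ (the only singularities are finitely many transverse double points), considered up to isotopy of the sphere. Non-Seifert resolution $A^{-1}$: orient $P$ arbitrarily; of the two planar smoothings of a double point, $A^{-1}$ is the one that does not respect the orientation, i.e. it joins the two incoming branches to each other and the two outgoing branches to each other. This does not depend on the orientation chosen. Applying $A^{-1}$ simultaneously at every double point of $P$ (with respect to an orientation of $P$) yields a finite collection $\tau(P)$ of pairwise disjoint simple closed curves on $S^2$, called the circle arrangement of $P$ and considered up to isotopy of the sphere. The circle number $|\tau(P)|$ is the number of circles in $\tau(P)$. *)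

theory Defs
  imports "HOL-Analysis.Analysis"
begin

abbreviation S2 :: "(real^3) set" where
  "S2 \<equiv> sphere 0 1"

definition smooth_curve :: "(real \<Rightarrow> real^3) \<Rightarrow> bool" where
  "smooth_curve g \<longleftrightarrow>
     (\<exists>D. D 0 = g \<and> (\<forall>n t. (D n has_vector_derivative D (Suc n) t) (at t)))"

definition double_points :: "(real \<Rightarrow> real^3) \<Rightarrow> (real^3) set" where
  "double_points g = {p. \<exists>s\<in>{0..<2*pi}. \<exists>t\<in>{0..<2*pi}. s \<noteq> t \<and> g s = p \<and> g t = p}"

text \<open>A map from the circle is a \<open>2\<pi>\<close>-periodic map on the reals. At a double point both
  velocities lie in the tangent plane of the sphere, so that transversality of the two branches
  means that their velocities are linearly independent, i.e. have nonzero cross product.\<close>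

definition generic_immersion :: "(real \<Rightarrow> real^3) \<Rightarrow> bool" where
  "generic_immersion g \<longleftrightarrow>
     range g \<subseteq> S2 \<and>
     (\<forall>t. g (t + 2*pi) = g t) \<and>
     smooth_curve g \<and>
     (\<forall>t. vector_derivative g (at t) \<noteq> 0) \<and>
     finite (double_points g) \<and>
     (\<forall>s\<in>{0..<2*pi}. \<forall>t\<in>{0..<2*pi}. \<forall>u\<in>{0..<2*pi}.
        g s = g t \<and> g t = g u \<longrightarrow> s = t \<or> t = u \<or> s = u) \<and>
     (\<forall>s\<in>{0..<2*pi}. \<forall>t\<in>{0..<2*pi}. s \<noteq> t \<and> g s = g t \<longrightarrow>
        cross3 (vector_derivative g (at s)) (vector_derivative g (at t)) \<noteq> 0)"

text \<open>A representative of a knot projection; the orientation and the parametrization are forgotten.\<close>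

definition knot_projection :: "(real^3) set \<Rightarrow> bool" where
  "knot_projection P \<longleftrightarrow> (\<exists>g. generic_immersion g \<and> range g = P)"

definition cap :: "real^3 \<Rightarrow> real \<Rightarrow> (real^3) set" where
  "cap p r = cball p r \<inter> S2"

text \<open>\<open>A_inv_smoothing g p r A\<close>: the closed disc \<open>cap p r\<close> meets the curve exactly in two strands
  \<open>g ` {a..b}\<close> and \<open>g ` {c..d}\<close> that run from boundary to boundary and cross only at \<open>p\<close>, and
  \<open>A\<close> consists of two disjoint arcs in the disc that may replace them: \<open>\<alpha>\<close> joins the two
  incoming ends \<open>g a\<close>, \<open>g c\<close>, and \<open>\<beta>\<close> joins the two outgoing ends \<open>g b\<close>, \<open>g d\<close>.\<close>

definition A_inv_smoothing ::
  "(real \<Rightarrow> real^3) \<Rightarrow> real^3 \<Rightarrow> real \<Rightarrow> (real^3) set \<Rightarrow> bool" where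
  "A_inv_smoothing g p r A \<longleftrightarrow>
     (\<exists>a b c d \<alpha> \<beta>.
        a < b \<and> c < d \<and>
        cap p r \<inter> range g = g ` {a..b} \<union> g ` {c..d} \<and>
        g ` {a..b} \<inter> g ` {c..d} = {p} \<and>
        (\<forall>u\<in>{a, b, c, d}. dist p (g u) = r) \<and>
        (\<forall>u\<in>{a<..<b} \<union> {c<..<d}. dist p (g u) < r) \<and>
        arc \<alpha> \<and> pathstart \<alpha> = g a \<and> pathfinish \<alpha> = g c \<and>
        arc \<beta> \<and> pathstart \<beta> = g b \<and> pathfinish \<beta> = g d \<and>
        path_image \<alpha> \<subseteq> cap p r \<and> path_image \<alpha> \<inter> sphere p r = {g a, g c} \<and>
        path_image \<beta> \<subseteq> cap p r \<and> path_image \<beta> \<inter> sphere p r = {g b, g d} \<and>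
        path_image \<alpha> \<inter> path_image \<beta> = {} \<and>
        A = path_image \<alpha> \<union> path_image \<beta>)"

text \<open>The result of smoothing all double points simultaneously, in pairwise disjoint discs.\<close>

definition A_inv_resolution :: "(real \<Rightarrow> real^3) \<Rightarrow> (real^3) set \<Rightarrow> bool" where
  "A_inv_resolution g R \<longleftrightarrow>
     (\<exists>r A.
        (\<forall>p\<in>double_points g. A_inv_smoothing g p (r p) (A p)) \<and>
        disjoint_family_on (\<lambda>p. cap p (r p)) (double_points g) \<and>
        R = (range g - (\<Union>p\<in>double_points g. cap p (r p))) \<union> (\<Union>p\<in>double_points g. A p))"

text \<open>Ambient isotopy of the sphere, i.e. a homotopy through self-homeomorphisms starting at the
  identity, carrying one collection of curves to the other.\<close>

definition sphere_isotopic :: "(real^3) set set \<Rightarrow> (real^3) set set \<Rightarrow> bool" where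
  "sphere_isotopic C C' \<longleftrightarrow>
     (\<exists>f. homotopic_with_canon (\<lambda>h. \<exists>k. homeomorphism S2 S2 h k) S2 S2 id f \<and>
          (\<lambda>c. f ` c) ` C = C')"

text \<open>The circle arrangement \<open>\<tau>(P)\<close>, as an isotopy class of collections of circles. The circles of
  a resolution are its connected components. The class depends neither on the parametrization
  of \<open>P\<close> nor on the discs and arcs used for the smoothings.\<close>

definition tau :: "(real^3) set \<Rightarrow> (real^3) set set set" where
  "tau P = {C. \<exists>g R. generic_immersion g \<and> range g = P \<and> A_inv_resolution g R \<and>
                     sphere_isotopic (components R) C}"

definition circle_number :: "(real^3) set \<Rightarrow> nat" where
  "circle_number P = (THE n. card ` tau P = {n})"

end

theory Submission
  imports Defs "HOL-Complex_Analysis.Cauchy_Integral_Formula"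
begin

text \<open>
  The circle number is a function of \<open>\<tau>\<close>. It is strictly weaker: compare two closed braids around
  the polar axis, the shadow of \<open>\<sigma>\<^sub>1\<^sup>5\<close> on two strands (the standard \<open>5\<^sub>1\<close> projection) and the shadow of
  \<open>\<sigma>\<^sub>1\<^sup>3 \<sigma>\<^sub>2\<^sup>3\<close> on three strands (a sum of two trefoils). Both resolve into five circles. Those of the first
  all border the region that contains the face around a pole minus the smoothing discs. In the second one circle
  separates the poles and has two circles on each side, so no region borders all five.

  The circles are counted combinatorially, from the Gauss diagram. Since \<open>\<tau>\<close> collects the
  resolutions of all parametrizations by all choices of discs, two facts are needed for arbitrary
  discs: two generic parametrizations of a projection differ by a homeomorphism of the line, and, by
  Janiszewski's theorem, a face minus the smoothing discs lies in a single region of the resolution.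
\<close>

text \<open>If the two classes were equal, each resolution of the three-strand curve would be
  isotopic to some resolution of the two-strand curve. The first may be chosen with small discs,
  while nothing is known about the discs of the second. Hence the common region is proved for
  arbitrary discs in the two-strand case, but its absence only for small discs in the three-strand
  case. That the circle of colour 2 separates is not drawn from the Jordan curve theorem. A
  connected set that joins the poles and avoids a compact subset of the sphere yields a continuous
  longitude on that subset; around the circle of colour 2 such a longitude would have to change by 2
  pi. This count only uses the parameters of the passes, because the longitude of a closed braid on
  k strands is k times the parameter. The braids have trigonometric heights, so that smoothness
  follows from holomorphy and double points are zeros of explicit functions.\<close>

section \<open>Angles modulo 2 pi\<close>

definition same_angle :: "real \<Rightarrow> real \<Rightarrow> bool" where
  "same_angle s t \<longleftrightarrow> (\<exists>k::int. s = t + 2*pi * of_int k)"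

lemma same_angle_refl [simp, intro]: "same_angle s s"
  unfolding same_angle_def by (rule exI[of _ 0]) simp

lemma same_angle_sym: "same_angle s t \<Longrightarrow> same_angle t s"
proof -
  assume "same_angle s t"
  then obtain k :: int where "s = t + 2*pi * of_int k" unfolding same_angle_def by blast
  then have "t = s + 2*pi * of_int (-k)" by simp
  then show ?thesis unfolding same_angle_def by blast
qed

lemma same_angle_trans [trans]: "same_angle s t \<Longrightarrow> same_angle t u \<Longrightarrow> same_angle s u"
proof -
  assume "same_angle s t" "same_angle t u"
  then obtain k l :: int where "s = t + 2*pi * of_int k" "t = u + 2*pi * of_int l"
    unfolding same_angle_def by blast
  then have "s = u + 2*pi * of_int (k + l)" by (simp add: algebra_simps)
  then show ?thesis unfolding same_angle_def by blast
qed

lemma same_angle_add [simp]: "same_angle (s + 2*pi * of_int k) t \<longleftrightarrow> same_angle s t"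
  and same_angle_add' [simp]: "same_angle t (s + 2*pi * of_int k) \<longleftrightarrow> same_angle t s"
proof -
  have "same_angle (s + 2*pi * of_int k) s" unfolding same_angle_def by blast
  then show "same_angle (s + 2*pi * of_int k) t \<longleftrightarrow> same_angle s t"
    "same_angle t (s + 2*pi * of_int k) \<longleftrightarrow> same_angle t s"
    using same_angle_sym same_angle_trans by blast+
qed

lemma same_angle_cis: "same_angle s t \<longleftrightarrow> cis s = cis t"
  unfolding same_angle_def
proof
  assume "cis s = cis t"
  then have "sin s = sin t \<and> cos s = cos t" by (simp add: complex_eq_iff)
  then show "\<exists>k::int. s = t + 2*pi * of_int k"
    using sin_cos_eq_iff[of s t] by (metis)
next
  assume "\<exists>k::int. s = t + 2*pi * of_int k"
  then show "cis s = cis t"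
    by (metis add.commute cis_multiple_2pi cis_mult mult.commute mult_1 Ints_of_int)
qed

lemma same_angle_rep: obtains s' where "s' \<in> {0..<2*pi}" "same_angle s s'"
proof
  define k where "k = \<lfloor>s / (2*pi)\<rfloor>"
  have "of_int k \<le> s / (2*pi)" "s / (2*pi) < of_int k + 1" unfolding k_def by linarith+
  then have "of_int k * (2*pi) \<le> s" "s < (of_int k + 1) * (2*pi)"
    by (simp_all add: field_simps)
  then show "s - 2*pi * of_int k \<in> {0..<2*pi}" by (simp add: algebra_simps)
  show "same_angle s (s - 2*pi * of_int k)"
    unfolding same_angle_def by (rule exI[of _ k]) simp
qed

lemma same_angle_near:
  assumes "same_angle s t" "\<bar>s - t\<bar> < 2*pi"
  shows "s = t"
proof -
  obtain k :: int where k: "s = t + 2*pi * of_int k" using assms(1) unfolding same_angle_def by blast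
  then have "2*pi * \<bar>of_int k\<bar> < 2*pi * 1" using assms(2) by (simp add: abs_mult)
  then have "\<bar>real_of_int k\<bar> < 1" by (simp add: mult_less_cancel_left_pos)
  then have "k = 0" by linarith
  then show ?thesis using k by simp
qed

text \<open>The difference divided by 2 pi is continuous with integer values, hence constant on a
  connected set. This compares lifts of one angle, both for the degree of a reparametrization and
  for longitudes along the circles.\<close>

lemma multiple_2pi_constant:
  fixes F G :: "'a::topological_space \<Rightarrow> real"
  assumes S: "connected S" and F: "continuous_on S F" and G: "continuous_on S G"
    and eq: "\<And>x. x \<in> S \<Longrightarrow> same_angle (F x) (G x)" and "x \<in> S" "y \<in> S"
  shows "F x - G x = F y - G y"
proof -
  define H where "H = (\<lambda>x. (F x - G x) / (2*pi))"
  have cH: "continuous_on S H" unfolding H_def by (intro continuous_intros F G) auto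
  have "H constant_on S"
  proof (rule continuous_discrete_range_constant[OF S cH])
    fix x assume x: "x \<in> S"
    have "\<forall>y. y \<in> S \<and> H y \<noteq> H x \<longrightarrow> 1 \<le> norm (H y - H x)"
    proof (intro allI impI)
      fix y assume y: "y \<in> S \<and> H y \<noteq> H x"
      obtain k :: int where "F x = G x + 2*pi * of_int k" using eq[OF x] unfolding same_angle_def by blast
      then have k: "H x = of_int k" unfolding H_def by simp
      obtain l :: int where "F y = G y + 2*pi * of_int l" using eq[of y] y unfolding same_angle_def by blast
      then have l: "H y = of_int l" unfolding H_def by simp
      have "l \<noteq> k" using y k l by auto
      then have "1 \<le> \<bar>l - k\<bar>" by linarith
      then show "1 \<le> norm (H y - H x)" unfolding k l by (metis of_int_1_le_iff of_int_abs of_int_diff real_norm_def)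
    qed
    then show "\<exists>e>0. \<forall>y. y \<in> S \<and> H y \<noteq> H x \<longrightarrow> e \<le> norm (H y - H x)"
      using zero_less_one by blast
  qed
  then have "H x = H y" using assms(5,6) unfolding constant_on_def by metis
  then show ?thesis unfolding H_def by simp
qed

section \<open>Generic immersions as periodic curves on the whole line\<close>

context
  fixes g :: "real \<Rightarrow> real^3"
  assumes gen: "generic_immersion g"
begin

lemma gen_sphere: "norm (g t) = 1"
  using gen unfolding generic_immersion_def by (auto simp: image_subset_iff)

lemma gen_periodic: "g (t + 2*pi * of_int k) = g t"
proof -
  have p: "g (t + 2*pi) = g t" for t using gen unfolding generic_immersion_def by blast
  have nat: "g (t + 2*pi * of_nat n) = g t" for t n
  proof (induction n)
    case (Suc n)
    have "g (t + 2*pi * of_nat (Suc n)) = g ((t + 2*pi * of_nat n) + 2*pi)" by (simp add: algebra_simps)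
    then show ?case using p Suc by simp
  qed simp
  show ?thesis
  proof (cases "k \<ge> 0")
    case True
    then show ?thesis using nat[of t "nat k"] by simp
  next
    case False
    then show ?thesis using nat[of "t + 2*pi * of_int k" "nat (-k)"] by simp
  qed
qed

lemma gen_same_angle: "same_angle s t \<Longrightarrow> g s = g t"
  unfolding same_angle_def using gen_periodic by blast

lemma gen_derivative: "(g has_vector_derivative vector_derivative g (at t)) (at t)"
proof -
  obtain D where "D 0 = g" "\<forall>n t. (D n has_vector_derivative D (Suc n) t) (at t)"
    using gen unfolding generic_immersion_def smooth_curve_def by blast
  then have "(g has_vector_derivative D (Suc 0) t) (at t)" by metis
  then show ?thesis by (metis vector_derivative_at)
qed

lemma gen_derivative_continuous: "continuous_on UNIV (\<lambda>t. vector_derivative g (at t))"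
proof -
  obtain D where D: "D 0 = g" "\<forall>n t. (D n has_vector_derivative D (Suc n) t) (at t)"
    using gen unfolding generic_immersion_def smooth_curve_def by blast
  then have "vector_derivative g (at t) = D (Suc 0) t" for t by (metis vector_derivative_at)
  moreover have "continuous_on UNIV (D (Suc 0))"
    using D(2) by (meson continuous_at_imp_continuous_on has_vector_derivative_continuous)
  ultimately show ?thesis by simp
qed

lemma gen_continuous: "continuous_on S g"
  using gen_derivative by (meson continuous_at_imp_continuous_on has_vector_derivative_continuous)

lemma gen_derivative_nz: "vector_derivative g (at t) \<noteq> 0"
  using gen unfolding generic_immersion_def by blast

lemma gen_derivative_same_angle:
  assumes "same_angle s t"
  shows "vector_derivative g (at s) = vector_derivative g (at t)"
proof -
  obtain k :: int where k: "s = t + 2*pi * of_int k" using assms unfolding same_angle_def by blast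
  have "((g \<circ> (\<lambda>t. t + 2*pi * of_int k)) has_vector_derivative (1 *\<^sub>R vector_derivative g (at s))) (at t)"
    by (rule vector_diff_chain_at)
      (auto intro!: derivative_eq_intros simp: k gen_derivative simp flip: has_real_derivative_iff_has_vector_derivative)
  moreover have "g \<circ> (\<lambda>t. t + 2*pi * of_int k) = g" using gen_periodic by auto
  ultimately show ?thesis by (metis scaleR_one vector_derivative_at)
qed

lemma gen_triple:
  assumes "g s = g t" "g t = g u"
  shows "same_angle s t \<or> same_angle t u \<or> same_angle s u"
proof -
  obtain s' where s': "s' \<in> {0..<2*pi}" "same_angle s s'" by (rule same_angle_rep)
  obtain t' where t': "t' \<in> {0..<2*pi}" "same_angle t t'" by (rule same_angle_rep)
  obtain u' where u': "u' \<in> {0..<2*pi}" "same_angle u u'" by (rule same_angle_rep)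
  have "g s' = g t' \<and> g t' = g u'" using assms gen_same_angle s' t' u' by metis
  then have "s' = t' \<or> t' = u' \<or> s' = u'"
    using gen s' t' u' unfolding generic_immersion_def by blast
  then show ?thesis using s' t' u' same_angle_sym same_angle_trans by metis
qed

lemma gen_transversal:
  assumes "g s = g t" "\<not> same_angle s t"
  shows "cross3 (vector_derivative g (at s)) (vector_derivative g (at t)) \<noteq> 0"
proof -
  obtain s' where s': "s' \<in> {0..<2*pi}" "same_angle s s'" by (rule same_angle_rep)
  obtain t' where t': "t' \<in> {0..<2*pi}" "same_angle t t'" by (rule same_angle_rep)
  have "g s' = g t'" using assms gen_same_angle s' t' by metis
  moreover have "s' \<noteq> t'" using assms(2) s' t' same_angle_sym same_angle_trans by metis
  ultimately have "cross3 (vector_derivative g (at s')) (vector_derivative g (at t')) \<noteq> 0"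
    using gen s' t' unfolding generic_immersion_def by blast
  then show ?thesis using gen_derivative_same_angle s'(2) t'(2) by metis
qed

lemma double_points_iff: "p \<in> double_points g \<longleftrightarrow> (\<exists>s t. \<not> same_angle s t \<and> g s = p \<and> g t = p)"
proof
  assume "p \<in> double_points g"
  then obtain s t where "s \<in> {0..<2*pi}" "t \<in> {0..<2*pi}" "s \<noteq> t" "g s = p" "g t = p"
    unfolding double_points_def by blast
  moreover from this have "\<bar>s - t\<bar> < 2*pi" by auto
  with \<open>s \<noteq> t\<close> have "\<not> same_angle s t" using same_angle_near by blast
  ultimately show "\<exists>s t. \<not> same_angle s t \<and> g s = p \<and> g t = p" by blast
next
  assume "\<exists>s t. \<not> same_angle s t \<and> g s = p \<and> g t = p"
  then obtain s t where st: "\<not> same_angle s t" "g s = p" "g t = p" by blast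
  obtain s' where s': "s' \<in> {0..<2*pi}" "same_angle s s'" by (rule same_angle_rep)
  obtain t' where t': "t' \<in> {0..<2*pi}" "same_angle t t'" by (rule same_angle_rep)
  have "s' \<noteq> t'" using st s' t' same_angle_sym same_angle_trans by metis
  moreover have "g s' = p" "g t' = p" using st s' t' gen_same_angle by metis+
  ultimately show "p \<in> double_points g" unfolding double_points_def using s' t' by blast
qed

lemma gen_range: "range g = g ` {0..2*pi}"
proof -
  have "g s \<in> g ` {0..2*pi}" for s
  proof -
    obtain s' where s': "s' \<in> {0..<2*pi}" "same_angle s s'" by (rule same_angle_rep)
    then show ?thesis using gen_same_angle by force
  qed
  then show ?thesis by auto
qed

lemma gen_compact: "compact (range g)"
  unfolding gen_range by (intro compact_continuous_image gen_continuous compact_Icc)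

lemma gen_finite_double: "finite (double_points g)"
  using gen unfolding generic_immersion_def by blast

end

subsection \<open>Parametrizations of a projection\<close>

lemma vector_difference_quotient:
  assumes "(f has_vector_derivative D) (at x)"
  shows "((\<lambda>y. (f y - f x) /\<^sub>R (y - x)) \<longlongrightarrow> D) (at x)"
proof (rule LIM_zero_cancel, rule tendsto_norm_zero_cancel)
  have "((\<lambda>y. norm ((f y - f x) - (y - x) *\<^sub>R D) / norm (y - x)) \<longlongrightarrow> 0) (at x)"
    using assms unfolding has_vector_derivative_def has_derivative_iff_norm by blast
  moreover have "norm ((f y - f x) - (y - x) *\<^sub>R D) / norm (y - x) = norm ((f y - f x) /\<^sub>R (y - x) - D)"
    if "y \<noteq> x" for y
  proof -
    have "(f y - f x) /\<^sub>R (y - x) - D = ((f y - f x) - (y - x) *\<^sub>R D) /\<^sub>R (y - x)"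
      using that by (simp add: scaleR_diff_right)
    then show ?thesis by (simp add: divide_inverse mult.commute)
  qed
  then have "eventually (\<lambda>y. norm ((f y - f x) - (y - x) *\<^sub>R D) / norm (y - x)
      = norm ((f y - f x) /\<^sub>R (y - x) - D)) (at x)"
    by (simp add: eventually_at_filter)
  ultimately show "((\<lambda>y. norm ((f y - f x) /\<^sub>R (y - x) - D)) \<longlongrightarrow> 0) (at x)"
    by (rule Lim_transform_eventually)
qed

text \<open>At a double point the image alone does not tell which parameter of \<open>g\<close>
  corresponds to a parameter of \<open>f\<close>. The common tangent line does, since the two
  branches of \<open>g\<close> have different tangents there.\<close>

definition tangent_meeting :: "(real \<Rightarrow> real^3) \<Rightarrow> (real \<Rightarrow> real^3) \<Rightarrow> real \<Rightarrow> real \<Rightarrow> bool" where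
  "tangent_meeting f g s t \<longleftrightarrow>
     f s = g t \<and> cross3 (vector_derivative f (at s)) (vector_derivative g (at t)) = 0"

lemma tangent_meeting_sym: "tangent_meeting f g s t \<Longrightarrow> tangent_meeting g f t s"
  unfolding tangent_meeting_def by (metis cross_skew neg_equal_0_iff_equal)

lemma tendsto_cross3:
  assumes "(F \<longlongrightarrow> a) X" "(G \<longlongrightarrow> b) X"
  shows "((\<lambda>x. cross3 (F x) (G x)) \<longlongrightarrow> cross3 a b) X"
  using bounded_bilinear.tendsto[OF _ assms] bilinear_cross bilinear_conv_bounded_bilinear by blast

lemma tangent_meeting_same_angle:
  assumes f: "generic_immersion f" and g: "generic_immersion g"
    and "tangent_meeting f g s t" "same_angle s s'" "same_angle t t'"
  shows "tangent_meeting f g s' t'"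
proof -
  have "f s = f s'" "g t = g t'" using assms(4,5) gen_same_angle f g by blast+
  moreover have "vector_derivative f (at s) = vector_derivative f (at s')"
    "vector_derivative g (at t) = vector_derivative g (at t')"
    using assms(4,5) gen_derivative_same_angle f g by blast+
  ultimately show ?thesis using assms(3) unfolding tangent_meeting_def by simp
qed

lemma parallel_cross3_trans:
  assumes "cross3 u v = 0" "cross3 u w = 0" "u \<noteq> 0"
  shows "cross3 v w = 0"
proof -
  obtain c d where c: "v = c *\<^sub>R u \<or> u = 0" and d: "w = d *\<^sub>R u \<or> u = 0"
    using assms unfolding cross_eq_0 collinear_lemma by (metis scaleR_zero_left)
  then show ?thesis using assms(3) by (simp add: cross_mult_left cross_mult_right)
qed

text \<open>Two inequivalent parameters would give a double point of \<open>g\<close> at which both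
  velocities are parallel to the nonzero velocity of \<open>f\<close>, against
  transversality.\<close>

lemma tangent_meeting_unique:
  assumes f: "generic_immersion f" and g: "generic_immersion g"
    and "tangent_meeting f g s t" "tangent_meeting f g s t'"
  shows "same_angle t t'"
proof (rule ccontr)
  assume "\<not> same_angle t t'"
  moreover have "g t = g t'" using assms unfolding tangent_meeting_def by metis
  ultimately have "cross3 (vector_derivative g (at t)) (vector_derivative g (at t')) \<noteq> 0"
    using gen_transversal[OF g] by blast
  then show False
    using assms parallel_cross3_trans gen_derivative_nz[OF f] unfolding tangent_meeting_def by blast
qed

text \<open>Approach \<open>s\<close> by parameters of \<open>f\<close>, choose parameters of
  \<open>g\<close> with the same images in the compact interval of one turn, and pass to a
  convergent subsequence. The displacements of \<open>f\<close> and \<open>g\<close> coincide, so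
  the difference quotients are parallel, and so are their limits.\<close>

lemma tangent_meeting_exists:
  assumes f: "generic_immersion f" and g: "generic_immersion g" and r: "range f \<subseteq> range g"
  shows "\<exists>t. tangent_meeting f g s t"
proof -
  define \<sigma> where "\<sigma> n = s + inverse (real (Suc n))" for n
  have \<sigma>: "\<sigma> \<longlonglongrightarrow> s"
    unfolding \<sigma>_def using tendsto_add[OF tendsto_const LIMSEQ_inverse_real_of_nat, of s] by simp
  have \<sigma>_ne: "\<sigma> n \<noteq> s" for n unfolding \<sigma>_def by simp
  have "\<exists>t. t \<in> {0..2*pi} \<and> g t = f (\<sigma> n)" for n
    using r gen_range[OF g] by (metis imageE rangeI subsetD)
  then obtain \<tau> where \<tau>: "\<And>n. \<tau> n \<in> {0..2*pi}" "\<And>n. g (\<tau> n) = f (\<sigma> n)" by metis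
  have "seq_compact {0..2*pi}" by (simp add: compact_imp_seq_compact)
  then obtain t \<rho> where t: "strict_mono (\<rho> :: nat \<Rightarrow> nat)" "(\<tau> \<circ> \<rho>) \<longlonglongrightarrow> t"
    unfolding seq_compact_def using \<tau>(1) by metis
  define S T where "S = \<sigma> \<circ> \<rho>" and "T = \<tau> \<circ> \<rho>"
  have S: "S \<longlonglongrightarrow> s" and T: "T \<longlonglongrightarrow> t"
    unfolding S_def T_def using \<sigma> t LIMSEQ_subseq_LIMSEQ by auto
  have S_ne: "S n \<noteq> s" and gf: "g (T n) = f (S n)" for n
    unfolding S_def T_def using \<sigma>_ne \<tau>(2) by auto
  have "(\<lambda>n. f (S n)) \<longlonglongrightarrow> f s" and "(\<lambda>n. g (T n)) \<longlonglongrightarrow> g t"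
    using S T gen_continuous[OF f, of UNIV] gen_continuous[OF g, of UNIV]
    by (auto intro: continuous_on_tendsto_compose[of UNIV])
  then have eq: "f s = g t" unfolding gf using LIMSEQ_unique by blast
  let ?F = "\<lambda>n. (f (S n) - f s) /\<^sub>R (S n - s)" and ?G = "\<lambda>n. (g (T n) - g t) /\<^sub>R (T n - t)"
  have F: "?F \<longlonglongrightarrow> vector_derivative f (at s)"
  proof (rule filterlim_compose[OF vector_difference_quotient[OF gen_derivative[OF f]]])
    show "filterlim S (at s) sequentially" using S S_ne by (simp add: filterlim_at)
  qed
  have "eventually (\<lambda>n. ?F n \<noteq> 0) sequentially"
    using F gen_derivative_nz[OF f, of s] tendsto_imp_eventually_ne by blast
  \<comment> \<open>The quotients of \<open>f\<close> tend to a nonzero velocity, so eventually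
    \<open>f (S n)\<close> differs from \<open>f s = g t\<close>; hence \<open>T n\<close> differs
    from \<open>t\<close> and the quotient of \<open>g\<close> is a genuine one.\<close>
  then have "eventually (\<lambda>n. T n \<noteq> t) sequentially"
    by (rule eventually_mono) (use gf eq in auto)
  then have "filterlim T (at t) sequentially" using T by (simp add: filterlim_at)
  from filterlim_compose[OF vector_difference_quotient[OF gen_derivative[OF g]] this]
  have G: "?G \<longlonglongrightarrow> vector_derivative g (at t)" .
  have "cross3 (?F n) (?G n) = 0" for n
    unfolding gf eq by (simp add: cross_mult_left cross_mult_right)
  then have "(\<lambda>n. 0) \<longlonglongrightarrow> cross3 (vector_derivative f (at s)) (vector_derivative g (at t))"
    using tendsto_cross3[OF F G] by simp
  then have "cross3 (vector_derivative f (at s)) (vector_derivative g (at t)) = 0"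
    using LIMSEQ_unique tendsto_const by blast
  then show ?thesis using eq unfolding tangent_meeting_def by blast
qed

text \<open>Transversality makes the tangential meeting relation between two parametrizations of the
  same projection the graph of a homeomorphism of the circle, which is then lifted to the line.\<close>

lemma reparametrization:
  assumes f: "generic_immersion f" and g: "generic_immersion g" and r: "range f = range g"
  obtains \<phi> where "continuous_on UNIV \<phi>" "strict_mono \<phi> \<or> strict_antimono_on UNIV \<phi>" "surj \<phi>"
    "f = g \<circ> \<phi>" "\<And>s t. same_angle (\<phi> s) (\<phi> t) \<longleftrightarrow> same_angle s t"
proof -
  obtain \<tau> where \<tau>: "\<And>s. tangent_meeting f g s (\<tau> s)"
    using tangent_meeting_exists[OF f g] r by (metis order_refl)
  define z where "z s = cis (\<tau> s)" for s
  \<comment> \<open>The angle \<open>\<tau> s\<close> is an arbitrary choice; only its point on the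
    unit circle is canonical. That circle is compact, so a closed graph suffices, and a limit of
    tangential meetings is a tangential meeting.\<close>
  have cont: "continuous_on UNIV z"
  proof (rule continuous_from_closed_graph[of "sphere 0 1"])
    show "closed ((\<lambda>x. (x, z x)) ` UNIV)"
      unfolding closed_sequential_limits
    proof (intro allI impI, elim conjE)
      fix x and l :: "real \<times> complex"
      assume x: "\<forall>n. x n \<in> range (\<lambda>x. (x, z x))" and lim: "x \<longlonglongrightarrow> l"
      define \<sigma> where "\<sigma> n = fst (x n)" for n
      have \<sigma>: "x n = (\<sigma> n, z (\<sigma> n))" for n
      proof -
        have "x n \<in> range (\<lambda>x. (x, z x))" using x by blast
        then show ?thesis unfolding \<sigma>_def by auto
      qed
      have "\<exists>t. t \<in> {0..2*pi} \<and> same_angle (\<tau> (\<sigma> n)) t" for n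
        by (rule same_angle_rep[of "\<tau> (\<sigma> n)"]) force
      then obtain \<tau>' where \<tau>': "\<And>n. \<tau>' n \<in> {0..2*pi}" "\<And>n. same_angle (\<tau> (\<sigma> n)) (\<tau>' n)" by metis
      have tm: "tangent_meeting f g (\<sigma> n) (\<tau>' n)" for n
        using tangent_meeting_same_angle[OF f g \<tau> _ \<tau>'(2)] by blast
      have zc: "z (\<sigma> n) = cis (\<tau>' n)" for n
        using \<tau>'(2) same_angle_cis unfolding z_def by blast
      have "seq_compact {0..2*pi}" by (simp add: compact_imp_seq_compact)
      then obtain t \<rho> where t: "strict_mono (\<rho> :: nat \<Rightarrow> nat)" "(\<tau>' \<circ> \<rho>) \<longlonglongrightarrow> t"
        unfolding seq_compact_def using \<tau>'(1) by metis
      have "\<sigma> \<longlonglongrightarrow> fst l" using tendsto_fst[OF lim] \<sigma> by simp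
      then have s: "(\<sigma> \<circ> \<rho>) \<longlonglongrightarrow> fst l" using t(1) LIMSEQ_subseq_LIMSEQ by blast
      have "(\<lambda>n. z (\<sigma> n)) \<longlonglongrightarrow> snd l" using tendsto_snd[OF lim] \<sigma> by simp
      then have "((\<lambda>n. z (\<sigma> n)) \<circ> \<rho>) \<longlonglongrightarrow> snd l" using t(1) LIMSEQ_subseq_LIMSEQ by blast
      then have "(\<lambda>n. cis ((\<tau>' \<circ> \<rho>) n)) \<longlonglongrightarrow> snd l" by (simp add: o_def zc)
      moreover have "(\<lambda>n. cis ((\<tau>' \<circ> \<rho>) n)) \<longlonglongrightarrow> cis t"
        using t(2) by (intro tendsto_intros)
      ultimately have sl: "snd l = cis t" using LIMSEQ_unique by blast
      have cf: "(\<lambda>n. f ((\<sigma> \<circ> \<rho>) n)) \<longlonglongrightarrow> f (fst l)" and cg: "(\<lambda>n. g ((\<tau>' \<circ> \<rho>) n)) \<longlonglongrightarrow> g t"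
        using continuous_on_tendsto_compose[OF gen_continuous[OF f] s UNIV_I]
          continuous_on_tendsto_compose[OF gen_continuous[OF g] t(2) UNIV_I] by simp_all
      have e1: "f (fst l) = g t"
      proof (rule LIMSEQ_unique[OF cf])
        show "(\<lambda>n. f ((\<sigma> \<circ> \<rho>) n)) \<longlonglongrightarrow> g t"
          using cg tm unfolding tangent_meeting_def by (simp add: o_def)
      qed
      have df: "(\<lambda>n. vector_derivative f (at ((\<sigma> \<circ> \<rho>) n))) \<longlonglongrightarrow> vector_derivative f (at (fst l))"
        and dg: "(\<lambda>n. vector_derivative g (at ((\<tau>' \<circ> \<rho>) n))) \<longlonglongrightarrow> vector_derivative g (at t)"
        using continuous_on_tendsto_compose[OF gen_derivative_continuous[OF f] s UNIV_I]
          continuous_on_tendsto_compose[OF gen_derivative_continuous[OF g] t(2) UNIV_I] by simp_all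
      have "cross3 (vector_derivative f (at (fst l))) (vector_derivative g (at t)) = 0"
      proof (rule LIMSEQ_unique[OF tendsto_cross3[OF df dg]])
        show "(\<lambda>n. cross3 (vector_derivative f (at ((\<sigma> \<circ> \<rho>) n))) (vector_derivative g (at ((\<tau>' \<circ> \<rho>) n)))) \<longlonglongrightarrow> 0"
          using tm unfolding tangent_meeting_def by (simp add: o_def)
      qed
      then have "tangent_meeting f g (fst l) t" using e1 unfolding tangent_meeting_def by blast
      then have "same_angle t (\<tau> (fst l))" using tangent_meeting_unique[OF f g] \<tau> by blast
      then have "snd l = z (fst l)" unfolding sl z_def by (simp add: same_angle_cis)
      then show "l \<in> range (\<lambda>x. (x, z x))" by (metis prod.collapse rangeI)
    qed
  qed (auto simp: z_def)
  obtain L where L: "continuous_on UNIV L" "\<And>s. z s = exp (L s)"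
    using continuous_logarithm_on_contractible[OF cont] by (auto simp: z_def convex_imp_contractible)
  define \<phi> where "\<phi> s = Im (L s)" for s
  have c\<phi>: "continuous_on UNIV \<phi>" unfolding \<phi>_def by (intro continuous_intros L)
  have "cis (\<phi> s) = cis (\<tau> s)" for s
  proof -
    have e: "exp (L s) = cis (\<tau> s)" using L(2)[of s] unfolding z_def by simp
    then have "norm (exp (L s)) = 1" by simp
    then have "Re (L s) = 0" by simp
    then have "L s = \<i> * of_real (\<phi> s)" by (simp add: complex_eq_iff \<phi>_def)
    then show ?thesis using e by (simp add: cis_conv_exp)
  qed
  then have sa: "same_angle (\<tau> s) (\<phi> s)" for s by (simp add: same_angle_cis)
  have tm: "tangent_meeting f g s (\<phi> s)" for s
    using tangent_meeting_same_angle[OF f g \<tau> same_angle_refl sa] .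
  have iff: "same_angle (\<phi> s) (\<phi> t) \<longleftrightarrow> same_angle s t" for s t
  proof
    assume "same_angle (\<phi> s) (\<phi> t)"
    then have "tangent_meeting g f (\<phi> t) s"
      using tangent_meeting_same_angle[OF f g tm] tangent_meeting_sym by blast
    then show "same_angle s t"
      using tangent_meeting_unique[OF g f] tangent_meeting_sym[OF tm] by blast
  next
    assume "same_angle s t"
    then have "tangent_meeting f g t (\<phi> s)" using tangent_meeting_same_angle[OF f g tm] by blast
    then show "same_angle (\<phi> s) (\<phi> t)" using tangent_meeting_unique[OF f g] tm by blast
  qed
  \<comment> \<open>The integer \<open>k\<close> is the degree of the lift.\<close>
  obtain k :: int where k0: "\<phi> (0 + 2*pi) = \<phi> 0 + 2*pi * of_int k"
    using iff[of "0 + 2*pi" 0] same_angle_add[of 0 1 0] unfolding same_angle_def by auto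
  have k: "\<phi> (s + 2*pi) = \<phi> s + 2*pi * of_int k" for s
  proof -
    have "\<phi> (s + 2*pi) - \<phi> s = \<phi> (0 + 2*pi) - \<phi> 0"
    proof (rule multiple_2pi_constant[of UNIV "\<lambda>s. \<phi> (s + 2*pi)" \<phi>])
      show "continuous_on UNIV (\<lambda>s. \<phi> (s + 2*pi))"
        by (rule continuous_on_compose2[OF c\<phi>]) (auto intro!: continuous_intros)
      show "same_angle (\<phi> (s + 2*pi)) (\<phi> s)" for s
        using iff same_angle_add[of s 1 s] by simp
    qed (use c\<phi> in \<open>auto simp: connected_UNIV\<close>)
    then show ?thesis using k0 by simp
  qed
  \<comment> \<open>For degree zero, \<phi> would be periodic and
    \<open>\<phi> (s + pi) - \<phi> s\<close> would take opposite values at 0 and pi. A zero in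
    between identifies \<open>s\<close> with \<open>s + pi\<close>, against injectivity modulo 2
    pi.\<close>
  have "k \<noteq> 0"
  proof
    assume "k = 0"
    then have per: "\<phi> (s + 2*pi) = \<phi> s" for s using k by simp
    define \<psi> where "\<psi> s = \<phi> (s + pi) - \<phi> s" for s
    have c\<psi>: "continuous_on UNIV \<psi>" unfolding \<psi>_def
      by (intro continuous_intros continuous_on_compose2[OF c\<phi>]) auto
    have "\<psi> pi = - \<psi> 0" using per[of 0] unfolding \<psi>_def by (simp add: algebra_simps)
    have "\<exists>s. \<psi> s = 0"
    proof (cases "\<psi> 0 \<le> 0")
      case True
      then show ?thesis using IVT'[of \<psi> 0 0 pi] \<open>\<psi> pi = - \<psi> 0\<close> continuous_on_subset[OF c\<psi>]
        by (metis neg_0_le_iff_le pi_ge_zero subset_UNIV)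
    next
      case False
      then show ?thesis using IVT2'[of \<psi> pi 0 0] \<open>\<psi> pi = - \<psi> 0\<close> continuous_on_subset[OF c\<psi>]
        by (metis linorder_not_le neg_le_0_iff_le order.strict_implies_order pi_ge_zero subset_UNIV)
    qed
    then obtain s where "\<phi> (s + pi) = \<phi> s" unfolding \<psi>_def by auto
    then have "same_angle (s + pi) s" using iff same_angle_refl by metis
    then show False using same_angle_near[of "s + pi" s] by simp
  qed
  have kn: "\<phi> (s + 2*pi * of_nat n) = \<phi> s + 2*pi * of_int k * of_nat n" for s n
  proof (induction n)
    case (Suc n)
    then show ?case using k[of "s + 2*pi * of_nat n"] by (simp add: algebra_simps)
  qed simp
  have kz: "\<phi> (s + 2*pi * of_int j) = \<phi> s + 2*pi * of_int k * of_int j" for s j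
  proof (cases "j \<ge> 0")
    case True
    then show ?thesis using kn[of s "nat j"] by simp
  next
    case False
    then show ?thesis using kn[of "s + 2*pi * of_int j" "nat (-j)"] by simp
  qed
  have "inj \<phi>"
  proof (rule injI)
    fix s t assume e: "\<phi> s = \<phi> t"
    then have "same_angle s t" using iff same_angle_refl by metis
    then obtain j :: int where j: "s = t + 2*pi * of_int j" unfolding same_angle_def by blast
    then show "s = t" using kz[of t j] e \<open>k \<noteq> 0\<close> by simp
  qed
  then have mono: "strict_mono \<phi> \<or> strict_antimono_on UNIV \<phi>"
    using injective_eq_monotone_map[OF is_interval_univ c\<phi>] by simp
  have "surj \<phi>"
  proof -
    have "y \<in> range \<phi>" for y
    proof -
      \<comment> \<open>With the sign of \<open>k\<close> as a factor, the parameters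
        \<open>2*pi*N\<close> and its negative are arranged so that their images lie above and below
        \<open>y\<close>, whether \<phi> increases or decreases.\<close>
      define N where "N = \<lceil>\<bar>y - \<phi> 0\<bar> / (2*pi)\<rceil>"
      have "\<bar>y - \<phi> 0\<bar> / (2*pi) \<le> of_int N" unfolding N_def by linarith
      then have N: "\<bar>y - \<phi> 0\<bar> \<le> 2*pi * of_int N" by (simp add: field_simps)
      have le: "2*pi * of_int N \<le> 2*pi * of_int (\<bar>k\<bar> * N)"
      proof -
        have "0 \<le> 2*pi*real_of_int N" using N by linarith
        then have "0 \<le> real_of_int N" using pi_gt_zero unfolding zero_le_mult_iff by linarith
        then have "0 \<le> N" by simp
        then have "1 * N \<le> \<bar>k\<bar> * N" using \<open>k \<noteq> 0\<close> by (intro mult_right_mono) auto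
        then have "real_of_int N \<le> of_int (\<bar>k\<bar> * N)" by (metis mult_1 of_int_le_iff)
        then show ?thesis by (intro mult_left_mono) auto
      qed
      have a: "\<phi> (2*pi * of_int (sgn k * N)) = \<phi> 0 + 2*pi * of_int (\<bar>k\<bar> * N)"
        and b: "\<phi> (2*pi * of_int (sgn k * - N)) = \<phi> 0 - 2*pi * of_int (\<bar>k\<bar> * N)"
      proof -
        have e: "k * (sgn k * N) = \<bar>k\<bar> * N" "k * (sgn k * - N) = - (\<bar>k\<bar> * N)" by (simp_all add: abs_sgn)
        have kj: "\<phi> (2*pi * of_int j) = \<phi> 0 + 2*pi * of_int (k * j)" for j
          using kz[of 0 j] by (simp add: mult.assoc)
        show "\<phi> (2*pi * of_int (sgn k * N)) = \<phi> 0 + 2*pi * of_int (\<bar>k\<bar> * N)"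
          "\<phi> (2*pi * of_int (sgn k * - N)) = \<phi> 0 - 2*pi * of_int (\<bar>k\<bar> * N)"
          unfolding kj e by simp_all
      qed
      have "connected (range \<phi>)" using connected_continuous_image[OF c\<phi>] connected_UNIV by blast
      then have "is_interval (range \<phi>)" by (simp add: is_interval_connected_1)
      moreover have "\<phi> 0 - 2*pi * of_int (\<bar>k\<bar> * N) \<in> range \<phi>" "\<phi> 0 + 2*pi * of_int (\<bar>k\<bar> * N) \<in> range \<phi>"
        by (subst b[symmetric], rule rangeI) (subst a[symmetric], rule rangeI)
      moreover have "\<phi> 0 - 2*pi * of_int (\<bar>k\<bar> * N) \<le> y" "y \<le> \<phi> 0 + 2*pi * of_int (\<bar>k\<bar> * N)"
        using N le by linarith+
      ultimately show ?thesis unfolding is_interval_1 by blast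
    qed
    then show ?thesis by auto
  qed
  moreover have "f = g \<circ> \<phi>" using tm unfolding tangent_meeting_def by auto
  ultimately show ?thesis using that c\<phi> mono iff by blast
qed

lemma double_points_reparam:
  assumes f: "generic_immersion f" and g: "generic_immersion g" and "f = g \<circ> \<phi>" "surj \<phi>"
    and "\<And>s t. same_angle (\<phi> s) (\<phi> t) \<longleftrightarrow> same_angle s t"
  shows "double_points f = double_points g"
proof (intro set_eqI)
  fix p
  show "p \<in> double_points f \<longleftrightarrow> p \<in> double_points g"
  proof
    assume "p \<in> double_points f"
    then obtain s t where "\<not> same_angle s t" "f s = p" "f t = p" unfolding double_points_iff[OF f] by blast
    then have "\<not> same_angle (\<phi> s) (\<phi> t)" "g (\<phi> s) = p" "g (\<phi> t) = p" using assms(3,5) by auto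
    then show "p \<in> double_points g" unfolding double_points_iff[OF g] by blast
  next
    assume "p \<in> double_points g"
    then obtain s t where st: "\<not> same_angle s t" "g s = p" "g t = p" unfolding double_points_iff[OF g] by blast
    obtain s' t' where "s = \<phi> s'" "t = \<phi> t'" using surjD[OF assms(4)] by blast
    then have "\<not> same_angle s' t'" "f s' = p" "f t' = p" using st assms(3,5) by auto
    then show "p \<in> double_points f" unfolding double_points_iff[OF f] by blast
  qed
qed

text \<open>Independence of the orientation: a decreasing \<phi> turns incoming ends into outgoing
  ones, so the same two arcs serve with \<alpha> and \<beta> exchanged.\<close>

lemma A_inv_smoothing_reparam:
  assumes cont: "continuous_on UNIV \<phi>" and mono: "strict_mono \<phi> \<or> strict_antimono_on UNIV \<phi>"
    and surj: "surj \<phi>" and sm: "A_inv_smoothing (g \<circ> \<phi>) p r A"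
  shows "A_inv_smoothing g p r A"
proof -
  obtain a b c d \<alpha> \<beta> where *: "a < b" "c < d"
    "cap p r \<inter> range (g \<circ> \<phi>) = (g \<circ> \<phi>) ` {a..b} \<union> (g \<circ> \<phi>) ` {c..d}"
    "(g \<circ> \<phi>) ` {a..b} \<inter> (g \<circ> \<phi>) ` {c..d} = {p}"
    "\<forall>u\<in>{a, b, c, d}. dist p ((g \<circ> \<phi>) u) = r"
    "\<forall>u\<in>{a<..<b} \<union> {c<..<d}. dist p ((g \<circ> \<phi>) u) < r"
    "arc \<alpha>" "pathstart \<alpha> = (g \<circ> \<phi>) a" "pathfinish \<alpha> = (g \<circ> \<phi>) c"
    "arc \<beta>" "pathstart \<beta> = (g \<circ> \<phi>) b" "pathfinish \<beta> = (g \<circ> \<phi>) d"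
    "path_image \<alpha> \<subseteq> cap p r" "path_image \<alpha> \<inter> sphere p r = {(g \<circ> \<phi>) a, (g \<circ> \<phi>) c}"
    "path_image \<beta> \<subseteq> cap p r" "path_image \<beta> \<inter> sphere p r = {(g \<circ> \<phi>) b, (g \<circ> \<phi>) d}"
    "path_image \<alpha> \<inter> path_image \<beta> = {}" "A = path_image \<alpha> \<union> path_image \<beta>"
    using sm unfolding A_inv_smoothing_def by (elim exE conjE) (rule that)
  have rg: "range (g \<circ> \<phi>) = range g" using surj by (metis image_comp)
  from mono show ?thesis
  proof
    assume m: "strict_mono \<phi>"
    have cl: "\<phi> ` {x..y} = {\<phi> x..\<phi> y}" and op: "\<phi> ` {x<..<y} = {\<phi> x<..<\<phi> y}" for x y
    proof -
      have "z \<in> \<phi> ` {x..y} \<longleftrightarrow> z \<in> {\<phi> x..\<phi> y}" "z \<in> \<phi> ` {x<..<y} \<longleftrightarrow> z \<in> {\<phi> x<..<\<phi> y}" for z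
      proof -
        obtain w where w: "z = \<phi> w" using surjD[OF surj] by blast
        have inj: "\<phi> w \<in> \<phi> ` S \<longleftrightarrow> w \<in> S" for S
          using inj_image_mem_iff[OF strict_mono_imp_inj_on[OF m]] .
        show "z \<in> \<phi> ` {x..y} \<longleftrightarrow> z \<in> {\<phi> x..\<phi> y}" "z \<in> \<phi> ` {x<..<y} \<longleftrightarrow> z \<in> {\<phi> x<..<\<phi> y}"
          unfolding w inj by (simp_all add: strict_mono_less[OF m] strict_mono_less_eq[OF m])
      qed
      then show "\<phi> ` {x..y} = {\<phi> x..\<phi> y}" "\<phi> ` {x<..<y} = {\<phi> x<..<\<phi> y}" by blast+
    qed
    have im: "(g \<circ> \<phi>) ` {x..y} = g ` {\<phi> x..\<phi> y}" for x y
      by (simp only: image_comp[symmetric] cl)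
    have int: "dist p (g u) < r" if "u \<in> {\<phi> a<..<\<phi> b} \<union> {\<phi> c<..<\<phi> d}" for u
      using that *(6) unfolding op[symmetric] by auto
    show ?thesis
      unfolding A_inv_smoothing_def
      apply (rule exI[of _ "\<phi> a"], rule exI[of _ "\<phi> b"], rule exI[of _ "\<phi> c"], rule exI[of _ "\<phi> d"])
      apply (rule exI[of _ \<alpha>], rule exI[of _ \<beta>])
      using *[unfolded im rg] m int by (simp add: strict_mono_less)
  next
    assume m: "strict_antimono_on UNIV \<phi>"
    have lt: "\<phi> x < \<phi> y \<longleftrightarrow> y < x" for x y
      using m unfolding monotone_on_def by (metis UNIV_I linorder_less_linear order_less_asym)
    then have le: "\<phi> x \<le> \<phi> y \<longleftrightarrow> y \<le> x" for x y by (metis linorder_not_le)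
    have cl: "\<phi> ` {x..y} = {\<phi> y..\<phi> x}" and op: "\<phi> ` {x<..<y} = {\<phi> y<..<\<phi> x}" for x y
    proof -
      have "z \<in> \<phi> ` {x..y} \<longleftrightarrow> z \<in> {\<phi> y..\<phi> x}" "z \<in> \<phi> ` {x<..<y} \<longleftrightarrow> z \<in> {\<phi> y<..<\<phi> x}" for z
      proof -
        obtain w where w: "z = \<phi> w" using surjD[OF surj] by blast
        have "inj \<phi>" by (rule injI) (metis le order_antisym order_refl)
        then have inj: "\<phi> w \<in> \<phi> ` S \<longleftrightarrow> w \<in> S" for S by (rule inj_image_mem_iff)
        show "z \<in> \<phi> ` {x..y} \<longleftrightarrow> z \<in> {\<phi> y..\<phi> x}" "z \<in> \<phi> ` {x<..<y} \<longleftrightarrow> z \<in> {\<phi> y<..<\<phi> x}"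
          unfolding w inj by (auto simp: lt le)
      qed
      then show "\<phi> ` {x..y} = {\<phi> y..\<phi> x}" "\<phi> ` {x<..<y} = {\<phi> y<..<\<phi> x}" by blast+
    qed
    have im: "(g \<circ> \<phi>) ` {x..y} = g ` {\<phi> y..\<phi> x}" for x y
      by (simp only: image_comp[symmetric] cl)
    have int: "dist p (g u) < r" if "u \<in> {\<phi> b<..<\<phi> a} \<union> {\<phi> d<..<\<phi> c}" for u
      using that *(6) unfolding op[symmetric] by auto
    show ?thesis
      unfolding A_inv_smoothing_def
      apply (rule exI[of _ "\<phi> b"], rule exI[of _ "\<phi> a"], rule exI[of _ "\<phi> d"], rule exI[of _ "\<phi> c"])
      apply (rule exI[of _ \<beta>], rule exI[of _ \<alpha>])
      using *[unfolded im rg] lt int by (simp add: Int_commute Un_commute)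
  qed
qed

text \<open>Double points and admissible smoothings survive the change of parameter, so one fixed
  parametrization already sees all resolutions of the projection.\<close>

lemma tau_eq:
  assumes g: "generic_immersion g"
  shows "tau (range g) = {C. \<exists>R. A_inv_resolution g R \<and> sphere_isotopic (components R) C}"
proof -
  have "A_inv_resolution g R" if f: "generic_immersion f" and r: "range f = range g"
    and res: "A_inv_resolution f R" for f R
  proof -
    obtain \<phi> where \<phi>: "continuous_on UNIV \<phi>" "strict_mono \<phi> \<or> strict_antimono_on UNIV \<phi>" "surj \<phi>"
      "f = g \<circ> \<phi>" "\<And>s t. same_angle (\<phi> s) (\<phi> t) \<longleftrightarrow> same_angle s t"
      using reparametrization[OF f g r] by metis
    have d: "double_points f = double_points g" using double_points_reparam f g \<phi> by blast
    have sm: "A_inv_smoothing f p r A \<Longrightarrow> A_inv_smoothing g p r A" for p r A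
      using A_inv_smoothing_reparam \<phi> by blast
    show ?thesis
      using res sm unfolding A_inv_resolution_def d r by blast
  qed
  then show ?thesis unfolding tau_def using g by blast
qed

subsection \<open>The circles of a resolution\<close>

text \<open>The passes of the curve through its double points are listed in order as \<open>T i\<close>, with integer
  indices so that one turn of the circle shifts the index by \<open>N\<close>; \<open>m\<close> is the Gauss diagram.\<close>

locale gauss_curve =
  fixes g :: "real \<Rightarrow> real^3" and N :: int and T :: "int \<Rightarrow> real" and m :: "int \<Rightarrow> int"
  assumes gen: "generic_immersion g"
    and N_pos: "0 < N"
    and T_mono: "strict_mono T"
    and T_shift: "T (i + N * k) = T i + 2*pi * of_int k"
    and meet: "g s = g t \<longleftrightarrow> same_angle s t \<or> (\<exists>i. s = T i \<and> same_angle t (T (m i)))"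
    and m_neq: "m i \<noteq> i + N * k"
begin

lemma same_angle_T: "same_angle (T i) (T j) \<longleftrightarrow> (\<exists>k. i = j + N * k)"
  unfolding same_angle_def using T_shift strict_mono_eq[OF T_mono] by metis

lemma same_angle_T': "same_angle t (T i) \<longleftrightarrow> (\<exists>k. t = T (i + N * k))"
  unfolding same_angle_def T_shift ..

lemma g_T_m: "g (T (m i)) = g (T i)"
  using meet by (metis same_angle_refl)

lemma g_T_iff: "g (T i) = g (T j) \<longleftrightarrow> (\<exists>k. i = j + N * k) \<or> (\<exists>k. i = m j + N * k)"
proof -
  have "g (T i) = g (T j) \<longleftrightarrow> g (T j) = g (T i)" by auto
  also have "\<dots> \<longleftrightarrow> same_angle (T j) (T i) \<or> (\<exists>i'. T j = T i' \<and> same_angle (T i) (T (m i')))"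
    by (rule meet)
  also have "\<dots> \<longleftrightarrow> same_angle (T i) (T j) \<or> same_angle (T i) (T (m j))"
    using strict_mono_eq[OF T_mono] same_angle_sym by metis
  finally show ?thesis unfolding same_angle_T .
qed

lemma g_eq_T: "g u = g (T i) \<Longrightarrow> \<exists>j. u = T j"
  using meet[of u "T i"] same_angle_T' by metis

lemma g_eq_not_T: "g u = g v \<Longrightarrow> (\<And>j. u \<noteq> T j) \<Longrightarrow> same_angle u v"
  using meet by blast

text \<open>The matching is an involution only modulo full turns. It follows from
  \<open>meet\<close>: among the passes through one point, \<open>m (m i)\<close> is one, and
  \<open>m_neq\<close> excludes that it is equivalent to \<open>m i\<close>.\<close>

lemma m_m: "\<exists>k. m (m i) = i + N * k"
proof -
  have "g (T i) = g (T (m i))" by (simp add: g_T_m)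
  then consider k where "i = m i + N * k" | k where "i = m (m i) + N * k" unfolding g_T_iff by blast
  then show ?thesis
  proof cases
    case 1
    then have "m i = i + N * (-k)" by simp
    then show ?thesis using m_neq by blast
  next
    case 2
    then have "m (m i) = i + N * (-k)" by simp
    then show ?thesis by blast
  qed
qed

lemma m_shift: "\<exists>l. m (i + N * k) = m i + N * l"
proof -
  have "g (T (m (i + N * k))) = g (T i)"
    unfolding g_T_m by (simp add: g_T_iff)
  then consider l where "m (i + N * k) = i + N * l" | l where "m (i + N * k) = m i + N * l" unfolding g_T_iff by blast
  then show ?thesis
  proof cases
    case 1
    then have "m (i + N * k) = (i + N * k) + N * (l - k)" by (simp add: algebra_simps)
    then show ?thesis using m_neq by blast
  qed blast
qed

lemma double_points_T: "double_points g = range (\<lambda>i. g (T i))"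
proof (intro set_eqI iffI)
  fix p assume "p \<in> double_points g"
  then obtain s t where st: "\<not> same_angle s t" "g s = p" "g t = p" unfolding double_points_iff[OF gen] by blast
  then obtain i where "s = T i" using meet by metis
  then show "p \<in> range (\<lambda>i. g (T i))" using st by blast
next
  fix p assume "p \<in> range (\<lambda>i. g (T i))"
  then obtain i where p: "p = g (T i)" by blast
  have "\<not> same_angle (T (m i)) (T i)" using same_angle_T m_neq by metis
  then show "p \<in> double_points g" unfolding double_points_iff[OF gen] using p g_T_m by blast
qed

lemma T_between: "T i < u \<Longrightarrow> u < T (i + 1) \<Longrightarrow> u \<noteq> T j"
  using strict_mono_less[OF T_mono] by (metis zless_imp_add1_zle linorder_not_less)

lemma T_locate: obtains i where "T i \<le> u" "u < T (i + 1)"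
proof -
  define k where "k = \<lfloor>(u - T 0) / (2*pi)\<rfloor>"
  have "of_int k \<le> (u - T 0) / (2*pi)" "(u - T 0) / (2*pi) < of_int k + 1" unfolding k_def by linarith+
  then have "T 0 + 2*pi * of_int k \<le> u" "u < T 0 + 2*pi * of_int (k + 1)"
    by (simp_all add: field_simps)
  then have l: "T (N * k) \<le> u" and r: "u < T (N * (k + 1))" using T_shift[of 0] by simp_all
  define J where "J = {j \<in> {N * k..N * (k + 1)}. T j \<le> u}"
  have "finite J" by (rule finite_subset[of _ "{N * k..N * (k + 1)}"]) (auto simp: J_def)
  moreover have "N * k \<in> J" unfolding J_def using l N_pos by (auto simp: algebra_simps)
  ultimately have J: "finite J" "N * k \<in> J" by blast+
  define i where "i = Max J"
  have i: "i \<in> J" unfolding i_def using J Max_in by blast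
  have "\<not> T (i + 1) \<le> u"
  proof
    assume a: "T (i + 1) \<le> u"
    then have "T (i + 1) < T (N * (k + 1))" using r by simp
    then have "i + 1 < N * (k + 1)" using strict_mono_less[OF T_mono] by blast
    then have "i + 1 \<in> J" using a i unfolding J_def by auto
    then have "i + 1 \<le> i" unfolding i_def using J(1) Max_ge by blast
    then show False by simp
  qed
  then show ?thesis using that i unfolding J_def by force
qed

end

section \<open>Strands inside the discs and edges between them\<close>

text \<open>The component count uses the smoothing arcs only as compact connected sets, so their
  parametrizations are dropped here.\<close>

lemma A_inv_smoothing_arcs:
  assumes "A_inv_smoothing g p r A"
    and "\<And>a b c d B B'. \<lbrakk>a < b; c < d; cap p r \<inter> range g = g ` {a..b} \<union> g ` {c..d};
        g ` {a..b} \<inter> g ` {c..d} = {p};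
        \<forall>u\<in>{a, b, c, d}. dist p (g u) = r; \<forall>u\<in>{a<..<b} \<union> {c<..<d}. dist p (g u) < r;
        compact B; connected B; compact B'; connected B';
        B \<subseteq> cap p r; B' \<subseteq> cap p r; B \<inter> sphere p r = {g a, g c}; B' \<inter> sphere p r = {g b, g d};
        B \<inter> B' = {}; A = B \<union> B'\<rbrakk> \<Longrightarrow> thesis"
  shows thesis
proof -
  obtain a b c d \<alpha> \<beta> where *: "a < b" "c < d"
    "cap p r \<inter> range g = g ` {a..b} \<union> g ` {c..d}"
    "g ` {a..b} \<inter> g ` {c..d} = {p}"
    "\<forall>u\<in>{a, b, c, d}. dist p (g u) = r"
    "\<forall>u\<in>{a<..<b} \<union> {c<..<d}. dist p (g u) < r"
    "arc \<alpha>" "pathstart \<alpha> = g a" "pathfinish \<alpha> = g c"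
    "arc \<beta>" "pathstart \<beta> = g b" "pathfinish \<beta> = g d"
    "path_image \<alpha> \<subseteq> cap p r" "path_image \<alpha> \<inter> sphere p r = {g a, g c}"
    "path_image \<beta> \<subseteq> cap p r" "path_image \<beta> \<inter> sphere p r = {g b, g d}"
    "path_image \<alpha> \<inter> path_image \<beta> = {}" "A = path_image \<alpha> \<union> path_image \<beta>"
    using assms(1) unfolding A_inv_smoothing_def by (elim exE conjE) (rule that)
  show ?thesis
    by (rule assms(2)[of a b c d "path_image \<alpha>" "path_image \<beta>"])
      (use * in \<open>auto simp: compact_arc_image connected_arc_image\<close>)
qed

text \<open>Nothing bounds the radii from above, because \<tau> collects the resolutions for every
  admissible choice of discs.\<close>

locale gauss_resolution = gauss_curve +
  fixes r :: "real^3 \<Rightarrow> real" and A :: "real^3 \<Rightarrow> (real^3) set"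
  assumes smoothing: "p \<in> double_points g \<Longrightarrow> A_inv_smoothing g p (r p) (A p)"
    and disj: "disjoint_family_on (\<lambda>p. cap p (r p)) (double_points g)"
begin

text \<open>The ends are the first exits from the disc in both directions from \<open>T i\<close>.
  An end of one such interval cannot lie inside another, where the distance is strictly below the
  radius; this is why the interval depends on \<open>i\<close> only.\<close>

definition strand :: "int \<Rightarrow> real \<Rightarrow> real \<Rightarrow> bool" where
  "strand i x y \<longleftrightarrow> x < T i \<and> T i < y \<and>
     dist (g (T i)) (g x) = r (g (T i)) \<and> dist (g (T i)) (g y) = r (g (T i)) \<and>
     (\<forall>u\<in>{x<..<y}. dist (g (T i)) (g u) < r (g (T i)))"

lemma strand_unique:
  assumes "strand i x y" "strand i x' y'"
  shows "x = x'" "y = y'"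
proof -
  have *: "x < T i" "T i < y" "x' < T i" "T i < y'"
    "dist (g (T i)) (g x) = r (g (T i))" "dist (g (T i)) (g y) = r (g (T i))"
    "dist (g (T i)) (g x') = r (g (T i))" "dist (g (T i)) (g y') = r (g (T i))"
    using assms unfolding strand_def by blast+
  have out: "\<not> dist (g (T i)) (g u) = r (g (T i))" if "u \<in> {x<..<y} \<or> u \<in> {x'<..<y'}" for u
    using assms that unfolding strand_def by (metis order_less_irrefl)
  show "x = x'" using out[of x] out[of x'] * by (cases x x' rule: linorder_cases) auto
  show "y = y'" using out[of y] out[of y'] * by (cases y y' rule: linorder_cases) auto
qed

lemma strand_shift:
  assumes "strand i x y"
  shows "strand (i + N * k) (x + 2*pi * of_int k) (y + 2*pi * of_int k)"
proof -
  have "dist (g (T i)) (g u) < r (g (T i))" if "u \<in> {x + 2*pi * of_int k<..<y + 2*pi * of_int k}" for u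
  proof -
    have "u - 2*pi * of_int k \<in> {x<..<y}" using that by auto
    then have "dist (g (T i)) (g (u - 2*pi * of_int k)) < r (g (T i))"
      using assms unfolding strand_def by blast
    then show ?thesis using gen_periodic[OF gen, of "u - 2*pi * of_int k" k] by simp
  qed
  then show ?thesis
    using assms unfolding strand_def T_shift gen_periodic[OF gen] by simp
qed

lemma strand_image_shift: "g ` {x + 2*pi * of_int k..y + 2*pi * of_int k} = g ` {x..y}"
proof -
  have "{x + 2*pi * of_int k..y + 2*pi * of_int k} = (\<lambda>u. u + 2*pi * of_int k) ` {x..y}" by simp
  then show ?thesis by (simp only: image_comp) (simp add: o_def gen_periodic[OF gen])
qed

text \<open>Whatever parameter intervals the smoothing at \<open>g (T i)\<close> uses, a shift by full turns and
  possibly an exchange of the two strands makes them neighbourhoods of \<open>T i\<close> and \<open>T (m i)\<close>.\<close>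

lemma smoothing_at_pass:
  "\<exists>x y x' y' B B'. strand i x y \<and> strand (m i) x' y' \<and>
     cap (g (T i)) (r (g (T i))) \<inter> range g = g ` {x..y} \<union> g ` {x'..y'} \<and>
     g ` {x..y} \<inter> g ` {x'..y'} = {g (T i)} \<and>
     compact B \<and> connected B \<and> compact B' \<and> connected B' \<and>
     B \<subseteq> cap (g (T i)) (r (g (T i))) \<and> B' \<subseteq> cap (g (T i)) (r (g (T i))) \<and>
     B \<inter> sphere (g (T i)) (r (g (T i))) = {g x, g x'} \<and>
     B' \<inter> sphere (g (T i)) (r (g (T i))) = {g y, g y'} \<and>
     B \<inter> B' = {} \<and> A (g (T i)) = B \<union> B'"
proof -
  let ?p = "g (T i)"
  have "A_inv_smoothing g ?p (r ?p) (A ?p)" using smoothing double_points_T by blast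
  then obtain a b c d B B' where *: "a < b" "c < d" "cap ?p (r ?p) \<inter> range g = g ` {a..b} \<union> g ` {c..d}"
        "g ` {a..b} \<inter> g ` {c..d} = {?p}"
        "\<forall>u\<in>{a, b, c, d}. dist ?p (g u) = r ?p" "\<forall>u\<in>{a<..<b} \<union> {c<..<d}. dist ?p (g u) < r ?p"
        "compact B" "connected B" "compact B'" "connected B'"
        "B \<subseteq> cap ?p (r ?p)" "B' \<subseteq> cap ?p (r ?p)"
        "B \<inter> sphere ?p (r ?p) = {g a, g c}" "B' \<inter> sphere ?p (r ?p) = {g b, g d}"
        "B \<inter> B' = {}" "A ?p = B \<union> B'"
    by (elim A_inv_smoothing_arcs) (rule that)
  have "(a + b) / 2 \<in> {a<..<b} \<union> {c<..<d}" using *(1) by simp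
  then have "dist ?p (g ((a + b) / 2)) < r ?p" using *(6) by blast
  then have pos: "0 < r ?p" by (rule order_le_less_trans[OF zero_le_dist])
  have "?p \<in> g ` {a..b} \<inter> g ` {c..d}" unfolding *(4) by simp
  then obtain s t where s: "s \<in> {a..b}" "g s = ?p" and t: "t \<in> {c..d}" "g t = ?p" by force
  have "s \<noteq> a" "s \<noteq> b" "t \<noteq> c" "t \<noteq> d" using s t *(5) pos by auto
  then have s': "s \<in> {a<..<b}" and t': "t \<in> {c<..<d}" using s(1) t(1) by auto
  obtain j where j: "s = T j" using g_eq_T s by blast
  obtain l where l: "t = T l" using g_eq_T t by blast
  have sj: "strand j a b" and sl: "strand l c d"
    unfolding strand_def using s' t' s t *(5,6) j l by auto
  \<comment> \<open>Equivalent passes would have the same strand as image. The intersection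
    \<open>{?p}\<close> would then contain \<open>g a\<close>, which is at positive distance from
    \<open>?p\<close>.\<close>
  have ne: "\<not> (\<exists>k. j = l + N * k)"
  proof
    assume "\<exists>k. j = l + N * k"
    then obtain k where k: "j = l + N * k" by blast
    have e: "a = c + 2*pi * of_int k" "b = d + 2*pi * of_int k"
      using strand_unique[OF sj] strand_shift[OF sl, of k] k by blast+
    have "g ` {a..b} = g ` {c..d}" unfolding e by (rule strand_image_shift)
    then have "g a \<in> {?p}" using *(1,4) by auto
    then show False using *(5) pos by auto
  qed
  have jl: "(\<exists>k. j = i + N * k) \<or> (\<exists>k. j = m i + N * k)" "(\<exists>k. l = i + N * k) \<or> (\<exists>k. l = m i + N * k)"
    using g_T_iff j l s t by metis+
  have same: "\<exists>k. x = y + N * k" if "x = z + N * k1" "y = z + N * k2" for x y z k1 k2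
    by (rule exI[of _ "k1 - k2"]) (use that in \<open>simp add: algebra_simps\<close>)
  have unshift: "strand z (x - 2*pi * of_int k) (y - 2*pi * of_int k) \<and>
      g ` {x - 2*pi * of_int k..y - 2*pi * of_int k} = g ` {x..y} \<and>
      g (x - 2*pi * of_int k) = g x \<and> g (y - 2*pi * of_int k) = g y"
    if "strand w x y" "w = z + N * k" for w z x y k
    using strand_shift[OF that(1), of "-k"] strand_image_shift[of x "-k" y]
      gen_periodic[OF gen, of x "-k"] gen_periodic[OF gen, of y "-k"] that(2) by simp
  from jl ne same consider k k' where "j = i + N * k" "l = m i + N * k'"
    | k k' where "j = m i + N * k" "l = i + N * k'" by metis
  then show ?thesis
  proof cases
    case 1
    show ?thesis
      apply (rule exI[of _ "a - 2*pi * of_int k"], rule exI[of _ "b - 2*pi * of_int k"])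
      apply (rule exI[of _ "c - 2*pi * of_int k'"], rule exI[of _ "d - 2*pi * of_int k'"])
      apply (rule exI[of _ B], rule exI[of _ B'])
      using unshift[OF sj 1(1)] unshift[OF sl 1(2)] * by simp
  next
    case 2
    show ?thesis
      apply (rule exI[of _ "c - 2*pi * of_int k'"], rule exI[of _ "d - 2*pi * of_int k'"])
      apply (rule exI[of _ "a - 2*pi * of_int k"], rule exI[of _ "b - 2*pi * of_int k"])
      apply (rule exI[of _ B], rule exI[of _ B'])
      using unshift[OF sj 2(1)] unshift[OF sl 2(2)] * by (simp add: Un_commute Int_commute insert_commute)
  qed
qed

definition lo :: "int \<Rightarrow> real" where "lo i = (SOME x. \<exists>y. strand i x y)"
definition hi :: "int \<Rightarrow> real" where "hi i = (SOME y. \<exists>x. strand i x y)"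

lemma strand_lo_hi: "strand i (lo i) (hi i)"
proof -
  obtain x y where s: "strand i x y" using smoothing_at_pass[of i] by (elim exE conjE) (rule that)
  have "lo i = x" unfolding lo_def using s strand_unique(1) by blast
  moreover have "hi i = y" unfolding hi_def using s strand_unique(2) by blast
  ultimately show ?thesis using s by simp
qed

lemma lo_shift: "lo (i + N * k) = lo i + 2*pi * of_int k"
  and hi_shift: "hi (i + N * k) = hi i + 2*pi * of_int k"
  using strand_unique[OF strand_lo_hi strand_shift[OF strand_lo_hi]] by blast+

abbreviation disc :: "int \<Rightarrow> (real^3) set" where "disc i \<equiv> cap (g (T i)) (r (g (T i)))"

text \<open>The condition ranges over all passes through \<open>p\<close>, so that one pair of arcs
  serves both passes and their shifts by full turns.\<close>

definition arcs_at :: "real^3 \<Rightarrow> (real^3) set \<Rightarrow> (real^3) set \<Rightarrow> bool" where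
  "arcs_at p B B' \<longleftrightarrow> (\<forall>i. g (T i) = p \<longrightarrow>
     compact B \<and> connected B \<and> compact B' \<and> connected B' \<and> B \<subseteq> disc i \<and> B' \<subseteq> disc i \<and>
     {g (lo i), g (lo (m i))} \<subseteq> B \<and> {g (hi i), g (hi (m i))} \<subseteq> B' \<and>
     B \<inter> B' = {} \<and> A p = B \<union> B')"

lemma lo_shift_m: "g (lo (m (m i))) = g (lo i)" "g (hi (m (m i))) = g (hi i)"
  using m_m[of i] by (metis lo_shift hi_shift gen_periodic[OF gen])+

lemma g_lo_shift: "g (lo (i + N * k)) = g (lo i)" "g (hi (i + N * k)) = g (hi i)"
  unfolding lo_shift hi_shift gen_periodic[OF gen] by simp_all

lemma g_lo_m_shift: "g (lo (m (i + N * k))) = g (lo (m i))" "g (hi (m (i + N * k))) = g (hi (m i))"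
  using m_shift[of i k] g_lo_shift by metis+

lemma disc_strands: "disc i \<inter> range g = g ` {lo i..hi i} \<union> g ` {lo (m i)..hi (m i)}"
  and strands_meet: "g ` {lo i..hi i} \<inter> g ` {lo (m i)..hi (m i)} = {g (T i)}"
  and arcs_exist: "\<exists>B B'. arcs_at (g (T i)) B B'"
proof -
  obtain x y x' y' B B' where s: "strand i x y" "strand (m i) x' y'" and
     *: "disc i \<inter> range g = g ` {x..y} \<union> g ` {x'..y'}" "g ` {x..y} \<inter> g ` {x'..y'} = {g (T i)}"
     "compact B" "connected B" "compact B'" "connected B'" "B \<subseteq> disc i" "B' \<subseteq> disc i"
     "B \<inter> sphere (g (T i)) (r (g (T i))) = {g x, g x'}"
     "B' \<inter> sphere (g (T i)) (r (g (T i))) = {g y, g y'}"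
     "B \<inter> B' = {}" "A (g (T i)) = B \<union> B'"
    using smoothing_at_pass[of i] by (elim exE conjE) (rule that)
  have xy: "x = lo i" "y = hi i" "x' = lo (m i)" "y' = hi (m i)"
    using strand_unique s strand_lo_hi by blast+
  show "disc i \<inter> range g = g ` {lo i..hi i} \<union> g ` {lo (m i)..hi (m i)}"
    "g ` {lo i..hi i} \<inter> g ` {lo (m i)..hi (m i)} = {g (T i)}" using * unfolding xy by blast+
  have "arcs_at (g (T i)) B B'" unfolding arcs_at_def
  proof (intro allI impI)
    fix j assume j: "g (T j) = g (T i)"
    have lh: "{g (lo i), g (lo (m i))} \<subseteq> B" "{g (hi i), g (hi (m i))} \<subseteq> B'" using *(9,10) unfolding xy by blast+
    have "{g (lo j), g (lo (m j))} = {g (lo i), g (lo (m i))} \<and> {g (hi j), g (hi (m j))} = {g (hi i), g (hi (m i))}"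
      using j unfolding g_T_iff
    proof
      assume "\<exists>k. j = i + N * k"
      then obtain k where k: "j = i + N * k" by blast
      show ?thesis unfolding k g_lo_shift g_lo_m_shift by blast
    next
      assume "\<exists>k. j = m i + N * k"
      then obtain k where k: "j = m i + N * k" by blast
      show ?thesis unfolding k g_lo_shift g_lo_m_shift lo_shift_m by blast
    qed
    then show "compact B \<and> connected B \<and> compact B' \<and> connected B' \<and> B \<subseteq> disc j \<and> B' \<subseteq> disc j \<and>
     {g (lo j), g (lo (m j))} \<subseteq> B \<and> {g (hi j), g (hi (m j))} \<subseteq> B' \<and> B \<inter> B' = {} \<and> A (g (T i)) = B \<union> B'"
      using * lh j by simp
  qed
  then show "\<exists>B B'. arcs_at (g (T i)) B B'" by blast
qed

text \<open>The arc that joins the two incoming ends; \<open>out\<close> is the one for the outgoing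
  ends. The choice depends on the point \<open>g (T i)\<close> and not on the pass, which gives
  \<open>inn_cong\<close> and \<open>out_cong\<close> for free.\<close>

definition inn :: "int \<Rightarrow> (real^3) set" where
  "inn i = fst (SOME BB. arcs_at (g (T i)) (fst BB) (snd BB))"
definition out :: "int \<Rightarrow> (real^3) set" where
  "out i = snd (SOME BB. arcs_at (g (T i)) (fst BB) (snd BB))"

lemma arcs_inn_out: "arcs_at (g (T i)) (inn i) (out i)"
proof -
  have "\<exists>BB. arcs_at (g (T i)) (fst BB) (snd BB)" using arcs_exist[of i] by force
  then show ?thesis unfolding inn_def out_def by (rule someI_ex)
qed

lemma inn: "compact (inn i)" "connected (inn i)" "inn i \<subseteq> disc i" "g (lo i) \<in> inn i" "g (lo (m i)) \<in> inn i"
  and out: "compact (out i)" "connected (out i)" "out i \<subseteq> disc i" "g (hi i) \<in> out i" "g (hi (m i)) \<in> out i"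
  and inn_out: "inn i \<inter> out i = {}" "A (g (T i)) = inn i \<union> out i"
  using arcs_inn_out[of i] unfolding arcs_at_def by blast+

lemma inn_cong: "g (T i) = g (T j) \<Longrightarrow> inn i = inn j" 
  and out_cong: "g (T i) = g (T j) \<Longrightarrow> out i = out j"
  unfolding inn_def out_def by simp_all

lemma disc_disjoint: "x \<in> disc i \<Longrightarrow> x \<in> disc j \<Longrightarrow> g (T i) = g (T j)"
  using disj double_points_T unfolding disjoint_family_on_def by blast

lemma lo_T: "lo i < T i" and T_hi: "T i < hi i"
  using strand_lo_hi unfolding strand_def by blast+

lemma radius_pos: "0 < r (g (T i))"
  using strand_lo_hi[of i] unfolding strand_def
  by (metis greaterThanLessThan_iff zero_le_dist order_le_less_trans)

lemma strand_dist: "dist (g (T i)) (g (lo i)) = r (g (T i))" "dist (g (T i)) (g (hi i)) = r (g (T i))"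
  using strand_lo_hi[of i] unfolding strand_def by blast+

text \<open>Overlapping strands of consecutive passes would put a common point into both discs, so
  the passes would belong to the same double point. Two passes of one double point have strands that
  meet only at that point, and an overlap produces a second one.\<close>

lemma hi_lo: "hi i < lo (i + 1)"
proof (rule ccontr)
  assume "\<not> hi i < lo (i + 1)"
  then have le: "lo (i + 1) \<le> hi i" by simp
  have TT: "T i < T (i + 1)" using strict_mono_less[OF T_mono] by simp
  define u where "u = max (lo (i + 1)) (T i)"
  have u: "u \<in> {lo i..hi i}" "u \<in> {lo (i + 1)..hi (i + 1)}" "u < T (i + 1)"
    unfolding u_def using le lo_T[of i] lo_T[of "i + 1"] T_hi[of i] T_hi[of "i + 1"] TT by auto
  have "g u \<in> disc i" "g u \<in> disc (i + 1)"
    using disc_strands[of i] disc_strands[of "i + 1"] u by blast+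
  then have c: "g (T i) = g (T (i + 1))" by (rule disc_disjoint)
  then have "g (T (i + 1)) = g (T i)" by simp
  then consider k where "i + 1 = i + N * k" | k where "i + 1 = m i + N * k" unfolding g_T_iff by blast
  then show False
  proof cases
    case 1
    then have "N * k = 1" by simp
    then have "N = 1" using pos_zmult_eq_1_iff[OF N_pos] by blast
    then show False using m_neq[of i "m i - i"] by simp
  next
    \<comment> \<open>Here the curve returns to the same double point at the next pass, a loop.
      Every parameter common to both strand intervals then maps to the double point.\<close>
    case 2
    then have im: "g ` {lo (i + 1)..hi (i + 1)} = g ` {lo (m i)..hi (m i)}"
      using strand_image_shift[of "lo (m i)" k "hi (m i)"] by (simp add: lo_shift hi_shift)
    have p: "g v = g (T i)" if "v \<in> {lo i..hi i}" "v \<in> {lo (i + 1)..hi (i + 1)}" for v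
    proof -
      have "g v \<in> g ` {lo i..hi i} \<inter> g ` {lo (m i)..hi (m i)}" using that im by blast
      then show ?thesis unfolding strands_meet by blast
    qed
    show False
    proof (cases "lo (i + 1) \<le> T i")
      case True
      \<comment> \<open>This parameter lies in both strand intervals but strictly between two
        consecutive passes, so it cannot map to a double point.\<close>
      define v where "v = (T i + min (hi i) (T (i + 1))) / 2"
      have v: "T i < v" "v < hi i" "v < T (i + 1)" unfolding v_def using T_hi[of i] TT by (auto simp: min_def)
      then have "g v = g (T i)" using p[of v] True lo_T[of i] T_hi[of "i + 1"] by auto
      then show False using g_eq_T T_between v by blast
    next
      case False
      then have "lo (i + 1) = u" unfolding u_def by simp
      then have "g (lo (i + 1)) = g (T i)" using p u by blast
      then show False using strand_dist(1)[of "i + 1"] radius_pos[of "i + 1"] c by simp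
    qed
  qed
qed

lemma hi_mono: "i < j \<Longrightarrow> hi i < lo j"
proof -
  have "hi i < lo (i + 1 + int n)" for n
  proof (induction n)
    case 0
    then show ?case using hi_lo by simp
  next
    case (Suc n)
    then show ?case
      using lo_T[of "i + 1 + int n"] T_hi[of "i + 1 + int n"] hi_lo[of "i + 1 + int n"] by (simp add: algebra_simps)
  qed
  from this[of "nat (j - i - 1)"] show "i < j \<Longrightarrow> hi i < lo j" by simp
qed

lemma lo_hi: "lo i < hi i" using lo_T[of i] T_hi[of i] by simp

lemma between_unique:
  assumes "u \<in> {hi i..lo (i + 1)}" "u \<in> {hi j..lo (j + 1)}"
  shows "i = j"
proof (rule ccontr)
  assume "i \<noteq> j"
  then consider "i + 1 \<le> j" | "j + 1 \<le> i" by linarith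
  then show False
  proof cases
    case 1
    then have "lo (i + 1) < hi j" using lo_hi[of "i + 1"] hi_mono[of "i + 1" j] lo_hi[of j] by (cases "i + 1 = j") auto
    then show False using assms by simp
  next
    case 2
    then have "lo (j + 1) < hi i" using lo_hi[of "j + 1"] hi_mono[of "j + 1" i] lo_hi[of i] by (cases "j + 1 = i") auto
    then show False using assms by simp
  qed
qed

lemma edge_in_strand:
  assumes "u \<in> {hi i..lo (i + 1)}" "u \<in> {lo j..hi j}"
  shows "(j = i \<and> u = hi i) \<or> (j = i + 1 \<and> u = lo (i + 1))"
proof -
  consider "j < i" | "j = i" | "j = i + 1" | "i + 1 < j" by linarith
  then show ?thesis
  proof cases
    case 1
    then show ?thesis using hi_mono[of j i] lo_hi[of i] assms by auto
  next
    case 4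
    then show ?thesis using hi_mono[of "i + 1" j] lo_hi[of "i + 1"] assms by auto
  qed (use assms in auto)
qed

lemma edge_not_T:
  assumes "u \<in> {hi i..lo (i + 1)}" shows "u \<noteq> T j"
  using T_between[of i u j] assms T_hi[of i] lo_T[of "i + 1"] by auto

text \<open>A point of the curve in a disc lies on one of its strands. The parameter
  \<open>u\<close> is not a pass, so it agrees with the strand parameter up to full turns, and
  strand intervals touch the interval of an edge only at its ends.\<close>

lemma edge_in_disc:
  assumes u: "u \<in> {hi i..lo (i + 1)}" and d: "g u \<in> disc j"
  shows "(u = hi i \<and> g (T j) = g (T i)) \<or> (u = lo (i + 1) \<and> g (T j) = g (T (i + 1)))"
proof -
  have "g u \<in> g ` {lo j..hi j} \<union> g ` {lo (m j)..hi (m j)}" using d disc_strands by blast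
  then obtain l v where l: "l = j \<or> l = m j" "v \<in> {lo l..hi l}" "g u = g v" by blast
  have gl: "g (T l) = g (T j)" using l(1) g_T_m by auto
  have "same_angle u v" using g_eq_not_T l(3) edge_not_T[OF u] by blast
  then obtain k :: int where k: "u = v + 2*pi * of_int k" unfolding same_angle_def by blast
  then have "u \<in> {lo (l + N * k)..hi (l + N * k)}" using l(2) by (simp add: lo_shift hi_shift)
  moreover have "g (T (l + N * k)) = g (T l)" using g_T_iff by blast
  ultimately show ?thesis using edge_in_strand[OF u] gl by metis
qed

definition edge :: "int \<Rightarrow> (real^3) set" where "edge i = g ` {hi i..lo (i + 1)}"

lemma edge_interior_not_disc: "u \<in> {hi i<..<lo (i + 1)} \<Longrightarrow> g u \<notin> disc j"
  using edge_in_disc[of u i j] by auto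

lemma edges_meet: "edge i \<inter> edge j \<noteq> {} \<Longrightarrow> \<exists>k. i = j + N * k"
proof -
  assume "edge i \<inter> edge j \<noteq> {}"
  then obtain u v where uv: "u \<in> {hi i..lo (i + 1)}" "v \<in> {hi j..lo (j + 1)}" "g u = g v"
    unfolding edge_def by blast
  have "same_angle u v" using g_eq_not_T uv(3) edge_not_T[OF uv(1)] by blast
  then obtain k :: int where k: "u = v + 2*pi * of_int k" unfolding same_angle_def by blast
  have "u \<in> {hi (j + N * k)..lo (j + N * k + 1)}"
    using uv(2) lo_shift[of "j + 1" k] k by (simp add: hi_shift algebra_simps)
  then show ?thesis using between_unique[OF uv(1)] by blast
qed

lemma edge_shift: "edge (i + N * k) = edge i"
  unfolding edge_def using strand_image_shift[of "hi i" k "lo (i + 1)"] lo_shift[of "i + 1" k]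
  by (simp add: hi_shift algebra_simps)

definition resolved :: "(real^3) set" where
  "resolved = (range g - (\<Union>p\<in>double_points g. cap p (r p))) \<union> (\<Union>p\<in>double_points g. A p)"

text \<open>An edge with the smoothing arcs at both of its ends. Every arc belongs to the pieces of
  two edges, and following shared arcs from piece to piece traces the circles.\<close>

definition piece :: "int \<Rightarrow> (real^3) set" where
  "piece i = edge i \<union> out i \<union> inn (i + 1)"

lemma resolved_pieces: "resolved = (\<Union>i. piece i)"
proof
  show "resolved \<subseteq> (\<Union>i. piece i)"
  proof
    fix x assume "x \<in> resolved"
    then consider u where "x = g u" "\<And>i. g u \<notin> disc i" | i where "x \<in> A (g (T i))"
      unfolding resolved_def double_points_T by auto
    then show "x \<in> (\<Union>i. piece i)"
    proof cases
      case 1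
      obtain i where i: "T i \<le> u" "u < T (i + 1)" by (rule T_locate)
      have "u \<notin> {lo j..hi j}" for j using 1 disc_strands[of j] by blast
      from this[of i] this[of "i + 1"] have "u \<in> {hi i..lo (i + 1)}"
        using i lo_T[of i] T_hi[of "i + 1"] by auto
      then show ?thesis unfolding piece_def edge_def using 1 by blast
    next
      case 2
      \<comment> \<open>The incoming arc at the pass \<open>i\<close> ends the edge
        \<open>i - 1\<close>.\<close>
      then have "x \<in> inn (i - 1 + 1) \<or> x \<in> out i" using inn_out by auto
      then show ?thesis unfolding piece_def by blast
    qed
  qed
  show "(\<Union>i. piece i) \<subseteq> resolved"
  proof
    fix x assume "x \<in> (\<Union>i. piece i)"
    then obtain i where "x \<in> edge i \<or> x \<in> out i \<or> x \<in> inn (i + 1)" unfolding piece_def by blast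
    moreover have "x \<in> resolved" if "x \<in> out j \<or> x \<in> inn j" for j
      unfolding resolved_def double_points_T using that inn_out(2) by blast
    moreover have "x \<in> resolved" if "x \<in> edge i"
    proof -
      obtain u where u: "x = g u" "u \<in> {hi i..lo (i + 1)}" using \<open>x \<in> edge i\<close> unfolding edge_def by blast
      show ?thesis
      proof (cases "\<exists>j. x \<in> disc j")
        case True
        then obtain j where "g u \<in> disc j" using u by blast
        then consider "u = hi i" | "u = lo (i + 1)" using edge_in_disc u by blast
        then show ?thesis
          using u out(4)[of i] inn(4)[of "i + 1"] inn_out(2) unfolding resolved_def double_points_T by cases blast+
      next
        case False
        then show ?thesis unfolding resolved_def double_points_T using u by blast
      qed
    qed
    ultimately show "x \<in> resolved" by blast
  qed
qed

lemma piece_compact: "compact (piece i)"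
  unfolding piece_def edge_def
  by (intro compact_Un inn out compact_continuous_image gen_continuous[OF gen] compact_Icc)

lemma edge_ends: "g (hi i) \<in> edge i" "g (lo (i + 1)) \<in> edge i"
  unfolding edge_def using hi_lo[of i] by auto

lemma edge_connected: "connected (edge i)"
  unfolding edge_def by (intro connected_continuous_image gen_continuous[OF gen]) simp

lemma piece_connected: "connected (piece i)"
  unfolding piece_def
  by (intro connected_Un inn out edge_connected) (use edge_ends[of i] out(4)[of i] inn(4)[of "i + 1"] in blast)+

lemma piece_shift: "piece (i + N * k) = piece i"
proof -
  have "g (T (i + N * k)) = g (T i)" "g (T (i + N * k + 1)) = g (T (i + 1))"
    unfolding g_T_iff by (auto simp: algebra_simps)
  then show ?thesis unfolding piece_def edge_shift using inn_cong out_cong by blast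
qed

end

text \<open>A labelling of the edges that is invariant under both smoothing moves separates the resolution
  into closed pieces; these are its components as soon as every label class is linked.\<close>

locale coloured_resolution = gauss_resolution +
  fixes col :: "int \<Rightarrow> 'c"
  assumes col_shift: "col (i + N * k) = col i"
    and col_out: "col (m i) = col i"
    and col_inn: "col (m i - 1) = col (i - 1)"
    and linked: "col i = col j \<Longrightarrow> equivclp (\<lambda>a b. b = m a \<or> b = m (a + 1) - 1 \<or> (\<exists>k. b = a + N * k)) i j"
begin

definition circle :: "'c \<Rightarrow> (real^3) set" where
  "circle c = (\<Union>i\<in>{i. col i = c}. piece i)"

lemma col_cong: "g (T i) = g (T j) \<Longrightarrow> col i = col j"
  and col_cong': "g (T i) = g (T j) \<Longrightarrow> col (i - 1) = col (j - 1)"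
proof -
  assume "g (T i) = g (T j)"
  then consider k where "i = j + N * k" | k where "i = m j + N * k" unfolding g_T_iff by blast
  then have "col i = col j \<and> col (i - 1) = col (j - 1)"
  proof cases
    case 1
    then show ?thesis using col_shift[of j k] col_shift[of "j - 1" k] by (simp add: algebra_simps)
  next
    case 2
    then show ?thesis using col_shift[of "m j" k] col_shift[of "m j - 1" k] col_out[of j] col_inn[of j]
      by (simp add: algebra_simps)
  qed
  then show "col i = col j" "col (i - 1) = col (j - 1)" by blast+
qed

text \<open>The meeting point is an end of the edge. It cannot be the final one, because that lies
  on an incoming arc, which is disjoint from the outgoing arc at the same double point.\<close>

lemma edge_out_col: "edge i \<inter> out j \<noteq> {} \<Longrightarrow> col i = col j"
proof -
  assume "edge i \<inter> out j \<noteq> {}"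
  then obtain u where u: "u \<in> {hi i..lo (i + 1)}" "g u \<in> out j" unfolding edge_def by blast
  then have "g u \<in> disc j" using out(3) by blast
  from edge_in_disc[OF u(1) this] show "col i = col j"
  proof
    assume "u = hi i \<and> g (T j) = g (T i)"
    then show ?thesis using col_cong by metis
  next
    assume a: "u = lo (i + 1) \<and> g (T j) = g (T (i + 1))"
    then have "g u \<in> inn j" using inn(4)[of "i + 1"] inn_cong by metis
    then show ?thesis using inn_out(1)[of j] u(2) by blast
  qed
qed

lemma edge_inn_col: "edge i \<inter> inn (j + 1) \<noteq> {} \<Longrightarrow> col i = col j"
proof -
  assume "edge i \<inter> inn (j + 1) \<noteq> {}"
  then obtain u where u: "u \<in> {hi i..lo (i + 1)}" "g u \<in> inn (j + 1)" unfolding edge_def by blast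
  then have "g u \<in> disc (j + 1)" using inn(3) by blast
  from edge_in_disc[OF u(1) this] show "col i = col j"
  proof
    assume "u = lo (i + 1) \<and> g (T (j + 1)) = g (T (i + 1))"
    then show ?thesis using col_cong'[of "j + 1" "i + 1"] by simp
  next
    assume a: "u = hi i \<and> g (T (j + 1)) = g (T i)"
    then have "g u \<in> out (j + 1)" using out(4)[of i] out_cong by metis
    then show ?thesis using inn_out(1)[of "j + 1"] u(2) by blast
  qed
qed

text \<open>Arcs that meet belong to the same double point because the discs are disjoint, and there
  incoming and outgoing arcs are disjoint. So a common point always comes from one of the smoothing
  moves or from a shift.\<close>

lemma pieces_meet_col: "piece i \<inter> piece j \<noteq> {} \<Longrightarrow> col i = col j"
proof -
  assume "piece i \<inter> piece j \<noteq> {}"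
  then obtain x where x: "x \<in> edge i \<or> x \<in> out i \<or> x \<in> inn (i + 1)" "x \<in> edge j \<or> x \<in> out j \<or> x \<in> inn (j + 1)"
    unfolding piece_def by blast
  have oo: "x \<in> out i \<Longrightarrow> x \<in> out j \<Longrightarrow> col i = col j"
    using out(3) disc_disjoint col_cong by blast
  have ii: "x \<in> inn (i + 1) \<Longrightarrow> x \<in> inn (j + 1) \<Longrightarrow> col i = col j"
  proof -
    assume "x \<in> inn (i + 1)" "x \<in> inn (j + 1)"
    then have "g (T (i + 1)) = g (T (j + 1))" using inn(3) disc_disjoint by blast
    then show "col i = col j" using col_cong'[of "i + 1" "j + 1"] by simp
  qed
  have oi: "x \<in> out a \<Longrightarrow> x \<in> inn b \<Longrightarrow> False" for a b
  proof -
    assume a: "x \<in> out a" "x \<in> inn b"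
    then have "g (T a) = g (T b)" using out(3) inn(3) disc_disjoint by blast
    then have "x \<in> inn a" using a(2) inn_cong by metis
    then show False using a(1) inn_out(1) by blast
  qed
  have "x \<in> edge i \<Longrightarrow> x \<in> edge j \<Longrightarrow> col i = col j" using edges_meet col_shift by blast
  then show "col i = col j"
    using x oo ii oi edge_out_col[of i j] edge_out_col[of j i] edge_inn_col[of i j] edge_inn_col[of j i]
    by (metis disjoint_iff)
qed

lemma circles_disjoint: "c \<noteq> c' \<Longrightarrow> circle c \<inter> circle c' = {}"
  unfolding circle_def using pieces_meet_col by blast

lemma circle_compact: "compact (circle c)"
proof -
  have "circle c = (\<Union>i\<in>{i \<in> {0..<N}. col i = c}. piece i)"
  proof
    show "circle c \<subseteq> (\<Union>i\<in>{i \<in> {0..<N}. col i = c}. piece i)"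
    proof
      fix x assume "x \<in> circle c"
      then obtain i where i: "x \<in> piece i" "col i = c" unfolding circle_def by blast
      have "i = i mod N + N * (i div N)" by simp
      then have "x \<in> piece (i mod N)" "col (i mod N) = c"
        using i piece_shift[of "i mod N" "i div N"] col_shift[of "i mod N" "i div N"] by auto
      moreover have "i mod N \<in> {0..<N}" using N_pos by simp
      ultimately show "x \<in> (\<Union>i\<in>{i \<in> {0..<N}. col i = c}. piece i)" by blast
    qed
  qed (auto simp: circle_def)
  moreover have "finite {i \<in> {0..<N}. col i = c}" by (rule finite_subset[of _ "{0..<N}"]) auto
  ultimately show ?thesis using piece_compact by (simp add: compact_UN)
qed

text \<open>Pieces of neighbouring edges in a chain of moves share an arc: \<open>m a\<close> has
  the outgoing arc of the edge \<open>a\<close>, and \<open>m (a + 1) - 1\<close> its incoming arc.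
  Connectedness follows by induction along the chain that \<open>linked\<close> supplies.\<close>

lemma circle_connected: "connected (circle c)"
proof -
  have link: "connected_component (circle c) x y"
    if "piece i \<inter> piece j \<noteq> {}" "col i = c" "col j = c" "x \<in> piece i" "y \<in> piece j" for x y i j
    unfolding connected_component_def
  proof (intro exI conjI)
    show "connected (piece i \<union> piece j)" by (rule connected_Un[OF piece_connected piece_connected that(1)])
    show "piece i \<union> piece j \<subseteq> circle c" unfolding circle_def using that(2,3) by blast
    show "x \<in> piece i \<union> piece j" "y \<in> piece i \<union> piece j" using that(4,5) by simp_all
  qed
  let ?r = "\<lambda>a b. b = m a \<or> b = m (a + 1) - 1 \<or> (\<exists>k. b = a + N * k)"
  have ne: "piece i \<noteq> {}" for i unfolding piece_def using edge_ends by blast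
  have meet: "piece a \<inter> piece b \<noteq> {} \<and> col a = col b" if "?r a b" for a b
  proof -
    have oi: "out (m a) = out a" "inn (m (a + 1) - 1 + 1) = inn (a + 1)"
      using out_cong[OF g_T_m[of a]] inn_cong[OF g_T_m[of "a + 1"]] by simp_all
    have ends: "out a \<noteq> {}" "inn (a + 1) \<noteq> {}" using out(4)[of a] inn(4)[of "a + 1"] by auto
    from that consider "b = m a" | "b = m (a + 1) - 1" | k where "b = a + N * k" by blast
    then show ?thesis
    proof cases
      case 1
      have "out b = out a" unfolding 1 by (rule oi(1))
      moreover have "col a = col b" using col_out[of a] unfolding 1 by simp
      ultimately show ?thesis using ends(1) unfolding piece_def by blast
    next
      case 2
      have "inn (b + 1) = inn (a + 1)" unfolding 2 by (rule oi(2))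
      moreover have "col a = col b" using col_inn[of "a + 1"] unfolding 2 by simp
      ultimately show ?thesis using ends(2) unfolding piece_def by blast
    next
      case 3
      then show ?thesis using piece_shift col_shift ne by auto
    qed
  qed
  have main: "col j = c \<and> (\<forall>x\<in>piece i. \<forall>y\<in>piece j. connected_component (circle c) x y)"
    if "equivclp ?r i j" "col i = c" for i j
    using that(1)
  proof (induction rule: equivclp_induct)
    case base
    have "piece i \<inter> piece i \<noteq> {}" using ne by simp
    then show ?case using link that(2) by blast
  next
    case (step j k)
    obtain y where y: "y \<in> piece j" using ne by blast
    from step(2) have "?r j k \<or> ?r k j" .
    then have jk: "piece j \<inter> piece k \<noteq> {} \<and> col j = col k"
    proof
      assume "?r k j"
      from meet[OF this] show ?thesis by (simp add: Int_commute)
    qed (rule meet)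
    then have k: "col j = c" "col k = c" using step(3) by auto
    show ?case
    proof (intro conjI ballI)
      fix x z assume "x \<in> piece i" "z \<in> piece k"
      then have "connected_component (circle c) x y" "connected_component (circle c) y z"
        using step(3) y link[OF _ k] jk by blast+
      then show "connected_component (circle c) x z" by (rule connected_component_trans)
    qed (rule k(2))
  qed
  show ?thesis
    unfolding connected_iff_connected_component
  proof (intro ballI)
    fix x y assume "x \<in> circle c" "y \<in> circle c"
    then obtain i j where ij: "x \<in> piece i" "col i = c" "y \<in> piece j" "col j = c" unfolding circle_def by blast
    then have "equivclp ?r i j" using linked[of i j] by simp
    then show "connected_component (circle c) x y" using main[OF _ ij(2)] ij by blast
  qed
qed

lemma circle_nonempty: "circle (col i) \<noteq> {}"
  unfolding circle_def piece_def using edge_ends[of i] by blast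

lemma circle_inj: "inj_on circle (range col)"
  by (rule inj_onI) (metis circles_disjoint circle_nonempty Int_absorb imageE)

lemma finite_range_col: "finite (range col)"
proof -
  have "range col = col ` {0..<N}"
  proof -
    have "col i = col (i mod N)" "i mod N \<in> {0..<N}" for i
      using col_shift[of "i mod N" "i div N"] N_pos by auto
    then show ?thesis by (metis (no_types, lifting) UNIV_I image_eqI image_subset_iff subsetI subset_antisym)
  qed
  then show ?thesis by simp
qed

text \<open>The colour classes are finitely many disjoint nonempty compact connected sets that cover
  \<open>resolved\<close>. A connected subset containing one of them cannot meet the closed union of
  the others.\<close>

lemma components_resolved: "components resolved = circle ` range col"
proof -
  have U: "resolved = (\<Union>c\<in>range col. circle c)" unfolding resolved_pieces circle_def by auto
  have max: "circle c \<in> components resolved" if c: "c \<in> range col" for c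
    unfolding in_components_maximal
  proof (intro conjI allI impI)
    show "circle c \<noteq> {}" "circle c \<subseteq> resolved" using c circle_nonempty U by blast+
    show "connected (circle c)" by (rule circle_connected)
    fix D assume D: "D \<noteq> {} \<and> circle c \<subseteq> D \<and> D \<subseteq> resolved \<and> connected D"
    let ?E = "\<Union>c'\<in>range col - {c}. circle c'"
    have "closed ?E" using finite_range_col compact_imp_closed[OF circle_compact] by (intro closed_UN) simp_all
    moreover have "closed (circle c)" using circle_compact compact_imp_closed by blast
    moreover have DE2: "D \<subseteq> circle c \<union> ?E" using D unfolding U by blast
    moreover have "circle c \<inter> ?E \<inter> D = {}" using circles_disjoint by blast
    moreover have "circle c \<inter> D \<noteq> {}" using D c circle_nonempty by blast
    ultimately have DE1: "?E \<inter> D = {}" using D connected_closed[of D] by blast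
    have "D \<subseteq> circle c"
    proof
      fix x assume x: "x \<in> D"
      then have "x \<in> circle c \<or> x \<in> ?E" using DE2 by blast
      then show "x \<in> circle c" using DE1 x by blast
    qed
    then show "D = circle c" using D by blast
  qed
  show ?thesis
  proof
    show "circle ` range col \<subseteq> components resolved" using max by blast
    show "components resolved \<subseteq> circle ` range col"
    proof
      fix D assume D: "D \<in> components resolved"
      then have "D \<noteq> {}" "D \<subseteq> resolved" using in_components_nonempty in_components_subset by blast+
      then obtain c where "c \<in> range col" "D \<inter> circle c \<noteq> {}" using U by blast
      then show "D \<in> circle ` range col" using max D components_eq by blast
    qed
  qed
qed

lemma card_components: "card (components resolved) = card (range col)"
  unfolding components_resolved by (rule card_image[OF circle_inj])

end

subsection \<open>Existence of small resolutions\<close>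

text \<open>The straight chord from \<open>x\<close> to \<open>y\<close>, projected radially to the
  sphere. On the sphere the disc is the set where the inner product with \<open>p\<close> is at
  least \<open>c\<close>; for \<open>r < 1\<close> this \<open>c\<close> is positive, so the chord
  misses the origin. The inner product is \<open>c\<close> along the chord, and normalizing raises
  it strictly between the ends. Half-spaces through the origin are preserved, which later keeps two
  such arcs apart.\<close>

lemma sphere_chord:
  fixes p x y :: "real^3"
  assumes p: "norm p = 1" and x: "norm x = 1" "dist p x = r" and y: "norm y = 1" "dist p y = r"
    and "x \<noteq> y" "r < 1"
  obtains \<gamma> where "arc \<gamma>" "pathstart \<gamma> = x" "pathfinish \<gamma> = y" "path_image \<gamma> \<subseteq> cap p r"
    "path_image \<gamma> \<inter> sphere p r = {x, y}"
    "\<And>w. w \<bullet> x < 0 \<Longrightarrow> w \<bullet> y < 0 \<Longrightarrow> \<forall>z\<in>path_image \<gamma>. w \<bullet> z < 0"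
proof -
  define c where "c = 1 - r\<^sup>2 / 2"
  have r0: "0 \<le> r" using x by auto
  have dist_unit: "(dist p z)\<^sup>2 = 2 - 2 * (p \<bullet> z)" if "norm z = 1" for z
    using p that unfolding dist_norm power2_norm_eq_inner norm_eq_1
    by (simp add: inner_diff_left inner_diff_right inner_commute)
  have r1: "r\<^sup>2 < 1" using r0 \<open>r < 1\<close> by (simp add: power_less_one_iff)
  then have c: "0 < c" unfolding c_def by simp
  have le: "dist p z \<le> r \<longleftrightarrow> c \<le> p \<bullet> z" and eq: "dist p z = r \<longleftrightarrow> p \<bullet> z = c" if "norm z = 1" for z
  proof -
    have "dist p z \<le> r \<longleftrightarrow> (dist p z)\<^sup>2 \<le> r\<^sup>2" using r0 by (simp add: abs_le_square_iff[symmetric])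
    then show "dist p z \<le> r \<longleftrightarrow> c \<le> p \<bullet> z" unfolding dist_unit[OF that] c_def by auto
    have "dist p z = r \<longleftrightarrow> (dist p z)\<^sup>2 = r\<^sup>2" using r0 by simp
    then show "dist p z = r \<longleftrightarrow> p \<bullet> z = c" unfolding dist_unit[OF that] c_def by auto
  qed
  have px: "p \<bullet> x = c" and py: "p \<bullet> y = c" using eq x y by blast+
  define L where "L = linepath x y"
  define \<gamma> where "\<gamma> t = L t /\<^sub>R norm (L t)" for t
  have pL: "p \<bullet> L t = c" for t
    unfolding L_def linepath_def inner_add_right inner_scaleR_right px py by (simp add: algebra_simps)
  have Lnz: "L t \<noteq> 0" for t using pL[of t] c by auto
  have unit: "norm (\<gamma> t) = 1" for t unfolding \<gamma>_def using Lnz[of t] by simp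
  have p\<gamma>: "p \<bullet> \<gamma> t = c / norm (L t)" for t
    unfolding \<gamma>_def inner_scaleR_right pL by (simp add: divide_inverse mult.commute)
  have L_le: "norm (L t) \<le> 1" if "t \<in> {0..1}" for t
  proof -
    have "norm (L t) \<le> norm ((1 - t) *\<^sub>R x) + norm (t *\<^sub>R y)"
      unfolding L_def linepath_def by (rule norm_triangle_ineq)
    then show ?thesis using that x y by simp
  qed
  have L_less: "norm (L t) < 1" if "t \<in> {0<..<1}" for t
  proof -
    have "L t \<in> open_segment x y"
      unfolding L_def linepath_def in_segment using that \<open>x \<noteq> y\<close> by auto
    then have "dist (L t) 0 < max (dist x 0) (dist y 0)"
      using dist_decreases_open_segment[of "L t" x y 0] by (auto simp: dist_commute)
    then show ?thesis using x y by simp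
  qed
  \<comment> \<open>The inner product of \<open>p\<close> with \<open>\<gamma> t\<close> determines
    the norm of \<open>L t\<close>, and then \<open>\<gamma> t\<close> determines
    \<open>L t\<close>.\<close>
  have inj: "inj_on \<gamma> {0..1}"
  proof (rule inj_onI)
    fix s t assume "\<gamma> s = \<gamma> t"
    then have "c / norm (L s) = c / norm (L t)" using p\<gamma> by metis
    then have "norm (L s) = norm (L t)" using c by (simp add: divide_inverse)
    then have "L s = L t" using \<open>\<gamma> s = \<gamma> t\<close> Lnz unfolding \<gamma>_def by simp
    then have "(1 - s) *\<^sub>R x + s *\<^sub>R y = (1 - t) *\<^sub>R x + t *\<^sub>R y" unfolding L_def linepath_def .
    then have "(s - t) *\<^sub>R (y - x) = 0" by (simp add: algebra_simps)
    then show "s = t" using \<open>x \<noteq> y\<close> by simp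
  qed
  have ends: "\<gamma> 0 = x" "\<gamma> 1 = y" unfolding \<gamma>_def L_def using x y by (simp_all add: linepath_def)
  have "continuous_on {0..1} L" unfolding L_def by (rule continuous_on_linepath)
  then have "path \<gamma>" unfolding path_def \<gamma>_def using Lnz by (intro continuous_intros) auto
  then have "arc \<gamma>" unfolding arc_def using inj by simp
  moreover have "pathstart \<gamma> = x" "pathfinish \<gamma> = y" unfolding pathstart_def pathfinish_def by (fact ends)+
  moreover have "path_image \<gamma> \<subseteq> cap p r"
  proof
    fix z assume "z \<in> path_image \<gamma>"
    then obtain t where t: "t \<in> {0..1}" "z = \<gamma> t" unfolding path_image_def by blast
    have "c \<le> c / norm (L t)" using L_le[OF t(1)] Lnz[of t] c by (simp add: field_simps)
    then have "dist p z \<le> r" using le unit p\<gamma> t(2) by simp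
    then show "z \<in> cap p r" unfolding cap_def using unit t(2) by simp
  qed
  moreover have "path_image \<gamma> \<inter> sphere p r = {x, y}"
  proof
    show "path_image \<gamma> \<inter> sphere p r \<subseteq> {x, y}"
    proof
      fix z assume z: "z \<in> path_image \<gamma> \<inter> sphere p r"
      then obtain t where t: "t \<in> {0..1}" "z = \<gamma> t" unfolding path_image_def by blast
      have "c / norm (L t) = c" using z eq[OF unit[of t]] p\<gamma> t(2) by simp
      then have "norm (L t) = 1" using c Lnz[of t] by (simp add: field_simps)
      then have "t = 0 \<or> t = 1" using L_less[of t] t(1) by force
      then show "z \<in> {x, y}" using ends t(2) by auto
    qed
    have "\<gamma> 0 \<in> path_image \<gamma>" "\<gamma> 1 \<in> path_image \<gamma>" unfolding path_image_def by auto
    then show "{x, y} \<subseteq> path_image \<gamma> \<inter> sphere p r" using x y unfolding ends by simp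
  qed
  moreover have "\<forall>z\<in>path_image \<gamma>. w \<bullet> z < 0" if w: "w \<bullet> x < 0" "w \<bullet> y < 0" for w
  proof
    fix z assume "z \<in> path_image \<gamma>"
    then obtain t where t: "t \<in> {0..1}" "z = \<gamma> t" unfolding path_image_def by blast
    have "L t \<in> {z. w \<bullet> z < 0}"
      using convex_contains_segment[of "{z. w \<bullet> z < 0}"] convex_halfspace_lt[of w 0] w
        linepath_in_path[OF t(1), of x y] unfolding L_def by blast
    then show "w \<bullet> z < 0" unfolding t \<gamma>_def using Lnz[of t] by (simp add: mult_less_0_iff)
  qed
  ultimately show ?thesis by (rule that)
qed

section \<open>Local form of the curve at a double point\<close>

context
  fixes g :: "real \<Rightarrow> real^3"
  assumes gen: "generic_immersion g"
begin

lemma tendsto_derivative: "((\<lambda>u. vector_derivative g (at u)) \<longlongrightarrow> vector_derivative g (at s)) (at s)"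
  using gen_derivative_continuous[OF gen] by (auto simp: continuous_on_eq_continuous_at isCont_def)

text \<open>The squared distance from \<open>g s\<close> has derivative
  \<open>2 * ((g u - g s) \<bullet> g' u)\<close>. Divided by \<open>u - s\<close>, the inner
  product tends to the squared speed at \<open>s\<close>, so near \<open>s\<close> the derivative
  has the sign of \<open>u - s\<close>.\<close>

lemma distance_strict_mono:
  obtains \<eta> where "0 < \<eta>"
    "\<And>u v. s \<le> u \<Longrightarrow> u < v \<Longrightarrow> v \<le> s + \<eta> \<Longrightarrow> dist (g s) (g u) < dist (g s) (g v)"
    "\<And>u v. s - \<eta> \<le> u \<Longrightarrow> u < v \<Longrightarrow> v \<le> s \<Longrightarrow> dist (g s) (g v) < dist (g s) (g u)"
proof -
  define g' where "g' = (\<lambda>u. vector_derivative g (at u))"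
  have "((\<lambda>u. ((g u - g s) /\<^sub>R (u - s)) \<bullet> g' u) \<longlongrightarrow> g' s \<bullet> g' s) (at s)"
    unfolding g'_def by (intro tendsto_intros vector_difference_quotient gen_derivative[OF gen] tendsto_derivative)
  moreover have "0 < g' s \<bullet> g' s" using gen_derivative_nz[OF gen] unfolding g'_def by simp
  ultimately have "eventually (\<lambda>u. 0 < ((g u - g s) /\<^sub>R (u - s)) \<bullet> g' u) (at s)"
    by (rule order_tendstoD(1))
  then obtain d where d: "0 < d" "\<And>u. u \<noteq> s \<Longrightarrow> dist u s < d \<Longrightarrow> 0 < ((g u - g s) /\<^sub>R (u - s)) \<bullet> g' u"
    unfolding eventually_at by blast
  have sgn: "0 < ((g u - g s) \<bullet> g' u) / (u - s)" if "u \<noteq> s" "\<bar>u - s\<bar> < d" for u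
    using d(2)[of u] that by (simp add: dist_real_def divide_inverse mult.commute)
  define F where "F u = (g u - g s) \<bullet> (g u - g s)" for u
  have F: "(F has_real_derivative 2 * ((g u - g s) \<bullet> g' u)) (at u)" for u
  proof -
    have "((\<lambda>u. g u - g s) has_vector_derivative g' u - 0) (at u)"
      unfolding g'_def by (intro has_vector_derivative_diff gen_derivative[OF gen] has_vector_derivative_const)
    then have "((\<lambda>u. g u - g s) has_derivative (\<lambda>h. h *\<^sub>R g' u)) (at u)"
      unfolding has_vector_derivative_def by simp
    from has_derivative_inner[OF this this]
    have "(F has_derivative (\<lambda>h. (g u - g s) \<bullet> (h *\<^sub>R g' u) + (h *\<^sub>R g' u) \<bullet> (g u - g s))) (at u)"
      unfolding F_def .
    then show ?thesis unfolding has_field_derivative_def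
      by (rule has_derivative_eq_rhs) (auto simp: fun_eq_iff inner_commute)
  qed
  have Fc: "continuous_on S F" for S using F by (meson DERIV_isCont continuous_at_imp_continuous_on)
  have "dist (g s) (g u) = sqrt (F u)" for u
    by (subst dist_commute) (simp add: dist_norm norm_eq_sqrt_inner F_def)
  then have dF: "dist (g s) (g u) < dist (g s) (g v) \<longleftrightarrow> F u < F v" for u v by simp
  show ?thesis
  proof (rule that[of "d / 2"])
    show "0 < d / 2" using d by simp
    fix u v assume uv: "s \<le> u" "u < v" "v \<le> s + d / 2"
    show "dist (g s) (g u) < dist (g s) (g v)"
      unfolding dF
    proof (rule DERIV_pos_imp_increasing_open[OF uv(2) _ Fc])
      fix x assume x: "u < x" "x < v"
      then have "0 < (g x - g s) \<bullet> g' x" using sgn[of x] uv d(1) by (auto simp: zero_less_divide_iff)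
      then show "\<exists>y. (F has_real_derivative y) (at x) \<and> 0 < y" using F[of x] by force
    qed
  next
    fix u v assume uv: "s - d / 2 \<le> u" "u < v" "v \<le> s"
    show "dist (g s) (g v) < dist (g s) (g u)"
      unfolding dF
    proof (rule DERIV_neg_imp_decreasing_open[OF uv(2) _ Fc])
      fix x assume x: "u < x" "x < v"
      then have "(g x - g s) \<bullet> g' x < 0" using sgn[of x] uv d(1) by (auto simp: zero_less_divide_iff)
      then show "\<exists>y. (F has_real_derivative y) (at x) \<and> y < 0" using F[of x] by force
    qed
  qed
qed

text \<open>The neighbourhood of \<open>s\<close> is fixed before the radius, so that for all small
  radii this part of the curve meets the disc in exactly one strand. The ends come from the
  intermediate value theorem, their uniqueness from monotone distance.\<close>

lemma local_strand:
  assumes "0 < e"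
  obtains \<eta> where "0 < \<eta>" "\<eta> < e"
    "\<exists>\<delta>>0. \<forall>r. 0 < r \<and> r < \<delta> \<longrightarrow> (\<exists>a b. s - \<eta> < a \<and> a < s \<and> s < b \<and> b < s + \<eta> \<and>
       dist (g s) (g a) = r \<and> dist (g s) (g b) = r \<and>
       (\<forall>u\<in>{a<..<b}. dist (g s) (g u) < r) \<and>
       (\<forall>u\<in>{s - \<eta>..s + \<eta>} - {a..b}. r < dist (g s) (g u)))"
proof -
  obtain \<eta>0 where \<eta>0: "0 < \<eta>0"
    "\<And>u v. s \<le> u \<Longrightarrow> u < v \<Longrightarrow> v \<le> s + \<eta>0 \<Longrightarrow> dist (g s) (g u) < dist (g s) (g v)"
    "\<And>u v. s - \<eta>0 \<le> u \<Longrightarrow> u < v \<Longrightarrow> v \<le> s \<Longrightarrow> dist (g s) (g v) < dist (g s) (g u)"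
    by (rule distance_strict_mono[of s]) blast
  define \<eta> where "\<eta> = min \<eta>0 (e / 2)"
  have \<eta>: "0 < \<eta>" "\<eta> < e" "\<eta> \<le> \<eta>0" unfolding \<eta>_def using \<eta>0 assms by auto
  define F where "F u = dist (g s) (g u)" for u
  have inc: "F u < F v" if "s \<le> u" "u < v" "v \<le> s + \<eta>" for u v
    unfolding F_def using \<eta>0(2) that \<eta>(3) by auto
  have dec: "F v < F u" if "s - \<eta> \<le> u" "u < v" "v \<le> s" for u v
    unfolding F_def using \<eta>0(3) that \<eta>(3) by auto
  have F: "continuous_on S F" for S unfolding F_def by (intro continuous_intros gen_continuous[OF gen])
  have Fs: "F s = 0" unfolding F_def by simp
  have pos: "0 < min (F (s - \<eta>)) (F (s + \<eta>))" using inc[of s "s + \<eta>"] dec[of "s - \<eta>" s] \<eta> Fs by simp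
  have "\<exists>a b. s - \<eta> < a \<and> a < s \<and> s < b \<and> b < s + \<eta> \<and> F a = r \<and> F b = r \<and>
       (\<forall>u\<in>{a<..<b}. F u < r) \<and> (\<forall>u\<in>{s - \<eta>..s + \<eta>} - {a..b}. r < F u)"
    if r: "0 < r" "r < min (F (s - \<eta>)) (F (s + \<eta>))" for r
  proof -
    obtain b where b: "s \<le> b" "b \<le> s + \<eta>" "F b = r"
      using IVT'[of F s r "s + \<eta>"] r Fs \<eta> F by auto
    obtain a where a: "s - \<eta> \<le> a" "a \<le> s" "F a = r"
      using IVT2'[of F s r "s - \<eta>"] r Fs \<eta> F by auto
    have ne: "b \<noteq> s" "a \<noteq> s" "b \<noteq> s + \<eta>" "a \<noteq> s - \<eta>" using a b r Fs by auto
    have "F u < r" if "u \<in> {a<..<b}" for u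
      using inc[of u b] dec[of a u] that a b by (cases "s \<le> u") auto
    moreover have "r < F u" if "u \<in> {s - \<eta>..s + \<eta>} - {a..b}" for u
      using inc[of b u] dec[of u a] that a b by (cases "u < a") auto
    ultimately show ?thesis using a b ne by (intro exI[of _ a] exI[of _ b]) auto
  qed
  then show ?thesis using that[of \<eta>] \<eta> pos unfolding F_def by blast
qed

text \<open>The vector \<open>w\<close> bisects the two velocities. It has positive inner product
  with both, by the strict Cauchy-Schwarz inequality for independent vectors, and it is orthogonal
  to \<open>p\<close>. So near \<open>p\<close> both incoming branches lie where \<open>w\<close> is
  negative and both outgoing ones where it is positive, and the two projected chords are separated
  by the great circle orthogonal to \<open>w\<close>.\<close>

lemma smoothing_exists:
  assumes s: "g s = p" and t: "g t = p" and ne: "\<not> same_angle s t"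
  obtains \<rho> where "0 < \<rho>" "\<And>r. 0 < r \<Longrightarrow> r < \<rho> \<Longrightarrow> \<exists>A. A_inv_smoothing g p r A"
proof -
  define U V where "U = vector_derivative g (at s)" and "V = vector_derivative g (at t)"
  have UV: "cross3 U V \<noteq> 0" unfolding U_def V_def using gen_transversal[OF gen _ ne] s t by simp
  have nz: "U \<noteq> 0" "V \<noteq> 0" unfolding U_def V_def using gen_derivative_nz[OF gen] by blast+
  define w where "w = U /\<^sub>R norm U + V /\<^sub>R norm V"
  have "(U \<bullet> V)\<^sup>2 < (norm U * norm V)\<^sup>2"
    using norm_cross_dot[of U V] UV by (metis add.commute less_add_same_cancel1 zero_less_norm_iff zero_less_power)
  then have "\<bar>U \<bullet> V\<bar> < norm U * norm V" using power2_less_imp_less[of "\<bar>U \<bullet> V\<bar>"] by simp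
  then have UVl: "- (norm U * norm V) < U \<bullet> V" by linarith
  have self: "inverse (norm x) * (x \<bullet> x) = norm x" if "x \<noteq> 0" for x :: "real^3"
    using that by (simp add: dot_square_norm power2_eq_square)
  have wU: "0 < w \<bullet> U"
  proof -
    have "w \<bullet> U = norm U + (U \<bullet> V) / norm V"
      unfolding w_def inner_add_left inner_scaleR_left using self nz by (simp add: inner_commute divide_inverse)
    also have "\<dots> = (norm U * norm V + U \<bullet> V) / norm V" using nz by (simp add: field_simps)
    finally have "w \<bullet> U = (norm U * norm V + U \<bullet> V) / norm V" .
    then show ?thesis using UVl nz by simp
  qed
  have wV: "0 < w \<bullet> V"
  proof -
    have "w \<bullet> V = norm V + (U \<bullet> V) / norm U"
      unfolding w_def inner_add_left inner_scaleR_left using self nz by (simp add: inner_commute divide_inverse)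
    also have "\<dots> = (norm U * norm V + U \<bullet> V) / norm U" using nz by (simp add: field_simps)
    finally have "w \<bullet> V = (norm U * norm V + U \<bullet> V) / norm U" .
    then show ?thesis using UVl nz by simp
  qed
  have orth: "g x \<bullet> vector_derivative g (at x) = 0" for x
  proof -
    have "(g has_derivative (\<lambda>h. h *\<^sub>R vector_derivative g (at x))) (at x)"
      using gen_derivative[OF gen, of x] unfolding has_vector_derivative_def .
    from has_derivative_inner[OF this this]
    have d: "((\<lambda>x. g x \<bullet> g x) has_derivative (\<lambda>h. g x \<bullet> (h *\<^sub>R vector_derivative g (at x)) + (h *\<^sub>R vector_derivative g (at x)) \<bullet> g x)) (at x)" .
    have "g y \<bullet> g y = 1" for y using gen_sphere[OF gen, of y] by (simp add: norm_eq_1)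
    then have "(\<lambda>x. g x \<bullet> g x) = (\<lambda>x. 1)" by simp
    from has_derivative_unique[OF d[unfolded this] has_derivative_const]
    have "(\<lambda>h. g x \<bullet> (h *\<^sub>R vector_derivative g (at x)) + (h *\<^sub>R vector_derivative g (at x)) \<bullet> g x) = (\<lambda>h. 0)" .
    from fun_cong[OF this, of 1] show ?thesis by (simp add: inner_commute)
  qed
  have wp: "w \<bullet> p = 0"
    using orth[of s] orth[of t] s t
    unfolding w_def U_def V_def inner_commute[of _ p] by (simp add: inner_add_right)
  have side: "\<exists>d>0. \<forall>y. \<bar>y - x\<bar> < d \<longrightarrow> (y < x \<longrightarrow> w \<bullet> g y < 0) \<and> (x < y \<longrightarrow> 0 < w \<bullet> g y)"
    if "g x = p" "0 < w \<bullet> vector_derivative g (at x)" for x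
  proof -
    have "((\<lambda>y. w \<bullet> ((g y - g x) /\<^sub>R (y - x))) \<longlongrightarrow> w \<bullet> vector_derivative g (at x)) (at x)"
      by (intro tendsto_intros vector_difference_quotient gen_derivative[OF gen])
    then have "eventually (\<lambda>y. 0 < w \<bullet> ((g y - g x) /\<^sub>R (y - x))) (at x)"
      using that(2) by (rule order_tendstoD(1))
    then obtain d where d: "0 < d" "\<And>y. y \<noteq> x \<Longrightarrow> dist y x < d \<Longrightarrow> 0 < w \<bullet> ((g y - g x) /\<^sub>R (y - x))"
      unfolding eventually_at by blast
    have sg: "0 < (w \<bullet> g y) / (y - x)" if "y \<noteq> x" "\<bar>y - x\<bar> < d" for y
      using d(2)[of y] that wp \<open>g x = p\<close> by (simp add: dist_real_def divide_inverse mult.commute inner_diff_right)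
    have "(y < x \<longrightarrow> w \<bullet> g y < 0) \<and> (x < y \<longrightarrow> 0 < w \<bullet> g y)" if "\<bar>y - x\<bar> < d" for y
      using sg[OF _ that] by (auto simp: zero_less_divide_iff)
    then show ?thesis using d(1) by blast
  qed
  obtain ds where ds: "0 < ds" "\<And>y. \<bar>y - s\<bar> < ds \<Longrightarrow> (y < s \<longrightarrow> w \<bullet> g y < 0) \<and> (s < y \<longrightarrow> 0 < w \<bullet> g y)"
    using side[of s] s wU unfolding U_def by blast
  obtain dt where dt: "0 < dt" "\<And>y. \<bar>y - t\<bar> < dt \<Longrightarrow> (y < t \<longrightarrow> w \<bullet> g y < 0) \<and> (t < y \<longrightarrow> 0 < w \<bullet> g y)"
    using side[of t] t wV unfolding V_def by blast
  \<comment> \<open>Parameters near \<open>s\<close> and parameters near \<open>t\<close> stay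
    inequivalent as long as each moves by less than half of \<kappa> on the unit circle. A common
    point of the two strands is then a double point.\<close>
  define \<kappa> where "\<kappa> = norm (cis s - cis t)"
  have \<kappa>: "0 < \<kappa>" unfolding \<kappa>_def using ne by (simp add: same_angle_cis)
  have "\<exists>d>0. \<forall>y. \<bar>y - x\<bar> < d \<longrightarrow> norm (cis y - cis x) < \<kappa> / 2" for x
  proof -
    have "isCont cis x" unfolding isCont_def by (intro tendsto_intros)
    then show ?thesis using \<kappa> unfolding continuous_at_eps_delta by (metis dist_norm half_gt_zero dist_real_def)
  qed
  then obtain cs ct where cs: "0 < cs" "\<And>y. \<bar>y - s\<bar> < cs \<Longrightarrow> norm (cis y - cis s) < \<kappa> / 2"
    and ct: "0 < ct" "\<And>y. \<bar>y - t\<bar> < ct \<Longrightarrow> norm (cis y - cis t) < \<kappa> / 2" by metis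
  have apart: "\<not> same_angle y z" if "\<bar>y - s\<bar> < cs" "\<bar>z - t\<bar> < ct" for y z
  proof
    assume "same_angle y z"
    then have "cis y = cis z" by (simp add: same_angle_cis)
    then have "cis s - cis t = (cis z - cis t) - (cis y - cis s)" by simp
    then have "\<kappa> \<le> norm (cis z - cis t) + norm (cis y - cis s)"
      unfolding \<kappa>_def by (metis norm_triangle_ineq4)
    then show False using cs(2)[OF that(1)] ct(2)[OF that(2)] by simp
  qed
  obtain \<eta>s \<delta>s where \<eta>s: "0 < \<eta>s" "\<eta>s < min ds cs" and \<delta>s: "0 < \<delta>s"
    "\<And>r. 0 < r \<Longrightarrow> r < \<delta>s \<Longrightarrow> (\<exists>a b. s - \<eta>s < a \<and> a < s \<and> s < b \<and> b < s + \<eta>s \<and>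
       dist (g s) (g a) = r \<and> dist (g s) (g b) = r \<and>
       (\<forall>u\<in>{a<..<b}. dist (g s) (g u) < r) \<and>
       (\<forall>u\<in>{s - \<eta>s..s + \<eta>s} - {a..b}. r < dist (g s) (g u)))"
    using local_strand[of "min ds cs" s] ds cs by (metis min_less_iff_conj)
  obtain \<eta>t \<delta>t where \<eta>t: "0 < \<eta>t" "\<eta>t < min dt ct" and \<delta>t: "0 < \<delta>t"
    "\<And>r. 0 < r \<Longrightarrow> r < \<delta>t \<Longrightarrow> (\<exists>a b. t - \<eta>t < a \<and> a < t \<and> t < b \<and> b < t + \<eta>t \<and>
       dist (g t) (g a) = r \<and> dist (g t) (g b) = r \<and>
       (\<forall>u\<in>{a<..<b}. dist (g t) (g u) < r) \<and>
       (\<forall>u\<in>{t - \<eta>t..t + \<eta>t} - {a..b}. r < dist (g t) (g u)))"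
    using local_strand[of "min dt ct" t] dt ct by (metis min_less_iff_conj)
  \<comment> \<open>The parameters of one turn that stay away from both passes. Their image is
    compact and misses \<open>p\<close>, so small discs see only the two local strands.\<close>
  define Q where "Q = {0..2*pi} \<inter> (\<Inter>k::int. {x. \<eta>s \<le> \<bar>x - s - 2*pi * of_int k\<bar>} \<inter> {x. \<eta>t \<le> \<bar>x - t - 2*pi * of_int k\<bar>})"
  have "closed (\<Inter>k::int. {x. \<eta>s \<le> \<bar>x - s - 2*pi * of_int k\<bar>} \<inter> {x. \<eta>t \<le> \<bar>x - t - 2*pi * of_int k\<bar>})"
    by (intro closed_INT ballI closed_Int closed_Collect_le continuous_intros)
  then have "compact Q" unfolding Q_def by (intro compact_Int_closed compact_Icc)
  then have "closed (g ` Q)" by (intro compact_imp_closed compact_continuous_image gen_continuous[OF gen])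
  moreover have "p \<notin> g ` Q"
  proof
    assume "p \<in> g ` Q"
    then obtain x where x: "x \<in> Q" "g x = p" by blast
    then have "same_angle x s \<or> same_angle x t" using gen_triple[OF gen, of x s t] s t ne by auto
    then obtain k :: int where "x = s + 2*pi * of_int k \<or> x = t + 2*pi * of_int k" unfolding same_angle_def by blast
    then have "\<bar>x - s - 2*pi * of_int k\<bar> = 0 \<or> \<bar>x - t - 2*pi * of_int k\<bar> = 0" by auto
    moreover have "\<eta>s \<le> \<bar>x - s - 2*pi * of_int k\<bar>" "\<eta>t \<le> \<bar>x - t - 2*pi * of_int k\<bar>"
      using x(1) unfolding Q_def by blast+
    ultimately show False using \<eta>s(1) \<eta>t(1) by linarith
  qed
  ultimately have "\<exists>d>0. \<forall>x\<in>g ` Q. d \<le> dist p x" by (rule separate_point_closed)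
  then obtain \<rho>1 where \<rho>1: "0 < \<rho>1" "\<And>x. x \<in> g ` Q \<Longrightarrow> \<rho>1 \<le> dist p x" by metis
  have near: "\<exists>y. same_angle x y \<and> (\<bar>y - s\<bar> < \<eta>s \<or> \<bar>y - t\<bar> < \<eta>t)" if "dist p (g x) < \<rho>1" for x
  proof -
    obtain x' where x': "x' \<in> {0..<2*pi}" "same_angle x x'" by (rule same_angle_rep)
    then have "x' \<notin> Q" using that \<rho>1(2) gen_same_angle[OF gen x'(2)] by (metis image_eqI linorder_not_less)
    then obtain k :: int where "\<bar>x' - s - 2*pi * of_int k\<bar> < \<eta>s \<or> \<bar>x' - t - 2*pi * of_int k\<bar> < \<eta>t"
      unfolding Q_def using x'(1) by (auto simp: not_le)
    then have "\<bar>(x' + 2*pi * of_int (-k)) - s\<bar> < \<eta>s \<or> \<bar>(x' + 2*pi * of_int (-k)) - t\<bar> < \<eta>t"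
      by (simp add: algebra_simps)
    moreover have "same_angle x (x' + 2*pi * of_int (-k))" unfolding same_angle_add' by (rule x'(2))
    ultimately show ?thesis by blast
  qed
  obtain \<rho>2 where \<rho>2: "0 < \<rho>2" "\<And>q. q \<in> double_points g \<Longrightarrow> q \<noteq> p \<Longrightarrow> \<rho>2 \<le> dist p q"
    using finite_set_avoid[OF gen_finite_double[OF gen]] by metis
  \<comment> \<open>The bound 1 is for \<open>sphere_chord\<close>, \<open>\<delta>s\<close> and
    \<open>\<delta>t\<close> are for the local strands, \<open>\<rho>1\<close> excludes the rest of
    the curve and \<open>\<rho>2\<close> the other double points.\<close>
  define \<rho> where "\<rho> = Min {1, \<delta>s, \<delta>t, \<rho>1, \<rho>2}"
  have \<rho>: "0 < \<rho>" "\<rho> \<le> 1" "\<rho> \<le> \<delta>s" "\<rho> \<le> \<delta>t" "\<rho> \<le> \<rho>1" "\<rho> \<le> \<rho>2"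
    unfolding \<rho>_def using \<delta>s(1) \<delta>t(1) \<rho>1(1) \<rho>2(1) by auto
  have "\<exists>A. A_inv_smoothing g p r A" if r: "0 < r" "r < \<rho>" for r
  proof -
    obtain a b where ab: "s - \<eta>s < a" "a < s" "s < b" "b < s + \<eta>s" "dist p (g a) = r" "dist p (g b) = r"
       "\<forall>u\<in>{a<..<b}. dist p (g u) < r" "\<forall>u\<in>{s - \<eta>s..s + \<eta>s} - {a..b}. r < dist p (g u)"
      using \<delta>s(2)[of r] r \<rho> unfolding s by auto
    obtain c d where cd: "t - \<eta>t < c" "c < t" "t < d" "d < t + \<eta>t" "dist p (g c) = r" "dist p (g d) = r"
       "\<forall>u\<in>{c<..<d}. dist p (g u) < r" "\<forall>u\<in>{t - \<eta>t..t + \<eta>t} - {c..d}. r < dist p (g u)"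
      using \<delta>t(2)[of r] r \<rho> unfolding t by auto
    have in1: "dist p (g u) \<le> r" if "u \<in> {a..b}" for u
      using that ab(5-7) by (cases "u = a \<or> u = b") (auto intro: less_imp_le)
    have in2: "dist p (g u) \<le> r" if "u \<in> {c..d}" for u
      using that cd(5-7) by (cases "u = c \<or> u = d") (auto intro: less_imp_le)
    have capr: "cap p r \<inter> range g = g ` {a..b} \<union> g ` {c..d}"
    proof
      show "cap p r \<inter> range g \<subseteq> g ` {a..b} \<union> g ` {c..d}"
      proof
        fix x assume x: "x \<in> cap p r \<inter> range g"
        then obtain y where y: "x = g y" "dist p (g y) \<le> r" unfolding cap_def by auto
        then obtain y' where y': "same_angle y y'" "\<bar>y' - s\<bar> < \<eta>s \<or> \<bar>y' - t\<bar> < \<eta>t"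
          using near[of y] r \<rho> by auto
        have x': "x = g y'" "dist p (g y') \<le> r" using y gen_same_angle[OF gen y'(1)] by auto
        from y'(2) have "y' \<in> {a..b} \<or> y' \<in> {c..d}"
        proof
          assume "\<bar>y' - s\<bar> < \<eta>s"
          then have "y' \<in> {s - \<eta>s..s + \<eta>s}" by auto
          then show ?thesis using ab(8) x'(2) by (meson DiffI linorder_not_less)
        next
          assume "\<bar>y' - t\<bar> < \<eta>t"
          then have "y' \<in> {t - \<eta>t..t + \<eta>t}" by auto
          then show ?thesis using cd(8) x'(2) by (meson DiffI linorder_not_less)
        qed
        then show "x \<in> g ` {a..b} \<union> g ` {c..d}" using x' by blast
      qed
      show "g ` {a..b} \<union> g ` {c..d} \<subseteq> cap p r \<inter> range g"
        unfolding cap_def using in1 in2 gen_sphere[OF gen] by auto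
    qed
    have meet: "y = p" if y: "y \<in> g ` {a..b}" "y \<in> g ` {c..d}" for y
    proof (rule ccontr)
      assume "y \<noteq> p"
      obtain u v where uv: "y = g u" "u \<in> {a..b}" "y = g v" "v \<in> {c..d}" using y by blast
      have "\<bar>u - s\<bar> < cs" "\<bar>v - t\<bar> < ct" using uv ab cd \<eta>s \<eta>t by auto
      then have "\<not> same_angle u v" by (rule apart)
      then have "y \<in> double_points g" unfolding double_points_iff[OF gen] using uv by metis
      then have "\<rho>2 \<le> dist p y" using \<rho>2(2) \<open>y \<noteq> p\<close> by blast
      then show False using in1[OF uv(2)] uv(1) r \<rho> by simp
    qed
    have "p \<in> g ` {a..b}" by (rule image_eqI[of _ _ s]) (use s ab in auto)
    moreover have "p \<in> g ` {c..d}" by (rule image_eqI[of _ _ t]) (use t cd in auto)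
    ultimately have inter: "g ` {a..b} \<inter> g ` {c..d} = {p}" using meet by blast
    have np: "norm p = 1" using gen_sphere[OF gen, of s] s by simp
    have r1: "r < 1" using r \<rho> by simp
    have ac: "g a \<noteq> g c"
    proof
      assume "g a = g c"
      moreover have "g a \<in> g ` {a..b}" "g c \<in> g ` {c..d}" using ab cd by auto
      ultimately have "g a = p" using meet by metis
      then show False using ab(5) r by simp
    qed
    have bd: "g b \<noteq> g d"
    proof
      assume "g b = g d"
      moreover have "g b \<in> g ` {a..b}" "g d \<in> g ` {c..d}" using ab cd by auto
      ultimately have "g b = p" using meet by metis
      then show False using ab(6) r by simp
    qed
    obtain \<alpha> where \<alpha>: "arc \<alpha>" "pathstart \<alpha> = g a" "pathfinish \<alpha> = g c" "path_image \<alpha> \<subseteq> cap p r"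
      "path_image \<alpha> \<inter> sphere p r = {g a, g c}"
      "\<And>w. w \<bullet> g a < 0 \<Longrightarrow> w \<bullet> g c < 0 \<Longrightarrow> \<forall>z\<in>path_image \<alpha>. w \<bullet> z < 0"
      by (rule sphere_chord[OF np gen_sphere[OF gen] ab(5) gen_sphere[OF gen] cd(5) ac r1]) blast
    obtain \<beta> where \<beta>: "arc \<beta>" "pathstart \<beta> = g b" "pathfinish \<beta> = g d" "path_image \<beta> \<subseteq> cap p r"
      "path_image \<beta> \<inter> sphere p r = {g b, g d}"
      "\<And>w. w \<bullet> g b < 0 \<Longrightarrow> w \<bullet> g d < 0 \<Longrightarrow> \<forall>z\<in>path_image \<beta>. w \<bullet> z < 0"
      by (rule sphere_chord[OF np gen_sphere[OF gen] ab(6) gen_sphere[OF gen] cd(6) bd r1]) blast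
    have "w \<bullet> g a < 0" "w \<bullet> g c < 0" using ds(2)[of a] dt(2)[of c] ab cd \<eta>s \<eta>t by auto
    then have A: "\<forall>z\<in>path_image \<alpha>. w \<bullet> z < 0" by (rule \<alpha>(6))
    have "- w \<bullet> g b < 0" "- w \<bullet> g d < 0" using ds(2)[of b] dt(2)[of d] ab cd \<eta>s \<eta>t by auto
    then have B: "\<forall>z\<in>path_image \<beta>. - w \<bullet> z < 0" by (rule \<beta>(6))
    have "path_image \<alpha> \<inter> path_image \<beta> = {}" using A B by force
    moreover have "a < b" "c < d" using ab cd by auto
    moreover have "\<forall>u\<in>{a, b, c, d}. dist p (g u) = r" using ab cd by simp
    moreover have "\<forall>u\<in>{a<..<b} \<union> {c<..<d}. dist p (g u) < r" using ab(7) cd(7) by blast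
    ultimately have "A_inv_smoothing g p r (path_image \<alpha> \<union> path_image \<beta>)"
      unfolding A_inv_smoothing_def using \<alpha>(1-5) \<beta>(1-5) capr inter by blast
    then show ?thesis ..
  qed
  then show ?thesis using that \<rho>(1) by blast
qed

text \<open>Supplies a member of \<tau> at all, and through \<open>e\<close> one whose discs avoid a
  given closed set. Radii below half the distances between double points make the discs
  disjoint.\<close>

lemma small_resolution:
  assumes "0 < e"
  obtains r A where "\<And>p. p \<in> double_points g \<Longrightarrow> A_inv_smoothing g p (r p) (A p)"
    "\<And>p. p \<in> double_points g \<Longrightarrow> r p < e"
    "disjoint_family_on (\<lambda>p. cap p (r p)) (double_points g)"
proof -
  let ?D = "double_points g"
  have fin: "finite ?D" by (rule gen_finite_double[OF gen])
  have "\<exists>\<rho>>0. \<forall>r. 0 < r \<and> r < \<rho> \<longrightarrow> (\<exists>A. A_inv_smoothing g p r A)" if p: "p \<in> ?D" for p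
  proof -
    obtain s t where st: "g s = p" "g t = p" "\<not> same_angle s t"
      using p unfolding double_points_iff[OF gen] by blast
    show ?thesis by (rule smoothing_exists[OF st]) blast
  qed
  then obtain \<rho> where \<rho>: "\<And>p. p \<in> ?D \<Longrightarrow> 0 < \<rho> p"
    "\<And>p r. p \<in> ?D \<Longrightarrow> 0 < r \<Longrightarrow> r < \<rho> p \<Longrightarrow> \<exists>A. A_inv_smoothing g p r A" by metis
  define E where "E = insert e (\<rho> ` ?D \<union> (\<lambda>(p, q). dist p q / 2) ` {(p, q) \<in> ?D \<times> ?D. p \<noteq> q})"
  have "finite {(p, q) \<in> ?D \<times> ?D. p \<noteq> q}" by (rule finite_subset[of _ "?D \<times> ?D"]) (use fin in auto)
  then have E: "finite E" unfolding E_def using fin by simp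
  have Epos: "\<forall>x\<in>E. 0 < x" unfolding E_def using \<rho>(1) assms by auto
  define r where "r = Min E / 2"
  have "E \<noteq> {}" unfolding E_def by simp
  then have "0 < Min E" using E Epos by simp
  then have r: "0 < r" "r < Min E" unfolding r_def by auto
  have rE: "r < x" if "x \<in> E" for x using r Min_le[OF E that] by linarith
  have "\<exists>A. A_inv_smoothing g p r A" if "p \<in> ?D" for p
    using \<rho>(2)[OF that r(1)] rE[of "\<rho> p"] that unfolding E_def by blast
  then obtain A where A: "\<And>p. p \<in> ?D \<Longrightarrow> A_inv_smoothing g p r (A p)" by metis
  have "disjoint_family_on (\<lambda>p. cap p r) ?D"
    unfolding disjoint_family_on_def
  proof (intro ballI impI)
    fix p q assume pq: "p \<in> ?D" "q \<in> ?D" "p \<noteq> q"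
    then have "dist p q / 2 \<in> E" unfolding E_def by force
    then have "2 * r < dist p q" using rE by fastforce
    moreover have "dist p q \<le> 2 * r" if "x \<in> cap p r" "x \<in> cap q r" for x
      using that dist_triangle2[of p q x] unfolding cap_def by auto
    ultimately show "cap p r \<inter> cap q r = {}" by fastforce
  qed
  moreover have "r < e" using rE unfolding E_def by blast
  ultimately show ?thesis using that[of "\<lambda>_. r" A] A by blast
qed

end

subsection \<open>Separation in the sphere\<close>

text \<open>Stereographic projection \<open>f\<close> from the antipode of \<open>p\<close>, which
  the cap misses as \<open>r < 2\<close>, onto the plane orthogonal to \<open>p\<close>, with
  inverse \<open>h\<close>. The squared norm of the image is a decreasing function of the inner
  product with \<open>p\<close>, so the cap becomes a round disc \<open>K\<close>. Sets homeomorphic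
  to compact convex sets do not separate the plane, as Janiszewski's theorem requires of the
  discs.\<close>

lemma cap_homeomorphic_convex:
  fixes p :: "real^3"
  assumes p: "norm p = 1" and r: "0 \<le> r" "r < 2"
  shows "\<exists>K :: (real^3) set. convex K \<and> compact K \<and> cap p r homeomorphic K"
proof -
  define c where "c = 1 - r\<^sup>2 / 2"
  have "r\<^sup>2 < 2\<^sup>2" using r by (intro power_strict_mono) auto
  then have c: "-1 < c" unfolding c_def by simp
  have pp: "p \<bullet> p = 1" using p by (simp add: norm_eq_1)
  have cap: "x \<in> cap p r \<longleftrightarrow> x \<bullet> x = 1 \<and> c \<le> p \<bullet> x" for x
  proof -
    have "dist p x \<le> r \<longleftrightarrow> c \<le> p \<bullet> x" if "x \<bullet> x = 1"
    proof -
      have "dist p x \<le> r \<longleftrightarrow> (dist p x)\<^sup>2 \<le> r\<^sup>2" using r by (simp add: abs_le_square_iff[symmetric])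
      also have "(dist p x)\<^sup>2 = 2 - 2 * (p \<bullet> x)"
        using pp that unfolding dist_norm power2_norm_eq_inner
        by (simp add: inner_diff_left inner_diff_right inner_commute)
      finally show ?thesis unfolding c_def by auto
    qed
    then show ?thesis unfolding cap_def by (auto simp: norm_eq_1)
  qed
  define \<rho> where "\<rho> = sqrt ((1 - c) / (1 + c))"
  have c1: "c \<le> 1" unfolding c_def by simp
  have \<rho>: "0 \<le> \<rho>" "\<rho>\<^sup>2 = (1 - c) / (1 + c)" unfolding \<rho>_def using c c1 by simp_all
  define K where "K = {w. p \<bullet> w = 0} \<inter> cball 0 \<rho>"
  have K: "w \<in> K \<longleftrightarrow> p \<bullet> w = 0 \<and> w \<bullet> w \<le> (1 - c) / (1 + c)" for w
    unfolding K_def using \<rho> by (simp add: norm_le_square)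
  define f where "f x = (x - (p \<bullet> x) *\<^sub>R p) /\<^sub>R (1 + p \<bullet> x)" for x
  define h where "h w = (2 *\<^sub>R w + (1 - w \<bullet> w) *\<^sub>R p) /\<^sub>R (1 + w \<bullet> w)" for w
  have w1: "0 < 1 + w \<bullet> w" for w :: "real^3" using inner_ge_zero[of w] by linarith
  have ph: "p \<bullet> h w = (1 - w \<bullet> w) / (1 + w \<bullet> w)" if "p \<bullet> w = 0" for w
    unfolding h_def using that pp by (simp add: inner_add_right divide_inverse mult.commute)
  have hh: "h w \<bullet> h w = 1" if "p \<bullet> w = 0" for w
  proof -
    have "(2 *\<^sub>R w + (1 - w \<bullet> w) *\<^sub>R p) \<bullet> (2 *\<^sub>R w + (1 - w \<bullet> w) *\<^sub>R p) = (1 + w \<bullet> w)\<^sup>2"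
      using that pp by (simp add: inner_add_left inner_add_right inner_commute power2_eq_square algebra_simps)
    moreover define n where "n = 1 + w \<bullet> w"
    ultimately have "h w \<bullet> h w = inverse n * (inverse n * n\<^sup>2)"
      unfolding h_def inner_scaleR_left inner_scaleR_right by simp
    moreover have "n \<noteq> 0" using w1[of w] unfolding n_def by simp
    ultimately show ?thesis by (simp add: field_simps power2_eq_square)
  qed
  have pf: "p \<bullet> f x = 0" for x
    unfolding f_def using pp by (simp add: inner_diff_right)
  have ff: "f x \<bullet> f x = (1 - p \<bullet> x) / (1 + p \<bullet> x)" if "x \<bullet> x = 1" "-1 < p \<bullet> x" for x
  proof -
    have "(x - (p \<bullet> x) *\<^sub>R p) \<bullet> (x - (p \<bullet> x) *\<^sub>R p) = (1 - p \<bullet> x) * (1 + p \<bullet> x)"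
      using that pp by (simp add: inner_diff_left inner_diff_right inner_commute algebra_simps)
    moreover define n where "n = 1 + p \<bullet> x"
    ultimately have "f x \<bullet> f x = inverse n * (inverse n * ((1 - p \<bullet> x) * n))"
      unfolding f_def inner_scaleR_left inner_scaleR_right by simp
    also have "\<dots> = (1 - p \<bullet> x) / n" using that(2) unfolding n_def by (simp add: divide_inverse)
    finally show ?thesis unfolding n_def .
  qed
  have hom: "homeomorphism (cap p r) K f h"
  proof (rule homeomorphismI)
    show "continuous_on (cap p r) f" unfolding f_def
      by (intro continuous_intros) (use c cap in force)
    show "continuous_on K h" unfolding h_def
      by (intro continuous_intros) (use w1 in \<open>metis less_irrefl\<close>)
    show "f ` cap p r \<subseteq> K"
    proof (rule image_subsetI)
      fix x assume "x \<in> cap p r"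
      then have x: "x \<bullet> x = 1" "c \<le> p \<bullet> x" "-1 < p \<bullet> x" using cap c by auto
      have "(1 - p \<bullet> x) / (1 + p \<bullet> x) \<le> (1 - c) / (1 + c)" using x c by (simp add: field_simps)
      then show "f x \<in> K" unfolding K using pf ff x by simp
    qed
    show "h ` K \<subseteq> cap p r"
    proof (rule image_subsetI)
      fix w assume "w \<in> K"
      then have w: "p \<bullet> w = 0" "w \<bullet> w \<le> (1 - c) / (1 + c)" using K by auto
      have "(w \<bullet> w) * (1 + c) \<le> 1 - c" using w(2) c by (simp add: field_simps)
      then have "c \<le> (1 - w \<bullet> w) / (1 + w \<bullet> w)" using w1[of w] by (simp add: field_simps)
      then show "h w \<in> cap p r" unfolding cap using hh ph w(1) by simp
    qed
    show "h (f x) = x" if "x \<in> cap p r" for x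
    proof -
      have x: "x \<bullet> x = 1" "-1 < p \<bullet> x" using that cap c by force+
      define d where "d = p \<bullet> x"
      have d: "0 < 1 + d" using x unfolding d_def by simp
      have q: "f x \<bullet> f x = (1 - d) / (1 + d)" unfolding d_def using ff x by simp
      have e: "1 + f x \<bullet> f x = 2 / (1 + d)" "1 - f x \<bullet> f x = 2 * d / (1 + d)" unfolding q using d by (simp_all add: field_simps)
      have "h (f x) = (2 *\<^sub>R f x + (2 * d / (1 + d)) *\<^sub>R p) /\<^sub>R (2 / (1 + d))"
        unfolding h_def e ..
      also have "\<dots> = (1 + d) *\<^sub>R f x + d *\<^sub>R p"
      proof -
        have "inverse (2 / (1 + d)) * 2 = 1 + d" "inverse (2 / (1 + d)) * (2 * d / (1 + d)) = d"
          using d by (simp_all add: field_simps)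
        then show ?thesis unfolding scaleR_add_right scaleR_scaleR by simp
      qed
      also have "\<dots> = x" unfolding f_def d_def[symmetric] using d by simp
      finally show ?thesis .
    qed
    show "f (h w) = w" if "w \<in> K" for w
    proof -
      have w: "p \<bullet> w = 0" using that K by auto
      define n where "n = w \<bullet> w"
      have n: "0 < 1 + n" unfolding n_def by (rule w1)
      have p1: "p \<bullet> h w = (1 - n) / (1 + n)" unfolding n_def by (rule ph[OF w])
      have e: "1 + p \<bullet> h w = 2 / (1 + n)" unfolding p1 using n by (simp add: field_simps)
      have hw: "h w = (2 / (1 + n)) *\<^sub>R w + ((1 - n) / (1 + n)) *\<^sub>R p"
        unfolding h_def n_def[symmetric] by (simp add: scaleR_add_right divide_inverse mult.commute)
      have "f (h w) = (h w - ((1 - n) / (1 + n)) *\<^sub>R p) /\<^sub>R (2 / (1 + n))"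
        unfolding f_def e by (simp only: p1)
      also have "\<dots> = (inverse (2 / (1 + n)) * (2 / (1 + n))) *\<^sub>R w"
        unfolding hw by (simp only: add_diff_cancel_right' scaleR_scaleR)
      also have "inverse (2 / (1 + n)) * (2 / (1 + n)) = 1" using n by (intro left_inverse) simp
      also have "1 *\<^sub>R w = w" by simp
      finally show ?thesis .
    qed
  qed
  moreover have "convex K" unfolding K_def
    by (intro convex_Int convex_hyperplane convex_cball)
  moreover have "compact K" unfolding K_def
    by (intro closed_Int_compact closed_hyperplane compact_cball)
  ultimately show ?thesis unfolding homeomorphic_def by blast
qed

lemma punctured_sphere_homeomorphic_plane:
  assumes "q \<in> S2"
  shows "S2 - {q} homeomorphic (UNIV :: complex set)"
proof -
  obtain c :: "real^3" where c: "c \<noteq> 0" using axis_eq_0_iff[of 1 "1::real"] by (metis zero_neq_one)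
  have "S2 - {q} homeomorphic {x::real^3. c \<bullet> x = 0}"
    using assms c by (intro homeomorphic_punctured_sphere_hyperplane) auto
  also have "{x::real^3. c \<bullet> x = 0} homeomorphic (UNIV :: complex set)"
    by (rule homeomorphic_subspaces) (use c in \<open>auto simp: subspace_hyperplane dim_hyperplane\<close>)
  finally show ?thesis .
qed

text \<open>Removing the point \<open>q\<close> of \<open>P\<close> turns the sphere into the plane of Janiszewski's theorem, which
  then applies to one disc after another.\<close>

lemma Janiszewski_sphere:
  fixes D :: "'i \<Rightarrow> (real^3) set"
  assumes P: "compact P" "P \<subseteq> S2" and q: "q \<in> P" and I: "finite I"
    and D: "\<And>i. i \<in> I \<Longrightarrow> D i \<subseteq> S2 - {q}" "\<And>i. i \<in> I \<Longrightarrow> connected (D i \<inter> P)"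
      "\<And>i. i \<in> I \<Longrightarrow> \<exists>K :: (real^3) set. convex K \<and> compact K \<and> D i homeomorphic K"
    and disj: "disjoint_family_on D I"
    and cc: "connected_component (S2 - P) y z"
    and yz: "y \<notin> (\<Union>i\<in>I. D i)" "z \<notin> (\<Union>i\<in>I. D i)"
  shows "connected_component (S2 - (P \<union> (\<Union>i\<in>I. D i))) y z"
proof -
  have "S2 - {q} homeomorphic (UNIV :: complex set)"
    using q P by (intro punctured_sphere_homeomorphic_plane) auto
  then obtain h k where hk: "homeomorphism (S2 - {q}) (UNIV :: complex set) h k"
    unfolding homeomorphic_def by blast
  have kh: "k (h x) = x" if "x \<in> S2 - {q}" for x using hk that by (simp add: homeomorphism_apply1)
  have hk': "h (k x) = x" "k x \<in> S2 - {q}" for x using hk unfolding homeomorphism_def by blast+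
  have hc: "continuous_on (S2 - {q}) h" and kc: "continuous_on UNIV k" using hk unfolding homeomorphism_def by auto
  obtain C where C: "connected C" "C \<subseteq> S2 - P" "y \<in> C" "z \<in> C" using cc unfolding connected_component_def by blast
  have Cq: "C \<subseteq> S2 - {q}" using C q by blast
  have hinj: "h a = h b \<Longrightarrow> a = b" if "a \<in> S2 - {q}" "b \<in> S2 - {q}" for a b using kh that by metis
  have ccP: "connected_component (- h ` (P - {q})) (h y) (h z)"
    unfolding connected_component_def
  proof (intro exI conjI)
    show "connected (h ` C)" using C(1) Cq hc by (meson connected_continuous_image continuous_on_subset)
    show "h ` C \<subseteq> - h ` (P - {q})"
    proof
      fix x assume "x \<in> h ` C"
      then obtain a where a: "a \<in> C" "x = h a" by blast
      show "x \<in> - h ` (P - {q})"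
      proof
        assume "x \<in> h ` (P - {q})"
        then obtain b where b: "b \<in> P - {q}" "x = h b" by blast
        have "a \<in> S2 - {q}" "b \<in> S2 - {q}" using a b Cq P(2) by blast+
        then have "a = b" by (rule hinj) (use a b in simp)
        then show False using a C(2) b by blast
      qed
    qed
  qed (use C in auto)
  \<comment> \<open>The point \<open>q\<close> goes to infinity, so this image is closed but
    possibly unbounded. The discs avoid \<open>q\<close> and have compact images, which gives the
    compact set that Janiszewski's theorem asks for.\<close>
  have clP: "closed (h ` (P - {q}))"
  proof -
    have "closedin (top_of_set (S2 - {q})) (P - {q})"
    proof -
      have "P - {q} = (S2 - {q}) \<inter> P" using P by blast
      then show ?thesis using P(1) compact_imp_closed by (auto simp: closedin_closed)
    qed
    then have "closedin (top_of_set (UNIV :: complex set)) (h ` (P - {q}))"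
      by (rule homeomorphism_imp_closed_map[OF hk])
    then show ?thesis by simp
  qed
  have "finite J \<Longrightarrow> J \<subseteq> I \<Longrightarrow>
      closed (h ` (P - {q}) \<union> (\<Union>i\<in>J. h ` D i)) \<and>
      connected_component (- (h ` (P - {q}) \<union> (\<Union>i\<in>J. h ` D i))) (h y) (h z)" for J
  proof (induction J rule: finite_induct)
    case empty
    then show ?case using ccP clP by simp
  next
    case (insert i J)
    let ?T = "h ` (P - {q}) \<union> (\<Union>i\<in>J. h ` D i)"
    have i: "i \<in> I" using insert by blast
    obtain K :: "(real^3) set" where K: "convex K" "compact K" "D i homeomorphic K" using D(3) i by blast
    have Dq: "D i \<subseteq> S2 - {q}" using D(1) i .
    have hD: "homeomorphism (D i) (h ` D i) h k"
      by (rule homeomorphism_of_subsets[OF hk Dq]) auto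
    then have "h ` D i homeomorphic K"
      using K(3) homeomorphic_sym homeomorphic_trans unfolding homeomorphic_def[of "D i" "h ` D i"] by (metis homeomorphic_def)
    then have conn: "connected (- h ` D i)"
      using K by (intro connected_complement_homeomorphic_convex_compact[of _ K]) auto
    have cD: "compact (h ` D i)"
      using K(2) \<open>h ` D i homeomorphic K\<close> homeomorphic_compactness by blast
    have y: "y \<in> S2 - {q}" and z: "z \<in> S2 - {q}" using C Cq by blast+
    have "h y \<notin> h ` D i"
    proof
      assume "h y \<in> h ` D i"
      then obtain b where b: "b \<in> D i" "h y = h b" by blast
      have "b \<in> S2 - {q}" using Dq b by blast
      with y have "y = b" by (rule hinj) (rule b(2))
      then show False using b yz(1) i by blast
    qed
    moreover have "h z \<notin> h ` D i"
    proof
      assume "h z \<in> h ` D i"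
      then obtain b where b: "b \<in> D i" "h z = h b" by blast
      have "b \<in> S2 - {q}" using Dq b by blast
      with z have "z = b" by (rule hinj) (rule b(2))
      then show False using b yz(2) i by blast
    qed
    ultimately have ccD: "connected_component (- h ` D i) (h y) (h z)"
      using conn unfolding connected_iff_connected_component by simp
    \<comment> \<open>The discs treated before are disjoint from this one, so the new intersection
      is the connected set where the disc meets \<open>P\<close>.\<close>
    have int: "h ` D i \<inter> ?T = h ` (D i \<inter> P)"
    proof
      show "h ` D i \<inter> ?T \<subseteq> h ` (D i \<inter> P)"
      proof
        fix x assume x: "x \<in> h ` D i \<inter> ?T"
        then obtain a where a: "a \<in> D i" "x = h a" by blast
        then have aq: "a \<in> S2 - {q}" using Dq by blast
        consider b where "b \<in> P - {q}" "x = h b" | j b where "j \<in> J" "b \<in> D j" "x = h b" using x by blast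
        then show "x \<in> h ` (D i \<inter> P)"
        proof cases
          case 1
          then have "b \<in> S2 - {q}" using P by blast
          with aq have "a = b" by (rule hinj) (use a 1 in simp)
          then show ?thesis using 1 a by blast
        next
          case 2
          then have j: "j \<in> I" "j \<noteq> i" using insert by blast+
          then have "b \<in> S2 - {q}" using D(1) 2 by blast
          with aq have "a = b" by (rule hinj) (use a 2 in simp)
          then have "a \<in> D i \<inter> D j" using a 2 by blast
          then show ?thesis using disj i j unfolding disjoint_family_on_def by blast
        qed
      qed
      show "h ` (D i \<inter> P) \<subseteq> h ` D i \<inter> ?T" using Dq by blast
    qed
    have "D i \<inter> P \<subseteq> S2 - {q}" using Dq by blast
    then have "connected (h ` (D i \<inter> P))"
      using D(2)[OF i] hc by (meson connected_continuous_image continuous_on_subset)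
    moreover have IH: "closed ?T" "connected_component (- ?T) (h y) (h z)" using insert by blast+
    ultimately have "connected_component (- (h ` D i \<union> ?T)) (h y) (h z)"
      using Janiszewski[OF cD IH(1) _ ccD IH(2)] int by simp
    moreover have "closed (h ` D i \<union> ?T)" by (intro closed_Un IH compact_imp_closed cD)
    ultimately show ?case by (simp add: Un_left_commute)
  qed
  from this[of I] have "connected_component (- (h ` (P - {q}) \<union> (\<Union>i\<in>I. h ` D i))) (h y) (h z)" using I by blast
  then obtain E where E: "connected E" "E \<subseteq> - (h ` (P - {q}) \<union> (\<Union>i\<in>I. h ` D i))" "h y \<in> E" "h z \<in> E"
    unfolding connected_component_def by blast
  show ?thesis unfolding connected_component_def
  proof (intro exI conjI)
    show "connected (k ` E)" using E(1) kc by (meson connected_continuous_image continuous_on_subset subset_UNIV)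
    show "k ` E \<subseteq> S2 - (P \<union> (\<Union>i\<in>I. D i))"
    proof
      fix x assume "x \<in> k ` E"
      then obtain e where e: "e \<in> E" "x = k e" by blast
      then have x: "x \<in> S2 - {q}" "h x = e" using hk' by auto
      have "x \<notin> P" using e(1) E(2) x by blast
      moreover have "x \<notin> D i" if "i \<in> I" for i using e(1) E(2) x that by blast
      ultimately show "x \<in> S2 - (P \<union> (\<Union>i\<in>I. D i))" using x by blast
    qed
    show "y \<in> k ` E" "z \<in> k ` E" using E(3,4) kh C(3,4) Cq by (metis image_eqI subsetD)+
  qed
qed

section \<open>Continuous arguments in the plane\<close>

lemma exp_Im_Ln: "z \<noteq> 0 \<Longrightarrow> exp (\<i> * of_real (Im (Ln z))) = z /\<^sub>R norm z"
proof -
  assume z: "z \<noteq> 0"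
  have "z = exp (of_real (ln (norm z)) + \<i> * of_real (Im (Ln z)))"
    using z exp_Ln[OF z] complex_eq[of "Ln z"] by simp
  also have "\<dots> = of_real (norm z) * exp (\<i> * of_real (Im (Ln z)))"
    using z by (simp add: exp_add exp_of_real)
  finally show "exp (\<i> * of_real (Im (Ln z))) = z /\<^sub>R norm z"
    using z by (simp add: scaleR_conv_of_real field_simps)
qed

text \<open>Within the complement of \<open>K\<close>, the origin can be moved to a point
  \<open>b\<close> farther out than all of \<open>K\<close>. This deforms the direction seen from
  the origin into the direction seen from \<open>b\<close>, which has a continuous argument; a map
  to the circle that is homotopic to an inessential one is inessential.\<close>

lemma continuous_argument_plane:
  fixes K :: "complex set"
  assumes K: "compact K" "0 \<notin> K" and unb: "\<not> bounded (connected_component_set (- K) 0)"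
  obtains L where "continuous_on K L" "\<And>x. x \<in> K \<Longrightarrow> exp (\<i> * of_real (L x)) = x /\<^sub>R norm x"
proof -
  obtain B where B: "0 < B" "\<And>x. x \<in> K \<Longrightarrow> norm x \<le> B"
    using compact_imp_bounded[OF K(1)] bounded_pos by metis
  obtain b where b: "connected_component (- K) 0 b" "B < norm b"
    using unb unfolding bounded_iff by (metis linorder_not_less mem_Collect_eq)
  have "open (- K)" using K compact_imp_closed by blast
  then have "path_component (- K) 0 b" using b(1) open_path_connected_component by metis
  from Borsuk_maps_homotopic_in_path_component[OF this]
  have hom: "homotopic_with_canon (\<lambda>x. True) K (sphere 0 1) (\<lambda>x. inverse (norm (x - 0)) *\<^sub>R (x - 0)) (\<lambda>x. inverse (norm (x - b)) *\<^sub>R (x - b))" .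
  have b0: "b \<noteq> 0" using b B by auto
  have re: "0 < Re ((b - x) / b)" if "x \<in> K" for x
  proof -
    have "norm (x / b) < 1" using B(2)[OF that] b(2) b0 by (simp add: norm_divide)
    then have "Re (x / b) < 1" using complex_Re_le_cmod[of "x / b"] by linarith
    then show ?thesis using b0 by (simp add: diff_divide_distrib)
  qed
  \<comment> \<open>An argument of \<open>x - b\<close>, as that of \<open>(b - x) / b\<close> plus
    that of \<open>- b\<close>. The quotient stays in the right half-plane, where the principal
    logarithm is continuous.\<close>
  define M where "M x = Im (Ln ((b - x) / b)) + Im (Ln (- b))" for x
  have "continuous_on K M" unfolding M_def
    by (intro continuous_intros) (use b0 re in \<open>force simp: complex_nonpos_Reals_iff\<close>)+
  moreover have "inverse (norm (x - b)) *\<^sub>R (x - b) = exp (\<i> * of_real (M x))" if "x \<in> K" for x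
  proof -
    have nz: "(b - x) / b \<noteq> 0" "- b \<noteq> 0" using re[OF that] b0 by auto
    have "exp (\<i> * of_real (M x)) = (((b - x) / b) /\<^sub>R norm ((b - x) / b)) * ((- b) /\<^sub>R norm (- b))"
      unfolding M_def of_real_add distrib_left exp_add exp_Im_Ln[OF nz(1)] exp_Im_Ln[OF nz(2)] ..
    also have "\<dots> = (x - b) /\<^sub>R norm (x - b)"
      using b0 nz by (simp add: norm_divide norm_minus_commute scaleR_conv_of_real field_simps)
    finally show ?thesis by simp
  qed
  ultimately have "\<exists>a. homotopic_with_canon (\<lambda>h. True) K (sphere 0 1) (\<lambda>x. inverse (norm (x - b)) *\<^sub>R (x - b)) (\<lambda>t. a)"
    unfolding inessential_eq_continuous_logarithm_circle by blast
  then have "\<exists>a. homotopic_with_canon (\<lambda>h. True) K (sphere 0 1) (\<lambda>x. inverse (norm (x - 0)) *\<^sub>R (x - 0)) (\<lambda>t. a)"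
    using hom homotopic_with_trans by blast
  then show ?thesis
    unfolding inessential_eq_continuous_logarithm_circle using that by auto
qed

subsection \<open>Closed braids\<close>

text \<open>The inverse of the Mercator projection: \<open>v\<close> parametrizes the meridian at longitude \<open>\<theta>\<close>, with
  the poles at \<open>v = \<plusminus>\<infinity>\<close>.\<close>

definition mercator :: "real \<Rightarrow> real \<Rightarrow> real^3" where
  "mercator \<theta> v = vector [cos \<theta> / cosh v, sin \<theta> / cosh v, tanh v]"

lemma mercator_nth [simp]:
  "mercator \<theta> v $ 1 = cos \<theta> / cosh v" "mercator \<theta> v $ 2 = sin \<theta> / cosh v" "mercator \<theta> v $ 3 = tanh v"
  unfolding mercator_def by (simp_all add: vector_3)

lemma mercator_sphere: "mercator \<theta> v \<in> S2"
proof -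
  have "mercator \<theta> v \<bullet> mercator \<theta> v = (cos \<theta> / cosh v)\<^sup>2 + (sin \<theta> / cosh v)\<^sup>2 + (sinh v / cosh v)\<^sup>2"
    by (simp add: inner_vec_def sum_3 tanh_def power2_eq_square)
  also have "\<dots> = ((cos \<theta>)\<^sup>2 + (sin \<theta>)\<^sup>2 + (sinh v)\<^sup>2) / (cosh v)\<^sup>2"
    by (simp only: power_divide add_divide_distrib)
  also have "(cos \<theta>)\<^sup>2 + (sin \<theta>)\<^sup>2 + (sinh v)\<^sup>2 = (cosh v)\<^sup>2" by (simp add: cosh_square_eq)
  finally show ?thesis by (simp add: norm_eq_1)
qed

lemma mercator_eq_iff: "mercator \<theta> v = mercator \<theta>' v' \<longleftrightarrow> same_angle \<theta> \<theta>' \<and> v = v'"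
proof
  assume e: "mercator \<theta> v = mercator \<theta>' v'"
  then have "tanh v = tanh v'" by (metis mercator_nth(3))
  then have v: "v = v'" by simp
  then have "cos \<theta> = cos \<theta>'" "sin \<theta> = sin \<theta>'"
    using arg_cong[OF e, of "\<lambda>x. x $ 1"] arg_cong[OF e, of "\<lambda>x. x $ 2"] by simp_all
  then show "same_angle \<theta> \<theta>' \<and> v = v'" using v by (simp add: same_angle_cis complex_eq_iff)
next
  assume "same_angle \<theta> \<theta>' \<and> v = v'"
  then show "mercator \<theta> v = mercator \<theta>' v'"
    by (simp add: same_angle_cis complex_eq_iff mercator_def)
qed

lemma continuous_on_vec3:
  fixes f :: "'a::t2_space \<Rightarrow> real^3"
  assumes "continuous_on S (\<lambda>x. f x $ 1)" "continuous_on S (\<lambda>x. f x $ 2)" "continuous_on S (\<lambda>x. f x $ 3)"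
  shows "continuous_on S f"
proof -
  have "continuous_on S (\<lambda>x. \<chi> i. f x $ i)"
    by (intro continuous_on_vec_lambda) (use assms exhaust_3 in metis)
  then show ?thesis by simp
qed

lemma continuous_on_mercator [continuous_intros]:
  fixes f h :: "'a::t2_space \<Rightarrow> real"
  assumes "continuous_on S f" "continuous_on S h"
  shows "continuous_on S (\<lambda>x. mercator (f x) (h x))"
  by (rule continuous_on_vec3) (auto intro!: continuous_intros assms simp: less_imp_neq[symmetric])

lemma has_vector_derivative_vec3:
  fixes f :: "real \<Rightarrow> real^3"
  assumes "((\<lambda>t. f t $ 1) has_real_derivative d $ 1) (at t)" "((\<lambda>t. f t $ 2) has_real_derivative d $ 2) (at t)"
    "((\<lambda>t. f t $ 3) has_real_derivative d $ 3) (at t)"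
  shows "(f has_vector_derivative d) (at t)"
  unfolding has_vector_derivative_def
proof (subst has_derivative_componentwise_within, intro ballI)
  fix b :: "real^3" assume "b \<in> Basis"
  then obtain i where b: "b = axis i 1" unfolding Basis_vec_def by auto
  have "((\<lambda>t. f t $ i) has_real_derivative d $ i) (at t)" using assms exhaust_3[of i] by auto
  then have "((\<lambda>t. f t $ i) has_derivative (\<lambda>h. h * d $ i)) (at t)"
    unfolding has_field_derivative_def by (rule has_derivative_eq_rhs) (simp add: fun_eq_iff mult.commute)
  then show "((\<lambda>x. f x \<bullet> b) has_derivative (\<lambda>x. (x *\<^sub>R d) \<bullet> b)) (at t)"
    unfolding b by (simp add: inner_axis)
qed

text \<open>If the coordinates extend holomorphically to an open set around the real line, all
  derivatives exist at once as real parts of the complex ones.\<close>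

lemma smooth_curve_holomorphic:
  fixes g :: "real \<Rightarrow> real^3" and F :: "3 \<Rightarrow> complex \<Rightarrow> complex"
  assumes S: "open S" "\<And>t. of_real t \<in> S" and F: "\<And>j. F j holomorphic_on S"
    and Fg: "\<And>j t. F j (of_real t) = of_real (g t $ j)"
  shows "smooth_curve g"
proof -
  define D :: "nat \<Rightarrow> real \<Rightarrow> real^3" where "D n t = (\<chi> j. Re ((deriv ^^ n) (F j) (of_real t)))" for n t
  have "D 0 = g" unfolding D_def by (simp add: fun_eq_iff vec_eq_iff Fg)
  moreover have "(D n has_vector_derivative D (Suc n) t) (at t)" for n t
  proof -
    have "((\<lambda>t. D n t $ j) has_real_derivative D (Suc n) t $ j) (at t)" for j
    proof -
      have "(deriv ^^ n) (F j) holomorphic_on S" by (rule holomorphic_higher_deriv[OF F S(1)])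
      then have "((deriv ^^ n) (F j) has_field_derivative deriv ((deriv ^^ n) (F j)) (of_real t)) (at (of_real t))"
        using S by (intro holomorphic_derivI) auto
      then have "((\<lambda>x. (deriv ^^ n) (F j) (of_real x)) has_vector_derivative deriv ((deriv ^^ n) (F j)) (of_real t)) (at t)"
        by (rule has_vector_derivative_real_field)
      from bounded_linear.has_vector_derivative[OF bounded_linear_Re this]
      show ?thesis unfolding D_def by (simp add: has_real_derivative_iff_has_vector_derivative)
    qed
    then show ?thesis by (intro has_vector_derivative_vec3) auto
  qed
  ultimately show ?thesis unfolding smooth_curve_def by blast
qed

text \<open>The velocity of a moving point \<open>mercator\<close> whose longitude and height change
  at the rates \<open>a\<close> and \<open>b\<close>.\<close>

definition tangent :: "real \<Rightarrow> real \<Rightarrow> real \<Rightarrow> real \<Rightarrow> real^3" where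
  "tangent \<theta> v a b = vector [(- (sin \<theta> * a) * cosh v - cos \<theta> * (sinh v * b)) / (cosh v)\<^sup>2,
     (cos \<theta> * a * cosh v - sin \<theta> * (sinh v * b)) / (cosh v)\<^sup>2, b / (cosh v)\<^sup>2]"

lemma tangent_nth: "tangent \<theta> v a b $ 1 = (- (sin \<theta> * a) * cosh v - cos \<theta> * (sinh v * b)) / (cosh v)\<^sup>2"
  "tangent \<theta> v a b $ 2 = (cos \<theta> * a * cosh v - sin \<theta> * (sinh v * b)) / (cosh v)\<^sup>2"
  "tangent \<theta> v a b $ 3 = b / (cosh v)\<^sup>2"
  unfolding tangent_def by (simp_all add: vector_3)

lemma mercator_derivative:
  assumes "(f has_real_derivative a) (at t)" "(h has_real_derivative b) (at t)"
  shows "((\<lambda>t. mercator (f t) (h t)) has_vector_derivative tangent (f t) (h t) a b) (at t)"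
proof (rule has_vector_derivative_vec3)
  have c: "cosh (h t) \<noteq> 0" using cosh_real_pos[of "h t"] by linarith
  show "((\<lambda>t. mercator (f t) (h t) $ 1) has_real_derivative tangent (f t) (h t) a b $ 1) (at t)"
    unfolding tangent_nth mercator_nth using assms c
    by (auto intro!: derivative_eq_intros simp: power2_eq_square)
  show "((\<lambda>t. mercator (f t) (h t) $ 2) has_real_derivative tangent (f t) (h t) a b $ 2) (at t)"
    unfolding tangent_nth mercator_nth using assms c
    by (auto intro!: derivative_eq_intros simp: power2_eq_square)
  have "1 - (tanh (h t))\<^sup>2 = ((cosh (h t))\<^sup>2 - (sinh (h t))\<^sup>2) / (cosh (h t))\<^sup>2"
    using c by (simp add: tanh_def power_divide diff_divide_distrib)
  also have "(cosh (h t))\<^sup>2 - (sinh (h t))\<^sup>2 = 1" by (simp add: cosh_square_eq)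
  finally have "1 - (tanh (h t))\<^sup>2 = 1 / (cosh (h t))\<^sup>2" .
  then show "((\<lambda>t. mercator (f t) (h t) $ 3) has_real_derivative tangent (f t) (h t) a b $ 3) (at t)"
    unfolding tangent_nth mercator_nth using assms c
    by (auto intro!: derivative_eq_intros)
qed

lemma tangent_nonzero: "a \<noteq> 0 \<Longrightarrow> tangent \<theta> v a b \<noteq> 0"
proof
  assume a: "a \<noteq> 0" and z: "tangent \<theta> v a b = 0"
  have c: "cosh v \<noteq> 0" using cosh_real_pos[of v] by linarith
  have "b = 0" using arg_cong[OF z, of "\<lambda>x. x $ 3"] c by (simp add: tangent_nth)
  then have "sin \<theta> = 0" "cos \<theta> = 0"
    using arg_cong[OF z, of "\<lambda>x. x $ 1"] arg_cong[OF z, of "\<lambda>x. x $ 2"] c a by (simp_all add: tangent_nth)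
  then show False using sin_cos_squared_add[of \<theta>] by simp
qed

text \<open>The rates \<open>(a, b)\<close> and \<open>(a, b')\<close> are independent. In
  coordinates, the first two entries of the cross product are the cosine and the sine of the
  longitude times the same nonzero factor.\<close>

lemma tangent_transversal:
  assumes "same_angle \<theta> \<theta>'" "a \<noteq> 0" "b \<noteq> b'"
  shows "cross3 (tangent \<theta> v a b) (tangent \<theta>' v a b') \<noteq> 0"
proof
  have "cos \<theta>' = cos \<theta>" "sin \<theta>' = sin \<theta>" using assms(1) by (simp_all add: same_angle_cis complex_eq_iff)
  then have e: "tangent \<theta>' v a b' = tangent \<theta> v a b'" unfolding tangent_def by simp
  assume "cross3 (tangent \<theta> v a b) (tangent \<theta>' v a b') = 0"
  then have z: "cross3 (tangent \<theta> v a b) (tangent \<theta> v a b') = 0" unfolding e .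
  have c: "cosh v \<noteq> 0" using cosh_real_pos[of v] by linarith
  have "cross3 (tangent \<theta> v a b) (tangent \<theta> v a b') $ 1 = cos \<theta> * a * cosh v * (b' - b) / ((cosh v)\<^sup>2 * (cosh v)\<^sup>2)"
    unfolding cross3_def by (simp add: vector_3 tangent_nth diff_divide_distrib[symmetric]) (simp add: algebra_simps)
  moreover have "cross3 (tangent \<theta> v a b) (tangent \<theta> v a b') $ 2 = sin \<theta> * a * cosh v * (b' - b) / ((cosh v)\<^sup>2 * (cosh v)\<^sup>2)"
    unfolding cross3_def by (simp add: vector_3 tangent_nth diff_divide_distrib[symmetric]) (simp add: algebra_simps)
  ultimately have "cos \<theta> = 0" "sin \<theta> = 0" using z c assms(2,3) by simp_all
  then show False using sin_cos_squared_add[of \<theta>] by simp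
qed

text \<open>A closed braid with \<open>k\<close> strands: all strands advance in longitude at the
  same speed \<open>k\<close>. They cross where the heights agree at equal longitude, and crossing
  transversally means having different slopes. The function \<open>H\<close> extends the height
  holomorphically.\<close>

lemma braid_gauss_curve:
  fixes h h' :: "real \<Rightarrow> real" and H :: "complex \<Rightarrow> complex" and k :: nat and T :: "int \<Rightarrow> real"
  assumes k: "0 < k" and H: "H holomorphic_on UNIV" "\<And>t. H (of_real t) = of_real (h t)"
    and per: "\<And>t. h (t + 2*pi) = h t" and der: "\<And>t. (h has_real_derivative h' t) (at t)"
    and N: "0 < N" and T: "strict_mono T" "\<And>i k. T (i + N * k) = T i + 2*pi * of_int k"
    and meet: "\<And>s t :: real. h s = h t \<and> same_angle (real k * s) (real k * t) \<longleftrightarrow>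
        same_angle s t \<or> (\<exists>i. s = T i \<and> same_angle t (T (m i)))"
    and m: "\<And>i k. m i \<noteq> i + N * k"
    and trans: "\<And>i t. same_angle t (T (m i)) \<Longrightarrow> h' (T i) \<noteq> h' t"
  shows "gauss_curve (\<lambda>t. mercator (real k * t) (h t)) N T m"
proof -
  define g where "g t = mercator (real k * t) (h t)" for t :: real
  have gmeet: "g s = g t \<longleftrightarrow> same_angle s t \<or> (\<exists>i. s = T i \<and> same_angle t (T (m i)))" for s t :: real
    unfolding g_def mercator_eq_iff using meet by blast
  have vd: "vector_derivative g (at t) = tangent (real k * t) (h t) (real k) (h' t)" for t :: real
    unfolding g_def
    by (rule vector_derivative_at, rule mercator_derivative) (auto intro!: derivative_eq_intros der)
  have fin: "finite (double_points g)"
  proof (rule finite_subset)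
    show "double_points g \<subseteq> (\<lambda>i. g (T i)) ` {0..<N}"
    proof
      fix p assume "p \<in> double_points g"
      then obtain s t where st: "s \<in> {0..<2*pi}" "t \<in> {0..<2*pi}" "s \<noteq> t" "g s = p" "g t = p"
        unfolding double_points_def by blast
      then have "\<bar>s - t\<bar> < 2*pi" by auto
      then have "\<not> same_angle s t" using same_angle_near st by blast
      then obtain i where "s = T i" using gmeet st by metis
      moreover have "g (T i) = g (T (i mod N))"
      proof -
        have "same_angle (T i) (T (i mod N))"
          unfolding same_angle_def using T(2)[of "i mod N" "i div N"] by (intro exI[of _ "i div N"]) simp
        then show ?thesis using gmeet by blast
      qed
      moreover have "i mod N \<in> {0..<N}" using N by simp
      ultimately show "p \<in> (\<lambda>i. g (T i)) ` {0..<N}" using st by blast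
    qed
  qed simp
  have "smooth_curve g"
  proof (rule smooth_curve_holomorphic)
    \<comment> \<open>The complement of the zeros of the hyperbolic cosine of \<open>H\<close>, the
      common denominator of the three coordinates.\<close>
    let ?S = "{z. exp (H z) + exp (- H z) \<noteq> 0}"
    let ?F = "\<lambda>(j::3) z. (if j = 1 then 2 * cos (of_nat k * z) else if j = 2 then 2 * sin (of_nat k * z)
      else exp (H z) - exp (- H z)) / (exp (H z) + exp (- H z))"
    have "continuous_on UNIV (\<lambda>z. exp (H z) + exp (- H z))"
      by (intro continuous_intros holomorphic_on_imp_continuous_on H(1))
    then show "open ?S" by (rule open_Collect_neq) (rule continuous_on_const)
    have ch: "exp (H (of_real t)) + exp (- H (of_real t)) = of_real (2 * cosh (h t))"
      and sh: "exp (H (of_real t)) - exp (- H (of_real t)) = of_real (2 * sinh (h t))" for t :: real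
      unfolding H(2) cosh_def sinh_def by (simp_all add: exp_of_real[symmetric])
    show "of_real t \<in> ?S" for t :: real
    proof -
      have "2 * cosh (h t) \<noteq> 0" using cosh_real_pos[of "h t"] by linarith
      then show ?thesis unfolding mem_Collect_eq ch by (simp only: of_real_eq_0_iff not_False_eq_True)
    qed
    show "?F j holomorphic_on ?S" for j
      by (cases "j = 1"; cases "j = 2") (auto intro!: holomorphic_intros holomorphic_on_subset[OF H(1)])
    show "?F j (of_real t) = of_real (g t $ j)" for j t
    proof -
      have "of_nat k * complex_of_real t = of_real (real k * t)" by simp
      then show ?thesis
        using exhaust_3[of j] unfolding g_def ch sh
        by (auto simp: cos_of_real sin_of_real tanh_def simp del: of_real_mult)
          (simp_all add: field_simps)
    qed
  qed
  moreover have "g (t + 2*pi) = g t" for t :: real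
    unfolding g_def mercator_eq_iff per same_angle_def
    by (auto intro!: exI[of _ "int k"] simp: algebra_simps)
  moreover have "s = t \<or> t = u \<or> s = u"
    if stu: "s \<in> {0..<2*pi}" "t \<in> {0..<2*pi}" "u \<in> {0..<2*pi}" and e: "g s = g t \<and> g t = g u" for s t u
  proof (rule ccontr)
    assume ne: "\<not> ?thesis"
    have "\<bar>s - t\<bar> < 2*pi" "\<bar>t - u\<bar> < 2*pi" "\<bar>s - u\<bar> < 2*pi" using stu by auto
    then have n: "\<not> same_angle s t" "\<not> same_angle t u" "\<not> same_angle s u" using same_angle_near ne by blast+
    have "g s = g t" "g s = g u" using e by auto
    then obtain i j where i: "s = T i" "same_angle t (T (m i))" and j: "s = T j" "same_angle u (T (m j))"
      using n gmeet by metis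
    then have "i = j" using strict_mono_eq[OF T(1)] by metis
    then show False using i j n same_angle_sym same_angle_trans by metis
  qed
  moreover have "cross3 (vector_derivative g (at s)) (vector_derivative g (at t)) \<noteq> 0"
    if st: "s \<in> {0..<2*pi}" "t \<in> {0..<2*pi}" and e: "s \<noteq> t \<and> g s = g t" for s t :: real
  proof -
    have "\<bar>s - t\<bar> < 2*pi" using st by auto
    then have "\<not> same_angle s t" using same_angle_near e by blast
    then have "h' s \<noteq> h' t" using gmeet[of s t] e trans by blast
    moreover have "h s = h t" "same_angle (real k * s) (real k * t)" using e unfolding g_def mercator_eq_iff by auto
    ultimately show ?thesis unfolding vd using k by (simp add: tangent_transversal)
  qed
  moreover have "range g \<subseteq> S2" unfolding g_def using mercator_sphere by blast
  moreover have "vector_derivative g (at t) \<noteq> 0" for t unfolding vd using k by (simp add: tangent_nonzero)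
  ultimately have "generic_immersion g" unfolding generic_immersion_def using fin by blast
  then show ?thesis
    unfolding g_def[symmetric, abs_def] using N T gmeet m by unfold_locales auto
qed

subsection \<open>The two knot projections\<close>

lemma same_angle_mult: "same_angle s t \<Longrightarrow> same_angle (of_int n * s) (of_int n * t)"
proof -
  assume "same_angle s t"
  then obtain k :: int where "s = t + 2*pi * of_int k" unfolding same_angle_def by blast
  then have "of_int n * s = of_int n * t + 2*pi * of_int (n * k)" by (simp add: algebra_simps)
  then show ?thesis unfolding same_angle_def by blast
qed

lemma same_angle_cos: "same_angle s t \<Longrightarrow> cos s = cos t"
  and same_angle_sin: "same_angle s t \<Longrightarrow> sin s = sin t"
  by (simp_all add: same_angle_cis complex_eq_iff)

lemma strict_mono_int:
  fixes f :: "int \<Rightarrow> real"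
  assumes "\<And>i. f i < f (i + 1)"
  shows "strict_mono f"
proof (rule strict_monoI)
  fix i j :: int assume "i < j"
  have "f i < f (i + 1 + int n)" for n
  proof (induction n)
    case (Suc n)
    then show ?case using assms[of "i + 1 + int n"] by (simp add: algebra_simps)
  qed (simp add: assms)
  from this[of "nat (j - i - 1)"] show "f i < f j" using \<open>i < j\<close> by simp
qed

text \<open>At the longitude of the parameter \<open>t\<close> the other strand has the parameter
  \<open>t + pi\<close> and the opposite height. Hence the passes are the zeros of
  \<open>cos (5 * t)\<close>: ten in one turn, matched by adding pi, that is by adding 5 to the
  index.\<close>

definition five_curve :: "real \<Rightarrow> real^3" where
  "five_curve t = mercator (real 2 * t) (cos (5 * t))"

definition five_pass :: "int \<Rightarrow> real" where
  "five_pass i = pi / 10 + pi / 5 * of_int i"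

lemma cos_five_pass: "cos (5 * five_pass i) = 0"
proof -
  have "5 * five_pass i = of_int (2 * i + 1) * (pi / 2)" unfolding five_pass_def by (simp add: field_simps)
  moreover have "odd (2 * i + 1)" by simp
  ultimately show ?thesis unfolding cos_zero_iff_int by blast
qed

lemma cos_add_5pi: "cos (5 * (t + pi)) = - cos (5 * t)" and sin_add_5pi: "sin (5 * (t + pi)) = - sin (5 * t)"
  for t :: real
proof -
  have e: "5 * (t + pi) = (5 * t + pi) + 2*pi * of_int 2" by simp
  have "same_angle (5 * (t + pi)) (5 * t + pi)" unfolding e same_angle_add by simp
  then show "cos (5 * (t + pi)) = - cos (5 * t)" "sin (5 * (t + pi)) = - sin (5 * t)"
    using same_angle_cos same_angle_sin by (metis cos_periodic_pi sin_periodic_pi)+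
qed

lemma same_angle_five: "same_angle s t \<Longrightarrow> same_angle (5 * s) (5 * t)"
  using same_angle_mult[of s t 5] by simp

lemma five_pass_add: "five_pass (i + 5) = five_pass i + pi"
  unfolding five_pass_def by (simp add: field_simps)

lemma five_gauss_curve: "gauss_curve five_curve 10 five_pass (\<lambda>i. i + 5)"
  unfolding five_curve_def
proof (rule braid_gauss_curve[where H = "\<lambda>z. cos (5 * z)" and h' = "\<lambda>t. - 5 * sin (5 * t)"])
  show "(\<lambda>z. cos (5 * z)) holomorphic_on UNIV" by (intro holomorphic_intros)
  show "cos (5 * complex_of_real t) = of_real (cos (5 * t))" for t
    using cos_of_real[of "5 * t", where 'a = complex] by simp
  show "cos (5 * (t + 2*pi)) = cos (5 * t)" for t :: real
  proof -
    have "5 * (t + 2*pi) = 5 * t + 2*pi * of_int 5" by simp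
    then have "same_angle (5 * (t + 2*pi)) (5 * t)" by (simp only: same_angle_add same_angle_refl)
    then show ?thesis by (rule same_angle_cos)
  qed
  show "((\<lambda>t. cos (5 * t)) has_real_derivative - 5 * sin (5 * t)) (at t)" for t
    by (auto intro!: derivative_eq_intros)
  show "strict_mono five_pass" by (rule strict_mono_int) (simp add: five_pass_def field_simps)
  show "five_pass (i + 10 * k) = five_pass i + 2*pi * of_int k" for i k
    unfolding five_pass_def by (simp add: field_simps)
  show "i + 5 \<noteq> i + 10 * k" for i k :: int by presburger
  show "- 5 * sin (5 * five_pass i) \<noteq> - 5 * sin (5 * t)" if "same_angle t (five_pass (i + 5))" for i t
  proof -
    have "sin (5 * t) = - sin (5 * five_pass i)"
      using same_angle_sin[OF same_angle_five[OF that]] unfolding five_pass_add sin_add_5pi .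
    moreover have "sin (5 * five_pass i) \<noteq> 0"
      using sin_cos_squared_add[of "5 * five_pass i"] cos_five_pass[of i] by auto
    ultimately show ?thesis by simp
  qed
  show "cos (5 * s) = cos (5 * t) \<and> same_angle (real 2 * s) (real 2 * t) \<longleftrightarrow>
      same_angle s t \<or> (\<exists>i. s = five_pass i \<and> same_angle t (five_pass (i + 5)))" for s t :: real
  proof
    assume a: "cos (5 * s) = cos (5 * t) \<and> same_angle (real 2 * s) (real 2 * t)"
    then obtain l :: int where "2 * s = 2 * t + 2*pi * of_int l" unfolding same_angle_def by auto
    then have l: "s = t + pi * of_int l" by simp
    show "same_angle s t \<or> (\<exists>i. s = five_pass i \<and> same_angle t (five_pass (i + 5)))"
    proof (cases "even l")
      case True
      then obtain j where "l = 2 * j" by blast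
      then have "s = t + 2*pi * of_int j" using l by simp
      then show ?thesis unfolding same_angle_def by blast
    next
      case False
      then obtain j where j: "l = 2 * j + 1" by (elim oddE)
      then have s: "s = (t + pi) + 2*pi * of_int j" using l by (simp add: algebra_simps)
      have "same_angle s (t + pi)" unfolding s same_angle_add by simp
      then have "cos (5 * s) = - cos (5 * t)" using same_angle_cos[OF same_angle_five] cos_add_5pi by metis
      then have "cos (5 * s) = 0" using a by simp
      then obtain i :: int where i: "odd i" "5 * s = of_int i * (pi / 2)" unfolding cos_zero_iff_int by blast
      then obtain n where n: "i = 2 * n + 1" by (elim oddE)
      have "s = five_pass n" unfolding five_pass_def using i n by (simp add: field_simps)
      moreover have "t = five_pass (n + 5) + 2*pi * of_int (- j - 1)"
        unfolding five_pass_add calculation[symmetric] using s by (simp add: algebra_simps)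
      ultimately show ?thesis unfolding same_angle_def by blast
    qed
  next
    assume "same_angle s t \<or> (\<exists>i. s = five_pass i \<and> same_angle t (five_pass (i + 5)))"
    then show "cos (5 * s) = cos (5 * t) \<and> same_angle (real 2 * s) (real 2 * t)"
    proof
      assume "same_angle s t"
      then show ?thesis using same_angle_cos[OF same_angle_five] same_angle_mult[of s t 2] by simp
    next
      assume "\<exists>i. s = five_pass i \<and> same_angle t (five_pass (i + 5))"
      then obtain i where i: "s = five_pass i" "same_angle t (s + pi)" unfolding five_pass_add by blast
      have "cos (5 * t) = - cos (5 * s)" using same_angle_cos[OF same_angle_five[OF i(2)]] cos_add_5pi by simp
      then have "cos (5 * s) = cos (5 * t)" using cos_five_pass[of i] i(1) by simp
      moreover have "same_angle (2 * t) (2 * s)"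
      proof -
        have "same_angle (2 * t) (2 * (s + pi))" using same_angle_mult[OF i(2), of 2] by simp
        also have "2 * (s + pi) = 2 * s + 2*pi * of_int 1" by simp
        finally show ?thesis by (simp only: same_angle_add')
      qed
      ultimately show ?thesis using same_angle_sym by simp
    qed
  qed
qed simp_all

text \<open>With the coefficient \<open>2 + sqrt 3\<close> all passes through double points lie at multiples of \<open>\<pi>/12\<close>,
  namely at 3, 4, 5, 7, 8, 9, 15, 16, 17, 19, 20, 21 modulo 24.\<close>

definition six_height :: "real \<Rightarrow> real" where
  "six_height t = (2 + sqrt 3) * cos t + cos (5 * t)"

definition six_curve :: "real \<Rightarrow> real^3" where
  "six_curve t = mercator (real 3 * t) (six_height t)"

text \<open>Passes come in triples around the multiples of pi/3 that are not multiples of pi. The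
  triple with number \<open>i div 3\<close> is centred at 4, 8, 16, 20 modulo 24 in units of pi/12,
  and \<open>i mod 3 - 1\<close> is the offset from the centre.\<close>

definition six_index :: "int \<Rightarrow> int" where
  "six_index i = 6 * (i div 3) + (if even (i div 3) then 4 else 2) + i mod 3 - 1"

definition six_pass :: "int \<Rightarrow> real" where
  "six_pass i = pi / 12 * of_int (six_index i)"

text \<open>Matched triples are centred pi/3 before and pi/3 after a multiple of pi. Matched passes
  have the same offset, so they are 2 pi/3 apart and have the same longitude.\<close>

definition six_match :: "int \<Rightarrow> int" where
  "six_match i = (if even (i div 3) then i - 3 else i + 3)"

section \<open>Double points and slopes of the three-strand braid\<close>

lemma sin_pi_3_multiples: "sin (5 * (pi / 3)) = - (sqrt 3 / 2)"
proof -
  have "5 * (pi / 3) = 2*pi - pi / 3" by simp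
  then have "sin (5 * (pi / 3)) = sin (2*pi - pi / 3)" by (rule arg_cong)
  also have "\<dots> = - (sqrt 3 / 2)" unfolding sin_diff by (simp add: sin_60)
  finally show ?thesis .
qed

text \<open>Two strands at equal longitude have parameters \<open>x + pi / 3\<close> and
  \<open>x - pi / 3\<close>, up to full turns. With a coefficient \<open>a\<close> for
  \<open>cos t\<close> and \<open>C = cos (2 * x)\<close>, the factor next to \<open>sin x\<close>
  is \<open>4*C^2 + 2*C - 1 - a\<close>. It vanishes at \<open>C = sqrt 3 / 2\<close>, that is at
  pi/12 from a multiple of pi, exactly for \<open>a = 2 + sqrt 3\<close>; this is the origin of the
  coefficient.\<close>

lemma six_height_diff:
  "six_height (x + pi / 3) - six_height (x - pi / 3) =
     sqrt 3 * sin x * ((2 * cos (2 * x) - sqrt 3) * (2 * cos (2 * x) + 1 + sqrt 3))"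
proof -
  have a: "cos (x + pi / 3) - cos (x - pi / 3) = - sqrt 3 * sin x"
    by (simp add: cos_add cos_diff sin_60)
  have b: "cos (5 * (x + pi / 3)) - cos (5 * (x - pi / 3)) = sqrt 3 * sin (5 * x)"
    unfolding distrib_left right_diff_distrib cos_add cos_diff sin_pi_3_multiples by simp
  have "sin (5 * x) = sin (2 * (2 * x) + x)" by (simp add: algebra_simps)
  also have "\<dots> = 2 * sin (2 * x) * cos (2 * x) * cos x + (2 * (cos (2 * x))\<^sup>2 - 1) * sin x"
    unfolding sin_add sin_double[of "2 * x"] cos_double_cos[of "2 * x"] ..
  also have "sin (2 * x) = 2 * sin x * cos x" by (rule sin_double)
  also have "2 * (2 * sin x * cos x) * cos (2 * x) * cos x + (2 * (cos (2 * x))\<^sup>2 - 1) * sin x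
      = sin x * (2 * (2 * (cos x)\<^sup>2) * cos (2 * x) + 2 * (cos (2 * x))\<^sup>2 - 1)"
    by (simp add: power2_eq_square algebra_simps)
  also have "2 * (cos x)\<^sup>2 = 1 + cos (2 * x)" by (simp add: cos_double_cos)
  finally have s5: "sin (5 * x) = sin x * (2 * (1 + cos (2 * x)) * cos (2 * x) + 2 * (cos (2 * x))\<^sup>2 - 1)" .
  have "six_height (x + pi / 3) - six_height (x - pi / 3)
      = (2 + sqrt 3) * (cos (x + pi / 3) - cos (x - pi / 3)) + (cos (5 * (x + pi / 3)) - cos (5 * (x - pi / 3)))"
    unfolding six_height_def by (simp add: algebra_simps)
  also have "\<dots> = sqrt 3 * sin x * (2 * (1 + cos (2 * x)) * cos (2 * x) + 2 * (cos (2 * x))\<^sup>2 - 1 - (2 + sqrt 3))"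
    unfolding a b s5 by (simp add: algebra_simps)
  also have "2 * (1 + cos (2 * x)) * cos (2 * x) + 2 * (cos (2 * x))\<^sup>2 - 1 - (2 + sqrt 3)
      = (2 * cos (2 * x) - sqrt 3) * (2 * cos (2 * x) + 1 + sqrt 3)"
    by (simp add: algebra_simps power2_eq_square)
  finally show ?thesis .
qed

lemma six_height_eq_iff:
  "six_height (x + pi / 3) = six_height (x - pi / 3) \<longleftrightarrow>
     (\<exists>n e :: int. e \<in> {-1, 0, 1} \<and> x = pi / 12 * of_int (12 * n + e))"
proof -
  have "0 < 2 * cos (2 * x) + 1 + sqrt 3"
  proof -
    have "1 < sqrt (3::real)" by simp
    moreover have "-1 \<le> cos (2 * x)" by simp
    ultimately show ?thesis by linarith
  qed
  then have "six_height (x + pi / 3) = six_height (x - pi / 3) \<longleftrightarrow> sin x = 0 \<or> 2 * cos (2 * x) - sqrt 3 = 0"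
    using six_height_diff[of x] by auto
  also have "2 * cos (2 * x) - sqrt 3 = 0 \<longleftrightarrow> cos (2 * x) - cos (pi / 6) = 0" by (simp add: cos_30) linarith
  also have "cos (2 * x) - cos (pi / 6) = 0 \<longleftrightarrow> sin (x + pi / 12) = 0 \<or> sin (x - pi / 12) = 0"
  proof -
    have "(2 * x + pi / 6) / 2 = x + pi / 12" "(pi / 6 - 2 * x) / 2 = - (x - pi / 12)" by simp_all
    then show ?thesis unfolding cos_diff_cos by (simp only: sin_minus) simp
  qed
  also have "sin x = 0 \<or> sin (x + pi / 12) = 0 \<or> sin (x - pi / 12) = 0 \<longleftrightarrow>
     (\<exists>n e :: int. e \<in> {-1, 0, 1} \<and> x = pi / 12 * of_int (12 * n + e))"
  proof
    assume "sin x = 0 \<or> sin (x + pi / 12) = 0 \<or> sin (x - pi / 12) = 0"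
    then consider n :: int where "x = of_int n * pi" | n :: int where "x + pi / 12 = of_int n * pi"
      | n :: int where "x - pi / 12 = of_int n * pi" unfolding sin_zero_iff_int2 by blast
    then show "\<exists>n e :: int. e \<in> {-1, 0, 1} \<and> x = pi / 12 * of_int (12 * n + e)"
    proof cases
      case (1 n)
      then have "x = pi / 12 * of_int (12 * n + 0)" by (simp add: field_simps)
      then show ?thesis by blast
    next
      case (2 n)
      then have "x = pi / 12 * of_int (12 * n + -1)" by (simp add: field_simps)
      then show ?thesis by blast
    next
      case (3 n)
      then have "x = pi / 12 * of_int (12 * n + 1)" by (simp add: field_simps)
      then show ?thesis by blast
    qed
  next
    assume "\<exists>n e :: int. e \<in> {-1, 0, 1} \<and> x = pi / 12 * of_int (12 * n + e)"
    then obtain n e :: int where e: "e \<in> {-1, 0, 1}" and x: "x = pi / 12 * of_int (12 * n + e)" by blast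
    from e consider "e = -1" | "e = 0" | "e = 1" by blast
    then show "sin x = 0 \<or> sin (x + pi / 12) = 0 \<or> sin (x - pi / 12) = 0"
    proof cases
      case 1
      then have "x + pi / 12 = of_int n * pi" using x by (simp add: field_simps)
      then show ?thesis unfolding sin_zero_iff_int2 by blast
    next
      case 2
      then have "x = of_int n * pi" using x by (simp add: field_simps)
      then show ?thesis unfolding sin_zero_iff_int2 by blast
    next
      case 3
      then have "x - pi / 12 = of_int n * pi" using x by (simp add: field_simps)
      then show ?thesis unfolding sin_zero_iff_int2 by blast
    qed
  qed
  finally show ?thesis .
qed

text \<open>Normal form for the passes: \<open>n\<close> numbers the pairs of matched triples and
  \<open>e\<close> is the offset within a triple.\<close>

lemma six_index_blocks:
  assumes "e \<in> {-1, 0, 1 :: int}"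
  shows "six_index (6 * n + 1 + e) = 12 * n + 4 + e" "six_match (6 * n + 1 + e) = 6 * n - 2 + e"
    "six_index (6 * n - 2 + e) = 12 * n - 4 + e" "six_match (6 * n - 2 + e) = 6 * n + 1 + e"
proof -
  have d: "(6 * n + 1 + e) div 3 = 2 * n" "(6 * n + 1 + e) mod 3 = 1 + e"
    "(6 * n - 2 + e) div 3 = 2 * n - 1" "(6 * n - 2 + e) mod 3 = 1 + e"
    using assms by auto presburger+
  show "six_index (6 * n + 1 + e) = 12 * n + 4 + e" "six_match (6 * n + 1 + e) = 6 * n - 2 + e"
    "six_index (6 * n - 2 + e) = 12 * n - 4 + e" "six_match (6 * n - 2 + e) = 6 * n + 1 + e"
    unfolding six_index_def six_match_def d by simp_all
qed

lemma six_pass_blocks: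
  assumes "e \<in> {-1, 0, 1 :: int}" "x = pi / 12 * of_int (12 * n + e)"
  shows "six_pass (6 * n + 1 + e) = x + pi / 3" "six_pass (6 * n - 2 + e) = x - pi / 3"
  unfolding six_pass_def six_index_blocks[OF assms(1)] assms(2) by (simp_all add: field_simps)

lemma six_block_cases:
  obtains n e :: int where "e \<in> {-1, 0, 1}" "i = 6 * n + 1 + e" | n e :: int where "e \<in> {-1, 0, 1}" "i = 6 * n - 2 + e"
proof -
  have e: "i mod 3 - 1 \<in> {-1, 0, 1}" by auto
  show ?thesis
  proof (cases "even (i div 3)")
    case True
    then have "i = 6 * (i div 3 div 2) + 1 + (i mod 3 - 1)" by presburger
    then show ?thesis using that(1) e by blast
  next
    case False
    then have "i = 6 * ((i div 3 + 1) div 2) - 2 + (i mod 3 - 1)" by presburger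
    then show ?thesis using that(2) e by blast
  qed
qed

lemma six_pass_midpoint:
  obtains n e :: int and x where "e \<in> {-1, 0, 1}" "x = pi / 12 * of_int (12 * n + e)"
    "six_pass i = x + pi / 3 \<and> six_pass (six_match i) = x - pi / 3 \<or>
     six_pass i = x - pi / 3 \<and> six_pass (six_match i) = x + pi / 3"
proof (rule six_block_cases[of i])
  fix n e :: int assume e: "e \<in> {-1, 0, 1}" "i = 6 * n + 1 + e"
  show ?thesis
    by (rule that[OF e(1) refl[of "pi / 12 * of_int (12 * n + e)"]]) (simp only: e(2) six_index_blocks[OF e(1)] six_pass_blocks[OF e(1) refl] simp_thms)
next
  fix n e :: int assume e: "e \<in> {-1, 0, 1}" "i = 6 * n - 2 + e"
  show ?thesis
    by (rule that[OF e(1) refl[of "pi / 12 * of_int (12 * n + e)"]]) (simp only: e(2) six_index_blocks[OF e(1)] six_pass_blocks[OF e(1) refl] simp_thms)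
qed

definition six_slope :: "real \<Rightarrow> real" where
  "six_slope t = - (2 + sqrt 3) * sin t - 5 * sin (5 * t)"

lemma six_slope_diff:
  "six_slope (x + pi / 3) - six_slope (x - pi / 3) = - sqrt 3 * ((2 + sqrt 3) * cos x - 5 * cos (5 * x))"
proof -
  have a: "sin (x + pi / 3) - sin (x - pi / 3) = sqrt 3 * cos x"
    by (simp add: sin_add sin_diff sin_60)
  have b: "sin (5 * (x + pi / 3)) - sin (5 * (x - pi / 3)) = - sqrt 3 * cos (5 * x)"
    unfolding distrib_left right_diff_distrib sin_add sin_diff sin_pi_3_multiples by simp
  have "six_slope (x + pi / 3) - six_slope (x - pi / 3)
      = - (2 + sqrt 3) * (sin (x + pi / 3) - sin (x - pi / 3)) - 5 * (sin (5 * (x + pi / 3)) - sin (5 * (x - pi / 3)))"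
    unfolding six_slope_def by (simp add: algebra_simps)
  then show ?thesis unfolding a b by (simp add: algebra_simps)
qed

text \<open>Equal slopes mean \<open>(2 + sqrt 3) * cos x = 5 * cos (5 * x)\<close>. Removing the
  sign \<open>cos (pi * n)\<close> leaves the three angles 0 and plus or minus pi/12. At 0 the left
  side is smaller than 5. At pi/12 it exceeds \<open>3.7 * 0.85\<close>, while the right side is
  below 5/2.\<close>

lemma six_slope_neq:
  assumes e: "e \<in> {-1, 0, 1 :: int}" and x: "x = pi / 12 * of_int (12 * n + e)"
  shows "six_slope (x + pi / 3) \<noteq> six_slope (x - pi / 3)"
proof
  assume "six_slope (x + pi / 3) = six_slope (x - pi / 3)"
  then have z: "(2 + sqrt 3) * cos x = 5 * cos (5 * x)" using six_slope_diff[of x] by simp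
  define y where "y = pi / 12 * of_int e"
  have xy: "x = y + pi * of_int n" unfolding x y_def by (simp add: field_simps)
  have c: "cos x = cos (pi * of_int n) * cos y" unfolding xy by (simp add: cos_add mult.commute)
  have five: "5 * x = (5 * y + pi * of_int n) + 2*pi * of_int (2 * n)" unfolding xy by (simp add: algebra_simps)
  have "same_angle (5 * x) (5 * y + pi * of_int n)" unfolding five same_angle_add by simp
  then have c5: "cos (5 * x) = cos (pi * of_int n) * cos (5 * y)"
    using same_angle_cos by (simp add: cos_add mult.commute)
  have "cos (pi * of_int n) \<noteq> 0" by (simp add: cos_npi_int)
  then have z': "(2 + sqrt 3) * cos y = 5 * cos (5 * y)" using z unfolding c c5 by simp
  have s3: "1.7 < sqrt (3::real)" "sqrt (3::real) < 2"
    by (rule real_less_rsqrt, simp add: power2_eq_square) (rule real_less_lsqrt, simp_all)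
  from e consider "e = 0" | "y = pi / 12 \<or> y = - (pi / 12)" unfolding y_def by auto
  then show False
  proof cases
    case 1
    then show False using z' s3 unfolding y_def by simp
  next
    case 2
    then have "cos y = cos (pi / 12)" "cos (5 * y) = cos (5 * (pi / 12))"
      by (elim disjE; simp only: mult_minus_right cos_minus)+
    then have zz: "(2 + sqrt 3) * cos (pi / 12) = 5 * cos (5 * (pi / 12))" using z' by simp
    have "cos (pi / 6) < cos (pi / 12)" by (rule cos_monotone_0_pi) auto
    then have "0.85 < cos (pi / 12)" using s3 by (simp add: cos_30)
    then have "3.7 * 0.85 < (2 + sqrt 3) * cos (pi / 12)" using s3 by (intro mult_strict_mono) auto
    moreover have "cos (5 * (pi / 12)) < cos (pi / 3)" by (rule cos_monotone_0_pi) auto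
    then have "cos (5 * (pi / 12)) < 1 / 2" by (simp add: cos_60)
    ultimately show False using zz by simp
  qed
qed

lemma six_height_same_angle: "same_angle s t \<Longrightarrow> six_height s = six_height t"
  unfolding six_height_def using same_angle_cos same_angle_cos[OF same_angle_five] by simp

lemma six_slope_same_angle: "same_angle s t \<Longrightarrow> six_slope s = six_slope t"
  unfolding six_slope_def using same_angle_sin same_angle_sin[OF same_angle_five] by simp

lemma six_gauss_curve: "gauss_curve six_curve 12 six_pass six_match"
  unfolding six_curve_def
proof (rule braid_gauss_curve[where H = "\<lambda>z. of_real (2 + sqrt 3) * cos z + cos (5 * z)" and h' = six_slope])
  show "(\<lambda>z. of_real (2 + sqrt 3) * cos z + cos (5 * z)) holomorphic_on UNIV" by (intro holomorphic_intros)
  show "of_real (2 + sqrt 3) * cos (complex_of_real t) + cos (5 * complex_of_real t) = of_real (six_height t)" for t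
    unfolding six_height_def using cos_of_real[of "5 * t", where 'a = complex] cos_of_real[of t, where 'a = complex] by simp
  show "six_height (t + 2*pi) = six_height t" for t :: real
  proof -
    have "same_angle (t + 2*pi * of_int 1) t" unfolding same_angle_add by simp
    then show ?thesis using six_height_same_angle by simp
  qed
  show "(six_height has_real_derivative six_slope t) (at t)" for t
    unfolding six_height_def[abs_def] six_slope_def by (auto intro!: derivative_eq_intros simp: algebra_simps)
  show "strict_mono six_pass"
  proof (rule strict_mono_int)
    fix i :: int
    have "six_index i < six_index (i + 1)" unfolding six_index_def by (cases "even (i div 3)") (simp, presburger)+
    then show "six_pass i < six_pass (i + 1)" unfolding six_pass_def by simp
  qed
  show "six_pass (i + 12 * k) = six_pass i + 2*pi * of_int k" for i k
  proof -
    have "(i + 12 * k) div 3 = i div 3 + 4 * k" "(i + 12 * k) mod 3 = i mod 3" by presburger+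
    then have "six_index (i + 12 * k) = six_index i + 24 * k" unfolding six_index_def by simp
    then show ?thesis unfolding six_pass_def by (simp add: field_simps)
  qed
  show "six_match i \<noteq> i + 12 * k" for i k :: int unfolding six_match_def by (cases "even (i div 3)") (simp, presburger)+
  show "six_slope (six_pass i) \<noteq> six_slope t" if "same_angle t (six_pass (six_match i))" for i t
  proof -
    obtain n e :: int and x where *: "e \<in> {-1, 0, 1}" "x = pi / 12 * of_int (12 * n + e)"
      "six_pass i = x + pi / 3 \<and> six_pass (six_match i) = x - pi / 3 \<or>
       six_pass i = x - pi / 3 \<and> six_pass (six_match i) = x + pi / 3"
      by (rule six_pass_midpoint)
    show ?thesis using six_slope_neq[OF *(1,2)] *(3) six_slope_same_angle[OF that] by metis
  qed
  show "six_height s = six_height t \<and> same_angle (real 3 * s) (real 3 * t) \<longleftrightarrow>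
      same_angle s t \<or> (\<exists>i. s = six_pass i \<and> same_angle t (six_pass (six_match i)))" for s t :: real
  proof
    assume a: "six_height s = six_height t \<and> same_angle (real 3 * s) (real 3 * t)"
    then obtain l :: int where "3 * s = 3 * t + 2*pi * of_int l" unfolding same_angle_def by auto
    then have l: "s = t + 2*pi / 3 * of_int l" by (simp add: field_simps)
    \<comment> \<open>Modulo full turns the two parameters are equal, or one strand is 2 pi/3 ahead
      of the other, or behind it. In the last two cases \<open>x\<close> is the midpoint and
      \<open>six_height_eq_iff\<close> applies.\<close>
    have "l = 3 * (l div 3) \<or> l = 3 * (l div 3) + 1 \<or> l = 3 * (l div 3) + 2" by presburger
    then consider j where "l = 3 * j" | j where "l = 3 * j + 1" | j where "l = 3 * j + 2" by blast
    then show "same_angle s t \<or> (\<exists>i. s = six_pass i \<and> same_angle t (six_pass (six_match i)))"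
    proof cases
      case (1 j)
      then have "s = t + 2*pi * of_int j" using l by simp
      then show ?thesis unfolding same_angle_def by blast
    next
      case (2 j)
      define x where "x = s - pi / 3"
      have t: "t = (x - pi / 3) + 2*pi * of_int (- j)" unfolding x_def using l 2 by (simp add: field_simps)
      have sa: "same_angle t (x - pi / 3)" unfolding t same_angle_add by simp
      have "six_height (x + pi / 3) = six_height (x - pi / 3)"
        using a six_height_same_angle[OF sa] unfolding x_def by simp
      then obtain n e :: int where e: "e \<in> {-1, 0, 1}" "x = pi / 12 * of_int (12 * n + e)"
        unfolding six_height_eq_iff by blast
      have "s = six_pass (6 * n + 1 + e)" "same_angle t (six_pass (six_match (6 * n + 1 + e)))"
        unfolding six_index_blocks[OF e(1)] six_pass_blocks[OF e] using sa unfolding x_def by simp_all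
      then show ?thesis by blast
    next
      case (3 j)
      define x where "x = s + pi / 3"
      have t: "t = (x + pi / 3) + 2*pi * of_int (- j - 1)" unfolding x_def using l 3 by (simp add: field_simps)
      have sa: "same_angle t (x + pi / 3)" unfolding t same_angle_add by simp
      have "six_height (x + pi / 3) = six_height (x - pi / 3)"
        using a six_height_same_angle[OF sa] unfolding x_def by simp
      then obtain n e :: int where e: "e \<in> {-1, 0, 1}" "x = pi / 12 * of_int (12 * n + e)"
        unfolding six_height_eq_iff by blast
      have "s = six_pass (6 * n - 2 + e)" "same_angle t (six_pass (six_match (6 * n - 2 + e)))"
        unfolding six_index_blocks[OF e(1)] six_pass_blocks[OF e] using sa unfolding x_def by simp_all
      then show ?thesis by blast
    qed
  next
    assume "same_angle s t \<or> (\<exists>i. s = six_pass i \<and> same_angle t (six_pass (six_match i)))"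
    then show "six_height s = six_height t \<and> same_angle (real 3 * s) (real 3 * t)"
    proof
      assume "same_angle s t"
      then show ?thesis using six_height_same_angle same_angle_mult[of s t 3] by simp
    next
      assume "\<exists>i. s = six_pass i \<and> same_angle t (six_pass (six_match i))"
      then obtain i where i: "s = six_pass i" "same_angle t (six_pass (six_match i))" by blast
      obtain n e :: int and x where *: "e \<in> {-1, 0, 1}" "x = pi / 12 * of_int (12 * n + e)"
        "six_pass i = x + pi / 3 \<and> six_pass (six_match i) = x - pi / 3 \<or>
         six_pass i = x - pi / 3 \<and> six_pass (six_match i) = x + pi / 3"
        by (rule six_pass_midpoint)
      have "six_height (x + pi / 3) = six_height (x - pi / 3)" unfolding six_height_eq_iff using *(1,2) by blast
      then have "six_height s = six_height t"
        using *(3) six_height_same_angle[OF i(2)] i(1) by metis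
      moreover have "same_angle (3 * t) (3 * s)"
      proof -
        have "same_angle (3 * t) (3 * six_pass (six_match i))" using same_angle_mult[OF i(2), of 3] by simp
        also have "3 * six_pass (six_match i) = 3 * s + 2*pi * of_int 1 \<or> 3 * six_pass (six_match i) = 3 * s + 2*pi * of_int (- 1)"
          using *(3) i(1) by auto
        then have "same_angle (3 * six_pass (six_match i)) (3 * s)" unfolding same_angle_def by blast
        finally show ?thesis .
      qed
      then have "same_angle (3 * s) (3 * t)" by (rule same_angle_sym)
      ultimately show ?thesis by simp
    qed
  qed
qed simp_all

subsection \<open>A common region\<close>

text \<open>The property that tells the two arrangements apart: all circles border one region. A
  connected part \<open>U\<close> of the complement stands for its region, and bordering is
  expressed by closures, so any homeomorphism of the sphere carries the property along.\<close>

definition common_region :: "(real^3) set set \<Rightarrow> bool" where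
  "common_region C \<longleftrightarrow> (\<exists>U. connected U \<and> U \<subseteq> S2 - \<Union>C \<and> (\<forall>c\<in>C. closure U \<inter> c \<noteq> {}))"

lemma sphere_isotopicD:
  assumes "sphere_isotopic C C'"
  obtains f k where "homeomorphism S2 S2 f k" "C' = (\<lambda>c. f ` c) ` C"
proof -
  obtain f where f: "homotopic_with_canon (\<lambda>h. \<exists>k. homeomorphism S2 S2 h k) S2 S2 id f" "(\<lambda>c. f ` c) ` C = C'"
    using assms unfolding sphere_isotopic_def by blast
  have "\<exists>k. homeomorphism S2 S2 f k" using homotopic_with_imp_property[OF f(1)] by blast
  then show ?thesis using that f(2) by blast
qed

lemma sphere_isotopic_refl: "sphere_isotopic C C"
proof -
  have "\<exists>k. homeomorphism S2 S2 (id :: real^3 \<Rightarrow> _) k"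
    by (rule exI[of _ id]) (simp add: homeomorphism_def)
  then have "homotopic_with_canon (\<lambda>h. \<exists>k. homeomorphism S2 S2 h k) S2 S2 id id" by simp
  moreover have "(\<lambda>c. id ` c) ` C = C" by simp
  ultimately show ?thesis unfolding sphere_isotopic_def by blast
qed

lemma isotopic_card:
  assumes "sphere_isotopic C C'" "\<Union>C \<subseteq> S2"
  shows "card C' = card C"
proof -
  obtain f k where fk: "homeomorphism S2 S2 f k" "C' = (\<lambda>c. f ` c) ` C" using assms(1) by (rule sphere_isotopicD)
  have "inj_on f S2" using fk(1) by (metis homeomorphism_def inj_on_inverseI)
  then have "inj_on (\<lambda>c. f ` c) C"
    using assms(2) by (intro inj_onI) (metis Sup_le_iff inj_on_image_eq_iff)
  then show ?thesis unfolding fk(2) by (rule card_image)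
qed

lemma common_region_isotopic:
  assumes iso: "sphere_isotopic C C'" and CS: "\<Union>C \<subseteq> S2" and reg: "common_region C"
  shows "common_region C'"
proof -
  obtain f k where fk: "homeomorphism S2 S2 f k" "C' = (\<lambda>c. f ` c) ` C" using iso by (rule sphere_isotopicD)
  obtain U where U: "connected U" "U \<subseteq> S2 - \<Union>C" "\<forall>c\<in>C. closure U \<inter> c \<noteq> {}"
    using reg unfolding common_region_def by blast
  have fc: "continuous_on S2 f" and fS: "f ` S2 = S2" and kf: "\<And>x. x \<in> S2 \<Longrightarrow> k (f x) = x"
    using fk(1) unfolding homeomorphism_def by blast+
  have US: "U \<subseteq> S2" using U(2) by blast
  have "closure U \<subseteq> S2" using US by (rule closure_minimal) simp
  then have cl: "f ` closure U \<subseteq> closure (f ` U)"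
    using continuous_on_subset[OF fc] by (intro image_closure_subset[of _ f]) (auto simp: closure_subset)
  show ?thesis
    unfolding common_region_def
  proof (intro exI conjI ballI)
    show "connected (f ` U)" using U(1) continuous_on_subset[OF fc US] by (intro connected_continuous_image)
    show "f ` U \<subseteq> S2 - \<Union>C'"
    proof
      fix y assume "y \<in> f ` U"
      then obtain u where u: "u \<in> U" "y = f u" by blast
      have "y \<in> S2" using u US fS by blast
      moreover have "y \<notin> \<Union>C'"
      proof
        assume "y \<in> \<Union>C'"
        then obtain c x where x: "c \<in> C" "x \<in> c" "y = f x" unfolding fk(2) by blast
        have "x \<in> S2" "u \<in> S2" using x CS u US by blast+
        then have "x = u" using kf x(3) u(2) by metis
        then show False using x u U(2) by blast
      qed
      ultimately show "y \<in> S2 - \<Union>C'" by blast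
    qed
    fix c' assume "c' \<in> C'"
    then obtain c where c: "c \<in> C" "c' = f ` c" unfolding fk(2) by blast
    then obtain x where "x \<in> closure U" "x \<in> c" using U(3) by blast
    then show "closure (f ` U) \<inter> c' \<noteq> {}" using cl c by blast
  qed
qed

section \<open>Faces of the projection inside regions of the resolution\<close>

context gauss_resolution
begin

text \<open>At distance 2 or more from a point of the sphere lies only its antipode. Both ends of a
  strand would be that point, which would then lie on the incoming and the outgoing arc at
  once.\<close>

lemma radius_less_2: "r (g (T i)) < 2"
proof (rule ccontr)
  assume "\<not> r (g (T i)) < 2"
  then have r: "2 \<le> r (g (T i))" by simp
  let ?p = "g (T i)"
  have n: "norm (g t) = 1" for t by (rule gen_sphere[OF gen])
  have opp: "g t = - ?p" if "dist ?p (g t) = r ?p" for t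
  proof -
    have "2 \<le> norm (?p - g t)" using r that by (simp add: dist_norm)
    then have "2\<^sup>2 \<le> (norm (?p - g t))\<^sup>2" by (rule power_mono) simp
    then have "4 \<le> (norm (?p - g t))\<^sup>2" by simp
    moreover have "(norm (?p - g t))\<^sup>2 + (norm (?p + g t))\<^sup>2 = 4"
      using n[of "T i"] n[of t] unfolding power2_norm_eq_inner norm_eq_1
      by (simp add: inner_add_left inner_add_right inner_diff_left inner_diff_right)
    ultimately have "(norm (?p + g t))\<^sup>2 \<le> 0" by linarith
    then have "?p + g t = 0" by simp
    then show ?thesis by (simp add: eq_neg_iff_add_eq_0 add.commute)
  qed
  have "g (lo i) = g (hi i)" using opp strand_dist by metis
  then show False using inn(4)[of i] out(4)[of i] inn_out(1)[of i] by auto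
qed

lemma resolved_subset: "resolved \<subseteq> range g \<union> (\<Union>p\<in>double_points g. cap p (r p))"
proof -
  have "A (g (T i)) \<subseteq> disc i" for i using inn_out(2) inn(3) out(3) by blast
  then show ?thesis unfolding resolved_def double_points_T by blast
qed

lemma connected_disc_curve: "connected (disc i \<inter> range g)"
  unfolding disc_strands
  using strands_meet[of i] by (intro connected_Un connected_continuous_image gen_continuous[OF gen]) auto

lemma resolved_sphere: "resolved \<subseteq> S2"
  using resolved_subset gen_sphere[OF gen] unfolding cap_def by auto

text \<open>A large disc could conceivably cut a face apart. Each disc meets the curve in a
  connected set, two strands through the double point, so Janiszewski's theorem excludes this; and
  the resolution lies in the union of curve and discs.\<close>

lemma face_in_region:
  assumes cc: "connected_component (S2 - range g) y z"
    and y: "\<And>i. y \<notin> disc i" and z: "\<And>i. z \<notin> disc i"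
  shows "connected_component (S2 - resolved) y z"
proof -
  \<comment> \<open>The middle of an edge is a point of the curve outside all discs; it serves as
    the point sent to infinity.\<close>
  define u where "u = (hi 0 + lo (0 + 1)) / 2"
  have u: "u \<in> {hi 0<..<lo (0 + 1)}" unfolding u_def using hi_lo[of 0] by auto
  have "connected_component (S2 - (range g \<union> (\<Union>p\<in>double_points g. cap p (r p)))) y z"
  proof (rule Janiszewski_sphere)
    show "compact (range g)" by (rule gen_compact[OF gen])
    show "range g \<subseteq> S2" using gen_sphere[OF gen] by auto
    show "g u \<in> range g" by blast
    show "finite (double_points g)" by (rule gen_finite_double[OF gen])
    fix p assume "p \<in> double_points g"
    then obtain i where i: "p = g (T i)" unfolding double_points_T by blast
    show "cap p (r p) \<subseteq> S2 - {g u}"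
      using edge_interior_not_disc[OF u, of i] unfolding i cap_def by auto
    show "connected (cap p (r p) \<inter> range g)" unfolding i by (rule connected_disc_curve)
    show "\<exists>K :: (real^3) set. convex K \<and> compact K \<and> cap p (r p) homeomorphic K"
      unfolding i using gen_sphere[OF gen] radius_pos[of i] radius_less_2[of i]
      by (intro cap_homeomorphic_convex) auto
  qed (use disj cc y z in \<open>auto simp: double_points_T\<close>)
  moreover have "S2 - (range g \<union> (\<Union>p\<in>double_points g. cap p (r p))) \<subseteq> S2 - resolved"
    using resolved_subset by blast
  ultimately show ?thesis by (rule connected_component_of_subset)
qed

end

lemma A_inv_resolutionE:
  assumes "gauss_curve g N T m" "A_inv_resolution g R"
  obtains r A where "gauss_resolution g N T m r A" "R = gauss_resolution.resolved g r A"
proof -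
  obtain r A where rA: "\<forall>p\<in>double_points g. A_inv_smoothing g p (r p) (A p)"
    "disjoint_family_on (\<lambda>p. cap p (r p)) (double_points g)"
    "R = (range g - (\<Union>p\<in>double_points g. cap p (r p))) \<union> (\<Union>p\<in>double_points g. A p)"
    using assms(2) unfolding A_inv_resolution_def by blast
  have *: "gauss_resolution g N T m r A"
    using assms(1) rA unfolding gauss_resolution_def gauss_resolution_axioms_def by blast
  show ?thesis by (rule that[OF *]) (simp add: gauss_resolution.resolved_def[OF *] rA(3))
qed

lemma (in gauss_resolution) A_inv_resolution_resolved: "A_inv_resolution g resolved"
  unfolding A_inv_resolution_def resolved_def using smoothing disj by blast

text \<open>Both smoothing moves add 5, so a circle consists of the edges \<open>i\<close> and
  \<open>i + 5\<close> modulo full turns, the two sides of a bigon of the braid.\<close>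

lemma five_coloured:
  assumes "gauss_resolution five_curve 10 five_pass (\<lambda>i. i + 5) r A"
  shows "coloured_resolution five_curve 10 five_pass (\<lambda>i. i + 5) r A (\<lambda>i. i mod 5)"
proof -
  interpret gauss_resolution five_curve 10 five_pass "\<lambda>i. i + 5" r A by fact
  let ?r = "\<lambda>a b. b = a + 5 \<or> b = a + 1 + 5 - 1 \<or> (\<exists>k. b = a + 10 * k)"
  have rep: "equivclp ?r i (i mod 5)" for i :: int
  proof -
    have shift: "equivclp ?r a (a + 10 * k)" for a k by (rule r_into_equivclp) blast
    have "equivclp ?r (i mod 5) (i mod 5 + 5)" by (rule r_into_equivclp) simp
    from equivclp_trans[OF this shift]
    have five: "equivclp ?r (i mod 5) (i mod 5 + 5 + 10 * k)" for k .
    have "i mod 5 + 10 * (i div 5 div 2) = i \<or> i mod 5 + 5 + 10 * (i div 5 div 2) = i" by presburger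
    then have "equivclp ?r (i mod 5) i"
    proof
      assume e: "i mod 5 + 10 * (i div 5 div 2) = i"
      show ?thesis using shift[of "i mod 5" "i div 5 div 2"] unfolding e .
    next
      assume e: "i mod 5 + 5 + 10 * (i div 5 div 2) = i"
      show ?thesis using five[of "i div 5 div 2"] unfolding e .
    qed
    then show ?thesis by (rule equivclp_sym)
  qed
  show ?thesis
  proof unfold_locales
    fix i j k :: int
    show "(i + 10 * k) mod 5 = i mod 5" by presburger
    show "(i + 5) mod 5 = i mod 5" "(i + 5 - 1) mod 5 = (i - 1) mod 5" by presburger+
    assume "i mod 5 = j mod 5"
    then have "equivclp ?r (i mod 5) j" using equivclp_sym[OF rep[of j]] by simp
    with rep[of i] show "equivclp ?r i j" by (rule equivclp_trans)
  qed
qed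

text \<open>Above the longitude \<theta> the two strands have heights plus and minus
  \<open>cos (5 * \<theta> / 2)\<close>. Every point higher than both can be moved along its
  meridian to the parallel at height 2, which lies above the whole curve.\<close>

lemma five_face:
  assumes "\<bar>cos (5 * \<theta> / 2)\<bar> < v" "\<bar>cos (5 * \<theta>' / 2)\<bar> < v'"
  shows "connected_component (S2 - range five_curve) (mercator \<theta> v) (mercator \<theta>' v')"
proof -
  have above: "mercator \<theta> v \<in> S2 - range five_curve" if "\<bar>cos (5 * \<theta> / 2)\<bar> < v" for \<theta> v
  proof -
    have "mercator \<theta> v \<noteq> five_curve t" for t
    proof
      assume "mercator \<theta> v = five_curve t"
      then have e: "same_angle \<theta> (2 * t)" "v = cos (5 * t)" unfolding five_curve_def mercator_eq_iff by simp_all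
      obtain k :: int where "\<theta> = 2 * t + 2*pi * of_int k" using e(1) unfolding same_angle_def by blast
      moreover define n where "n = 5 * k"
      ultimately have x: "5 * \<theta> / 2 = 5 * t + pi * of_int n" by simp
      have "\<bar>cos (5 * \<theta> / 2)\<bar> = \<bar>cos (5 * t)\<bar>"
        unfolding x cos_add by (simp add: cos_npi_int sin_npi_int abs_mult mult.commute)
      then show False using that e(2) by simp
    qed
    then show ?thesis using mercator_sphere by auto
  qed
  have vert: "connected_component (S2 - range five_curve) (mercator \<theta> v) (mercator \<theta> 2)"
    if "\<bar>cos (5 * \<theta> / 2)\<bar> < v" for \<theta> v
    unfolding connected_component_def
  proof (intro exI conjI)
    have "\<bar>cos (5 * \<theta> / 2)\<bar> < 2" using abs_cos_le_one[of "5 * \<theta> / 2"] by linarith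
    then show "mercator \<theta> ` {min v 2..max v 2} \<subseteq> S2 - range five_curve"
      using that by (intro image_subsetI above) (auto simp: min_def split: if_splits)
    show "connected (mercator \<theta> ` {min v 2..max v 2})"
      by (intro connected_continuous_image continuous_intros) auto
  qed auto
  have horiz: "connected_component (S2 - range five_curve) (mercator \<theta> 2) (mercator \<theta>' 2)"
    unfolding connected_component_def
  proof (intro exI conjI)
    have "\<bar>cos (5 * \<theta> / 2)\<bar> < 2" for \<theta> :: real using abs_cos_le_one[of "5 * \<theta> / 2"] by linarith
    then show "range (\<lambda>\<theta>. mercator \<theta> 2) \<subseteq> S2 - range five_curve" by (intro image_subsetI above)
    show "connected (range (\<lambda>\<theta>. mercator \<theta> 2))"
      by (intro connected_continuous_image continuous_intros connected_UNIV)
  qed auto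
  show ?thesis
    using vert[OF assms(1)] horiz connected_component_sym[OF vert[OF assms(2)]] connected_component_trans by blast
qed

text \<open>Every circle of \<open>\<tau>\<close> runs along the face around the north pole.\<close>

lemma five_common_region:
  assumes "gauss_resolution five_curve 10 five_pass (\<lambda>i. i + 5) r A"
  shows "common_region (components (gauss_resolution.resolved five_curve r A))"
proof -
  interpret coloured_resolution five_curve 10 five_pass "\<lambda>i. i + 5" r A "\<lambda>i. i mod 5"
    by (rule five_coloured[OF assms])
  define u where "u i = (hi i + lo (i + 1)) / 2" for i
  have u: "u i \<in> {hi i<..<lo (i + 1)}" for i unfolding u_def using hi_lo[of i] by auto
  \<comment> \<open>After an odd pass the cosine is positive until the next pass, so the edge is the
    upper of the two strands there and borders the northern face.\<close>
  have c: "\<bar>cos (5 * (2 * u i) / 2)\<bar> = cos (5 * u i)" if odd: "odd i" for i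
  proof -
    have "five_pass i < u i" "u i < five_pass (i + 1)" using u[of i] T_hi[of i] lo_T[of "i + 1"] by auto
    then have "pi / 2 + pi * of_int i < 5 * u i" "5 * u i < pi / 2 + pi * of_int (i + 1)"
      unfolding five_pass_def by (simp_all add: field_simps)
    moreover obtain n where n: "i = 2 * n + 1" using odd by (elim oddE)
    ultimately have "- (pi / 2) < 5 * u i - 2*pi * of_int (n + 1)" "5 * u i - 2*pi * of_int (n + 1) < pi / 2"
      by (simp_all add: algebra_simps)
    then have "0 < cos (5 * u i - 2*pi * of_int (n + 1))" by (intro cos_gt_zero_pi)
    moreover have "same_angle (5 * u i - 2*pi * of_int (n + 1)) (5 * u i)"
      using same_angle_add[of "5 * u i" "- (n + 1)" "5 * u i"]
      by (simp only: of_int_minus mult_minus_right add_uminus_conv_diff same_angle_refl)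
    ultimately have "0 < cos (5 * u i)" using same_angle_cos by metis
    then show ?thesis by simp
  qed
  define U where "U = {y. (\<exists>\<theta> v. y = mercator \<theta> v \<and> \<bar>cos (5 * \<theta> / 2)\<bar> < v) \<and> (\<forall>i. y \<notin> disc i)}"
  have cU: "connected_component (S2 - resolved) y z" if "y \<in> U" "z \<in> U" for y z
    using that five_face unfolding U_def by (intro face_in_region) blast+
  \<comment> \<open>The middle of an edge has a neighbourhood free of discs, and the points just
    above it on its meridian lie in the northern face.\<close>
  have clU: "five_curve (u i) \<in> closure U" if "odd i" for i
  proof -
    have ni: "five_curve (u i) \<notin> disc j" for j by (rule edge_interior_not_disc[OF u])
    let ?D = "\<Union>p\<in>double_points five_curve. cap p (r p)"
    have "closed ?D" unfolding cap_def
      by (intro closed_UN gen_finite_double[OF gen] ballI closed_Int closed_cball closed_sphere)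
    moreover have "five_curve (u i) \<notin> ?D" using ni unfolding double_points_T by blast
    ultimately have "open (- ?D)" "five_curve (u i) \<in> - ?D" by (simp_all only: open_Compl Compl_iff not_False_eq_True)
    then obtain e where e: "0 < e" "ball (five_curve (u i)) e \<subseteq> - ?D" by (rule openE)
    have "continuous_on UNIV (\<lambda>v. mercator (2 * u i) v)"
      by (intro continuous_on_mercator continuous_on_const continuous_on_id)
    moreover have "(\<lambda>n. cos (5 * u i) + inverse (real (Suc n))) \<longlonglongrightarrow> cos (5 * u i) + 0"
      by (intro tendsto_add tendsto_const LIMSEQ_inverse_real_of_nat)
    ultimately have "(\<lambda>n. mercator (2 * u i) (cos (5 * u i) + inverse (real (Suc n)))) \<longlonglongrightarrow> mercator (2 * u i) (cos (5 * u i) + 0)"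
      by (rule continuous_on_tendsto_compose) auto
    then have lim: "(\<lambda>n. mercator (2 * u i) (cos (5 * u i) + inverse (real (Suc n)))) \<longlonglongrightarrow> five_curve (u i)"
      unfolding five_curve_def by simp
    then have "eventually (\<lambda>n. dist (mercator (2 * u i) (cos (5 * u i) + inverse (real (Suc n)))) (five_curve (u i)) < e) sequentially"
      by (rule tendstoD) (rule e(1))
    then have "eventually (\<lambda>n. mercator (2 * u i) (cos (5 * u i) + inverse (real (Suc n))) \<in> U) sequentially"
    proof (rule eventually_mono)
      fix n assume "dist (mercator (2 * u i) (cos (5 * u i) + inverse (real (Suc n)))) (five_curve (u i)) < e"
      then have "mercator (2 * u i) (cos (5 * u i) + inverse (real (Suc n))) \<in> ball (five_curve (u i)) e"
        by (simp only: mem_ball dist_commute)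
      then have "mercator (2 * u i) (cos (5 * u i) + inverse (real (Suc n))) \<notin> ?D"
        using e(2) by blast
      moreover have "\<bar>cos (5 * (2 * u i) / 2)\<bar> < cos (5 * u i) + inverse (real (Suc n))"
        unfolding c[OF that] by simp
      ultimately show "mercator (2 * u i) (cos (5 * u i) + inverse (real (Suc n))) \<in> U"
        unfolding U_def double_points_T by blast
    qed
    then have "eventually (\<lambda>n. mercator (2 * u i) (cos (5 * u i) + inverse (real (Suc n))) \<in> closure U) sequentially"
      by (rule eventually_mono) (rule subsetD[OF closure_subset])
    then show ?thesis using lim by (intro Lim_in_closed_set[OF closed_closure]) simp_all
  qed
  obtain y where y: "y \<in> U" using clU[of 1] closure_empty[of ] by fastforce
  define W where "W = connected_component_set (S2 - resolved) y"
  have UW: "U \<subseteq> W" unfolding W_def using cU[OF y] by blast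
  show ?thesis
    unfolding common_region_def
  proof (intro exI conjI ballI)
    show "connected W" unfolding W_def by simp
    show "W \<subseteq> S2 - \<Union>(components resolved)"
      unfolding W_def using connected_component_subset[of "S2 - resolved" y] Union_components[of resolved] by simp
    fix K assume "K \<in> components resolved"
    then obtain i where i: "K = circle (i mod 5)" unfolding components_resolved by blast
    \<comment> \<open>Each circle contains the edges \<open>i\<close> and \<open>i + 5\<close>, and
      exactly one of these indices is odd.\<close>
    define j where "j = (if odd i then i else i + 5)"
    have j: "odd j" "j mod 5 = i mod 5" unfolding j_def by (simp, presburger)
    have "u j \<in> {hi j..lo (j + 1)}" using u[of j] by simp
    then have "five_curve (u j) \<in> K" unfolding i circle_def piece_def edge_def using j(2) by blast
    then show "closure W \<inter> K \<noteq> {}" using clU[OF j(1)] closure_mono[OF UW] by blast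
  qed
qed

text \<open>Edges inside a triple of passes form bigons with those of the matched triple: colours 0
  and 1 for one group of three crossings, 3 and 4 for the other. The edges between triples, with
  indices 2 modulo 3, form the single circle of colour 2. The colour is also the index of an edge on
  the circle.\<close>

definition six_colour :: "int \<Rightarrow> int" where
  "six_colour i = (if i mod 3 = 2 then 2 else i mod 3 + 3 * ((i div 3 + 1) div 2 mod 2))"

lemma six_colour_block:
  shows "i mod 3 = 2 \<or> odd (i div 3) \<Longrightarrow> six_colour (i + 3) = six_colour i"
    and "i mod 3 = 2 \<or> even (i div 3) \<Longrightarrow> six_colour (i - 3) = six_colour i"
proof -
  have d: "(i + 3) mod 3 = i mod 3" "(i + 3) div 3 = i div 3 + 1" "(i - 3) mod 3 = i mod 3" "(i - 3) div 3 = i div 3 - 1"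
    by presburger+
  have o: "(q + 1 + 1) div 2 = (q + 1) div 2" if "odd q" for q :: int using that by presburger
  have e: "(q - 1 + 1) div 2 = (q + 1) div 2" if "even q" for q :: int using that by presburger
  show "i mod 3 = 2 \<or> odd (i div 3) \<Longrightarrow> six_colour (i + 3) = six_colour i"
    unfolding six_colour_def d using o by auto
  show "i mod 3 = 2 \<or> even (i div 3) \<Longrightarrow> six_colour (i - 3) = six_colour i"
    unfolding six_colour_def d using e by auto
qed

lemma six_coloured:
  assumes "gauss_resolution six_curve 12 six_pass six_match r A"
  shows "coloured_resolution six_curve 12 six_pass six_match r A six_colour"
proof -
  interpret gauss_resolution six_curve 12 six_pass six_match r A by fact
  let ?r = "\<lambda>a b. b = six_match a \<or> b = six_match (a + 1) - 1 \<or> (\<exists>k. b = a + 12 * k)"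
  have per: "six_colour (i + 12 * k) = six_colour i" for i k
  proof -
    have e: "i + 12 * k = i + 3 * (4 * k)" by simp
    have m3: "(i + 12 * k) mod 3 = i mod 3" and d3: "(i + 12 * k) div 3 = i div 3 + 4 * k"
      unfolding e mod_mult_self2 using div_mult_self2[of 3 i "4 * k"] by (simp_all only: add.commute)
    have "(i div 3 + 4 * k + 1) div 2 = (i div 3 + 1) div 2 + 2 * k" by presburger
    then have m4: "(i div 3 + 4 * k + 1) div 2 mod 2 = (i div 3 + 1) div 2 mod 2" by simp
    show ?thesis unfolding six_colour_def m3 d3 m4 ..
  qed
  have shift: "equivclp ?r a (a + 12 * k)" for a k by (rule r_into_equivclp) blast
  have out: "equivclp ?r a b" if "b + 12 * k = six_match a" for a b k
  proof -
    have "equivclp ?r a (six_match a)" by (rule r_into_equivclp) blast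
    then have "equivclp ?r a (b + 12 * k)" unfolding that .
    from this equivclp_sym[OF shift] show ?thesis by (rule equivclp_trans)
  qed
  have inn: "equivclp ?r a (six_match (a + 1) - 1)" for a by (rule r_into_equivclp) blast
  \<comment> \<open>Each edge of one turn is linked to the edge whose index is its colour. Outgoing
    arcs do this except for the four edges of colour 2, which also need the incoming arc between 5
    and 2.\<close>
  have 93: "equivclp ?r 9 0" by (rule out[of _ 1]) (simp add: six_match_def)
  have 101: "equivclp ?r 10 1" by (rule out[of _ 1]) (simp add: six_match_def)
  have 63: "equivclp ?r 6 3" by (rule out[of _ 0]) (simp add: six_match_def)
  have 74: "equivclp ?r 7 4" by (rule out[of _ 0]) (simp add: six_match_def)
  have 112: "equivclp ?r 11 2" by (rule out[of _ 1]) (simp add: six_match_def)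
  have 85: "equivclp ?r 8 5" by (rule out[of _ 0]) (simp add: six_match_def)
  have 52: "equivclp ?r 5 2" using inn[of 5] by (simp add: six_match_def)
  have 82: "equivclp ?r 8 2" using 85 52 by (rule equivclp_trans)
  have base: "equivclp ?r i (six_colour i)" if "0 \<le> i" "i < 12" for i
  proof -
    have "i \<in> {0,1,2,3,4,5,6,7,8,9,10,11}" unfolding insert_iff empty_iff using that by presburger
    then show ?thesis
      using 93 101 63 74 112 52 82 by (elim insertE emptyE) (simp_all add: six_colour_def)
  qed
  have rep: "equivclp ?r i (six_colour i)" for i
  proof -
    have e: "i = i mod 12 + 12 * (i div 12)" by simp
    have "equivclp ?r i (i mod 12)" using equivclp_sym[OF shift[of "i mod 12" "i div 12"]] by simp
    also have "equivclp ?r (i mod 12) (six_colour (i mod 12))" by (rule base) simp_all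
    also (equivclp_trans) have "six_colour (i mod 12) = six_colour i" using per[of "i mod 12" "i div 12"] by simp
    finally show ?thesis .
  qed
  show ?thesis
  proof unfold_locales
    fix i j k :: int
    show "six_colour (i + 12 * k) = six_colour i" by (rule per)
    show "six_colour (six_match i) = six_colour i"
      unfolding six_match_def using six_colour_block[of i] by simp
    have "(i - 1) mod 3 = 2 \<or> (i - 1) div 3 = i div 3" by presburger
    then show "six_colour (six_match i - 1) = six_colour (i - 1)"
      unfolding six_match_def using six_colour_block[of "i - 1"] by (auto simp: algebra_simps)
    assume c: "six_colour i = six_colour j"
    show "equivclp ?r i j" using rep[of i] equivclp_sym[OF rep[of j]] unfolding c by (rule equivclp_trans)
  qed
qed

section \<open>Meridians and continuous longitudes\<close>

lemma six_height_antipodal: "six_height (t + pi) = - six_height t"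
  unfolding six_height_def cos_add_5pi by simp

lemma mercator_antipodal: "mercator (\<theta> + pi) (- v) = - mercator \<theta> v"
  by (simp add: vec_eq_iff forall_3)

text \<open>The curve is symmetric under the antipodal map, so what is known about the northern
  quarter meridian transfers to its antipodal image.\<close>

lemma six_curve_antipodal: "six_curve (t + pi) = - six_curve t"
proof -
  have e: "3 * (t + pi) = (3 * t + pi) + 2*pi * of_int 1" by simp
  have "same_angle (3 * (t + pi)) (3 * t + pi)" unfolding e same_angle_add by simp
  then have "mercator (3 * (t + pi)) (- six_height t) = mercator (3 * t + pi) (- six_height t)"
    unfolding mercator_eq_iff by simp
  then show ?thesis unfolding six_curve_def six_height_antipodal by (simp add: mercator_antipodal)
qed

text \<open>The part of a meridian from the equator to the north pole, parametrized by latitude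
  because \<open>mercator\<close> omits the poles.\<close>

definition quarter :: "real \<Rightarrow> (real^3) set" where
  "quarter \<theta> = (\<lambda>a. vector [cos a * cos \<theta>, cos a * sin \<theta>, sin a]) ` {0..pi / 2}"

lemma quarter_compact: "compact (quarter \<theta>)" and quarter_connected: "connected (quarter \<theta>)"
proof -
  have "continuous_on {0..pi / 2} (\<lambda>a. vector [cos a * cos \<theta>, cos a * sin \<theta>, sin a] :: real^3)"
    by (rule continuous_on_vec3) (auto intro!: continuous_intros simp: vector_3)
  then show "compact (quarter \<theta>)" "connected (quarter \<theta>)"
    unfolding quarter_def by (auto intro!: compact_continuous_image connected_continuous_image)
qed

lemma north_in_quarter: "vector [0, 0, 1] \<in> quarter \<theta>"
  unfolding quarter_def by (rule image_eqI[of _ _ "pi / 2"]) simp_all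

lemma quarter_sphere: "quarter \<theta> \<subseteq> S2"
proof
  fix x assume "x \<in> quarter \<theta>"
  then obtain a where x: "x = vector [cos a * cos \<theta>, cos a * sin \<theta>, sin a]" unfolding quarter_def by blast
  have "x \<bullet> x = (cos a)\<^sup>2 * (cos \<theta>)\<^sup>2 + (cos a)\<^sup>2 * (sin \<theta>)\<^sup>2 + (sin a)\<^sup>2"
    unfolding x inner_vec_def sum_3 vector_3 by (simp only: inner_real_def power2_eq_square mult_ac)
  also have "\<dots> = (cos a)\<^sup>2 * ((cos \<theta>)\<^sup>2 + (sin \<theta>)\<^sup>2) + (sin a)\<^sup>2" by (simp only: distrib_left)
  finally have "x \<bullet> x = 1" by simp
  then show "x \<in> S2" by (simp add: norm_eq_1)
qed

text \<open>Latitude \<open>a\<close> and Mercator height \<open>v\<close> of a point are related by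
  \<open>sin a = tanh v\<close> and \<open>cos a = 1 / cosh v\<close>; the factor \<open>k\<close>
  in the proof is forced to be 1 because it scales one unit vector to another.\<close>

lemma mercator_in_quarter_iff: "mercator \<phi> v \<in> quarter \<theta> \<longleftrightarrow> same_angle \<phi> \<theta> \<and> 0 \<le> v"
proof
  assume "mercator \<phi> v \<in> quarter \<theta>"
  then obtain a where a: "0 \<le> a" "a \<le> pi / 2" "mercator \<phi> v = vector [cos a * cos \<theta>, cos a * sin \<theta>, sin a]"
    unfolding quarter_def by auto
  have e: "cos \<phi> / cosh v = cos a * cos \<theta>" "sin \<phi> / cosh v = cos a * sin \<theta>" "tanh v = sin a"
    using arg_cong[OF a(3), of "\<lambda>x. x $ 1"] arg_cong[OF a(3), of "\<lambda>x. x $ 2"] arg_cong[OF a(3), of "\<lambda>x. x $ 3"]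
    by (simp_all add: vector_3)
  have v: "0 \<le> v" using e(3) a sin_ge_zero[of a] by (metis tanh_real_nonneg_iff pi_half_ge_zero order_trans pi_half_le_two pi_ge_two le_add_same_cancel1 field_sum_of_halves)
  have ca: "0 \<le> cos a" using a by (intro cos_ge_zero) auto
  define k where "k = cosh v * cos a"
  have c: "cos \<phi> = k * cos \<theta>" "sin \<phi> = k * sin \<theta>" unfolding k_def using e(1,2) cosh_real_pos[of v] by (simp_all add: field_simps)
  have "k\<^sup>2 * ((cos \<theta>)\<^sup>2 + (sin \<theta>)\<^sup>2) = (cos \<phi>)\<^sup>2 + (sin \<phi>)\<^sup>2" unfolding c by (simp only: power_mult_distrib distrib_left)
  then have "k\<^sup>2 = 1" by simp
  moreover have "0 \<le> k" unfolding k_def using ca cosh_real_pos[of v] by (intro mult_nonneg_nonneg) auto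
  ultimately have "k = 1" by (simp add: power2_eq_1_iff)
  then show "same_angle \<phi> \<theta> \<and> 0 \<le> v" using c v by (simp add: same_angle_cis complex_eq_iff)
next
  assume a: "same_angle \<phi> \<theta> \<and> 0 \<le> v"
  define b where "b = arcsin (tanh v)"
  have t: "-1 \<le> tanh v" "tanh v \<le> 1" "0 \<le> tanh v" using tanh_real_bounds[of v] a by auto
  have s: "sin b = tanh v" unfolding b_def by (rule sin_arcsin[OF t(1,2)])
  have b: "0 \<le> b" "b \<le> pi / 2" unfolding b_def using t arcsin_le_arcsin[of 0 "tanh v"] arcsin_ubound[OF t(1,2)] by simp_all
  have "cos b = sqrt (1 - (tanh v)\<^sup>2)" unfolding b_def by (rule cos_arcsin[OF t(1,2)])
  also have "1 - (tanh v)\<^sup>2 = (1 / cosh v)\<^sup>2"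
  proof -
    have "1 - (tanh v)\<^sup>2 = ((cosh v)\<^sup>2 - (sinh v)\<^sup>2) / (cosh v)\<^sup>2"
      using cosh_real_pos[of v] by (simp add: tanh_def power_divide diff_divide_distrib)
    also have "(cosh v)\<^sup>2 - (sinh v)\<^sup>2 = 1" by (simp add: cosh_square_eq)
    finally show ?thesis by (simp add: power_divide)
  qed
  also have "sqrt ((1 / cosh v)\<^sup>2) = 1 / cosh v" using cosh_real_pos[of v] by simp
  finally have "mercator \<theta> v = vector [cos b * cos \<theta>, cos b * sin \<theta>, sin b]"
    using s unfolding mercator_def by simp
  moreover have "mercator \<phi> v = mercator \<theta> v" using a mercator_eq_iff by simp
  ultimately show "mercator \<phi> v \<in> quarter \<theta>" unfolding quarter_def using b by auto
qed

text \<open>Midway between the passes 0 and 1, at pi/4 and pi/3, hence on the edge 0, a side of the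
  bigon of colour 0.\<close>

definition six_time :: real where "six_time = 7 * pi / 24"

lemma six_height_time: "0 < six_height six_time"
proof -
  have "cos (pi / 3) < cos six_time" unfolding six_time_def by (rule cos_monotone_0_pi) auto
  then have "1 / 2 < cos six_time" by (simp add: cos_60)
  then have "2 * (1 / 2) < (2 + sqrt 3) * cos six_time" by (intro mult_strict_mono) (simp_all add: add_pos_pos)
  then show ?thesis unfolding six_height_def using cos_ge_minus_one[of "5 * six_time"] by linarith
qed

lemma six_height_time': "six_height (six_time + 2*pi / 3) < 0"
proof -
  have "cos (six_time + 2*pi / 3) < cos (2*pi / 3)" unfolding six_time_def by (rule cos_monotone_0_pi) auto
  then have "cos (six_time + 2*pi / 3) < - 1 / 2" by (simp add: cos_120)
  then have "(2 + sqrt 3) * cos (six_time + 2*pi / 3) < (2 + sqrt 3) * (- 1 / 2)"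
    by (intro mult_strict_left_mono) (auto simp: add_pos_nonneg)
  moreover have "(2 + sqrt 3) * (- 1 / 2) = - 1 - sqrt (3::real) / 2" by (simp add: field_simps)
  moreover have "0 < sqrt (3::real)" by simp
  ultimately have "(2 + sqrt 3) * cos (six_time + 2*pi / 3) < - 1" by linarith
  then show ?thesis unfolding six_height_def using cos_le_one[of "5 * (six_time + 2*pi / 3)"] by linarith
qed

text \<open>Three strands cross this meridian. The one at \<open>six_time + 2*pi / 3\<close> has
  negative height, and the other two parameters lie on the two sides of the bigon of colour
  0.\<close>

lemma six_curve_quarter:
  assumes "six_curve t \<in> quarter (3 * six_time)"
  shows "same_angle t six_time \<or> same_angle t (six_time - 2*pi / 3)"
proof -
  have a: "same_angle (3 * t) (3 * six_time)" "0 \<le> six_height t"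
    using assms unfolding six_curve_def mercator_in_quarter_iff by simp_all
  then obtain l :: int where "3 * t = 3 * six_time + 2*pi * of_int l" unfolding same_angle_def by blast
  then have l: "t = six_time + 2*pi / 3 * of_int l" by (simp add: field_simps)
  have "l = 3 * (l div 3) \<or> l = 3 * (l div 3) + 1 \<or> l = 3 * (l div 3 + 1) - 1" by presburger
  then consider j where "l = 3 * j" | j where "l = 3 * j + 1" | j where "l = 3 * j - 1" by blast
  then show ?thesis
  proof cases
    case (1 j)
    then have "t = six_time + 2*pi * of_int j" using l by simp
    then show ?thesis unfolding same_angle_def by blast
  next
    case (2 j)
    then have t: "t = (six_time + 2*pi / 3) + 2*pi * of_int j" using l by (simp add: field_simps)
    have "same_angle t (six_time + 2*pi / 3)" unfolding t same_angle_add by simp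
    then show ?thesis using six_height_same_angle six_height_time' a(2) by fastforce
  next
    case (3 j)
    have t: "t = (six_time - 2*pi / 3) + 2*pi * of_int j" using l unfolding 3 by (simp add: field_simps)
    have "same_angle t (six_time - 2*pi / 3)" unfolding t same_angle_add by simp
    then show ?thesis by blast
  qed
qed

definition horizontal :: "real^3 \<Rightarrow> complex" where "horizontal x = Complex (x $ 1) (x $ 2)"

lemma continuous_on_horizontal: "continuous_on S horizontal"
  unfolding horizontal_def Complex_eq by (intro continuous_intros)

lemma horizontal_mercator: "horizontal (mercator \<theta> v) = of_real (1 / cosh v) * cis \<theta>"
  unfolding horizontal_def by (simp add: complex_eq_iff)

lemma horizontal_diff: "norm (horizontal x - horizontal y) \<le> dist x y"
proof -
  have "(norm (horizontal x - horizontal y))\<^sup>2 = (x$1 - y$1)\<^sup>2 + (x$2 - y$2)\<^sup>2"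
    unfolding horizontal_def cmod_power2 by simp
  also have "\<dots> \<le> (dist x y)\<^sup>2"
    unfolding dist_norm power2_norm_eq_inner by (simp add: inner_vec_def sum_3 power2_eq_square)
  finally show ?thesis by (rule power2_le_imp_le) simp
qed

lemma horizontal_eq_0:
  assumes "x \<in> S2" "horizontal x = 0"
  shows "x = vector [0, 0, 1] \<or> x = vector [0, 0, -1]"
proof -
  have h: "x$1 = 0" "x$2 = 0" using assms(2) unfolding horizontal_def by (simp_all add: complex_eq_iff)
  have "x \<bullet> x = 1" using assms(1) by (simp add: norm_eq_1)
  then have "(x$3)\<^sup>2 = 1" using h by (simp add: inner_vec_def sum_3 power2_eq_square)
  then have "x$3 = 1 \<or> x$3 = -1" by (simp add: power2_eq_1_iff)
  then show ?thesis using h by (auto simp: vec_eq_iff forall_3 vector_3)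
qed

text \<open>Stereographic projection \<open>st\<close> from the north pole, with inverse \<sigma>,
  takes the south pole to 0 and longitude to argument. If 0 lay in a bounded component of the
  complement of the image of \<open>K\<close>, that component would separate the poles and split
  \<open>C\<close>. So 0 lies in the unbounded component and
  \<open>continuous_argument_plane\<close> applies.\<close>

lemma continuous_longitude:
  fixes K :: "(real^3) set"
  assumes K: "compact K" "K \<subseteq> S2"
    and C: "connected C" "C \<subseteq> S2 - K" "vector [0, 0, -1] \<in> C" "vector [0, 0, 1] \<in> C"
  obtains L where "continuous_on K L" "\<And>x. x \<in> K \<Longrightarrow> exp (\<i> * of_real (L x)) = horizontal x /\<^sub>R norm (horizontal x)"
proof -
  define st where "st x = horizontal x /\<^sub>R (1 - x $ 3)" for x :: "real^3"
  define \<sigma> :: "complex \<Rightarrow> real^3" where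
    "\<sigma> z = vector [2 * Re z, 2 * Im z, (norm z)\<^sup>2 - 1] /\<^sub>R ((norm z)\<^sup>2 + 1)" for z
  have pos: "0 < (norm z)\<^sup>2 + 1" for z :: complex using zero_le_power2[of "norm z"] by linarith
  have \<sigma>3: "\<sigma> z $ 3 = 1 - 2 / ((norm z)\<^sup>2 + 1)" for z
    unfolding \<sigma>_def using pos[of z] by (simp add: vector_3 field_simps)
  have st\<sigma>: "st (\<sigma> z) = z" for z
  proof -
    have "horizontal (\<sigma> z) = (2 / ((norm z)\<^sup>2 + 1)) *\<^sub>R z"
      unfolding horizontal_def \<sigma>_def by (simp add: complex_eq_iff vector_3 divide_inverse)
    then have "st (\<sigma> z) = (inverse (2 / ((norm z)\<^sup>2 + 1)) * (2 / ((norm z)\<^sup>2 + 1))) *\<^sub>R z"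
      unfolding st_def \<sigma>3 by simp
    also have "inverse (2 / ((norm z)\<^sup>2 + 1)) * (2 / ((norm z)\<^sup>2 + 1)) = 1"
      using pos[of z] by (intro left_inverse) simp
    also have "1 *\<^sub>R z = z" by simp
    finally show ?thesis .
  qed
  have x3: "x $ 3 < 1" if "x \<in> S2" "x \<noteq> vector [0, 0, 1]" for x
  proof -
    have n: "(x$1)\<^sup>2 + (x$2)\<^sup>2 + (x$3)\<^sup>2 = 1"
      using that(1) by (simp add: norm_eq_1 inner_vec_def sum_3 power2_eq_square)
    have s: "0 \<le> (x$1)\<^sup>2" "0 \<le> (x$2)\<^sup>2" by simp_all
    then have "(x$3)\<^sup>2 \<le> 1\<^sup>2" using n unfolding one_power2 by linarith
    then have "x$3 \<le> 1" by (rule power2_le_imp_le) simp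
    moreover have "x$3 \<noteq> 1"
    proof
      assume "x$3 = 1"
      then have "(x$1)\<^sup>2 = 0" "(x$2)\<^sup>2 = 0" using n s by simp_all
      then show False using \<open>x$3 = 1\<close> that(2) by (simp add: vec_eq_iff forall_3 vector_3)
    qed
    ultimately show ?thesis by simp
  qed
  have \<sigma>st: "\<sigma> (st x) = x" if x: "x \<in> S2" "x \<noteq> vector [0, 0, 1]" for x
  proof -
    define c where "c = x $ 3"
    have c: "0 < 1 - c" using x3[OF x] unfolding c_def by simp
    have "(x$1)\<^sup>2 + (x$2)\<^sup>2 + c\<^sup>2 = 1"
      using x(1) unfolding c_def by (simp add: norm_eq_1 inner_vec_def sum_3 power2_eq_square)
    then have n: "(x$1)\<^sup>2 + (x$2)\<^sup>2 = (1 - c) * (1 + c)" by (simp add: power2_eq_square algebra_simps)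
    have re: "Re (st x) = x$1 / (1 - c)" "Im (st x) = x$2 / (1 - c)"
      unfolding st_def horizontal_def c_def by (simp_all add: divide_inverse)
    have "(norm (st x))\<^sup>2 = ((x$1)\<^sup>2 + (x$2)\<^sup>2) / (1 - c)\<^sup>2"
      unfolding cmod_power2 re by (simp add: power_divide add_divide_distrib)
    also have "\<dots> = (1 + c) / (1 - c)" unfolding n using c by (simp add: power2_eq_square)
    finally have m: "(norm (st x))\<^sup>2 = (1 + c) / (1 - c)" .
    have m1: "(norm (st x))\<^sup>2 + 1 = 2 / (1 - c)" "(norm (st x))\<^sup>2 - 1 = 2 * c / (1 - c)"
      unfolding m using c by (simp_all add: field_simps)
    show ?thesis
      unfolding \<sigma>_def m1 re using c by (simp add: vec_eq_iff forall_3 vector_3 c_def[symmetric])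
  qed
  have NK: "vector [0, 0, 1] \<notin> K" "vector [0, 0, -1] \<notin> K" using C by blast+
  have stc: "continuous_on {x. x $ 3 < 1} st"
    unfolding st_def by (intro continuous_intros continuous_on_horizontal) auto
  have \<sigma>c: "continuous_on S \<sigma>" for S
    unfolding \<sigma>_def
  proof (intro continuous_intros)
    show "continuous_on S (\<lambda>z. vector [2 * Re z, 2 * Im z, (norm z)\<^sup>2 - 1] :: real^3)"
      by (rule continuous_on_vec3) (auto intro!: continuous_intros simp: vector_3)
  qed (use pos in \<open>metis less_irrefl\<close>)
  have K3: "K \<subseteq> {x. x $ 3 < 1}" using x3 K(2) NK by blast
  define K' where "K' = st ` K"
  have K': "compact K'" unfolding K'_def using K(1) continuous_on_subset[OF stc K3] by (intro compact_continuous_image)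
  have st0: "st x \<noteq> 0" if "x \<in> K" for x
  proof
    assume "st x = 0"
    moreover have "x $ 3 < 1" using K3 that by blast
    ultimately have "horizontal x = 0" unfolding st_def by simp
    then show False using horizontal_eq_0[of x] that K(2) NK by blast
  qed
  then have "0 \<notin> K'" unfolding K'_def by force
  have unb: "\<not> bounded (connected_component_set (- K') 0)"
  proof
    define W where "W = connected_component_set (- K') 0"
    assume "bounded (connected_component_set (- K') 0)"
    then have "compact (closure W)" unfolding W_def by (simp add: compact_closure)
    then have "compact (\<sigma> ` closure W)" using \<sigma>c by (intro compact_continuous_image)
    then have "open (- (\<sigma> ` closure W))" using compact_imp_closed by blast
    have "open W" unfolding W_def using K' compact_imp_closed by (intro open_connected_component) blast
    have "open {x::real^3. x $ 3 < 1}" by (intro open_Collect_less continuous_intros)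
    then have O: "open ({x. x $ 3 < 1} \<inter> st -` W)"
      using stc \<open>open W\<close> by (intro continuous_open_preimage)
    have clW: "closure W \<subseteq> W \<union> K'"
    proof -
      have "closedin (top_of_set (- K')) W" unfolding W_def by (rule closedin_connected_component)
      then obtain T where T: "closed T" "W = - K' \<inter> T" unfolding closedin_closed by blast
      then have "closure W \<subseteq> T" by (intro closure_minimal) auto
      then show ?thesis using T(2) by blast
    qed
    have iff: "x $ 3 < 1 \<and> st x \<in> W \<longleftrightarrow> x \<in> \<sigma> ` closure W" if "x \<in> C" for x
    proof
      assume a: "x $ 3 < 1 \<and> st x \<in> W"
      then have "x \<noteq> vector [0, 0, 1]" by (auto simp: vector_3)
      then have "x = \<sigma> (st x)" using \<sigma>st that C(2) by auto
      then show "x \<in> \<sigma> ` closure W" using a closure_subset by blast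
    next
      assume "x \<in> \<sigma> ` closure W"
      then obtain z where z: "z \<in> closure W" "x = \<sigma> z" by blast
      have "x $ 3 < 1" unfolding z(2) \<sigma>3 using pos[of z] by simp
      moreover have "z \<notin> K'"
      proof
        assume "z \<in> K'"
        then obtain y where y: "y \<in> K" "z = st y" unfolding K'_def by blast
        then have "x = y" using \<sigma>st[of y] K(2) NK z(2) by blast
        then show False using y(1) that C(2) by blast
      qed
      then have "st x \<in> W" using z clW st\<sigma> by auto
      ultimately show "x $ 3 < 1 \<and> st x \<in> W" by blast
    qed
    have "C \<inter> ({x. x $ 3 < 1} \<inter> st -` W) = {} \<or> C \<inter> (- (\<sigma> ` closure W)) = {}"
    proof (rule ccontr)
      assume "\<not> ?thesis"
      then show False
        using connectedD[OF C(1) O \<open>open (- (\<sigma> ` closure W))\<close>] iff by blast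
    qed
    moreover have "vector [0, 0, -1] \<in> C \<inter> ({x. x $ 3 < 1} \<inter> st -` W)"
    proof -
      have "st (vector [0, 0, -1]) = 0" unfolding st_def horizontal_def by (simp add: vector_3 complex_eq_iff)
      moreover have "0 \<in> W" unfolding W_def using \<open>0 \<notin> K'\<close> by simp
      ultimately show ?thesis using C(3) by (simp add: vector_3)
    qed
    moreover have "vector [0, 0, 1] \<in> C \<inter> (- (\<sigma> ` closure W))"
      using C(4) iff[OF C(4)] by (simp add: vector_3)
    ultimately show False by blast
  qed
  obtain L where L: "continuous_on K' L" "\<And>x. x \<in> K' \<Longrightarrow> exp (\<i> * of_real (L x)) = x /\<^sub>R norm x"
    using continuous_argument_plane[OF K' \<open>0 \<notin> K'\<close> unb] by blast
  show ?thesis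
  proof (rule that[of "L \<circ> st"])
    show "continuous_on K (L \<circ> st)"
      using continuous_on_subset[OF stc K3] L(1) unfolding K'_def by (rule continuous_on_compose)
    fix x assume x: "x \<in> K"
    have p: "0 < inverse (1 - x $ 3)" using K3 x by auto
    have "exp (\<i> * of_real ((L \<circ> st) x)) = st x /\<^sub>R norm (st x)" using L(2) x unfolding K'_def by simp
    also have "\<dots> = horizontal x /\<^sub>R norm (horizontal x)" unfolding st_def using p by simp
    finally show "exp (\<i> * of_real ((L \<circ> st) x)) = horizontal x /\<^sub>R norm (horizontal x)" .
  qed
qed

lemma exp_eq_same_angle: "exp (\<i> * of_real a) = exp (\<i> * of_real b) \<Longrightarrow> same_angle a b"
  by (simp add: same_angle_cis cis_conv_exp)

lemma horizontal_mercator_unit: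
  "horizontal (mercator \<theta> v) /\<^sub>R norm (horizontal (mercator \<theta> v)) = exp (\<i> * of_real \<theta>)"
proof -
  define c where "c = 1 / cosh v"
  have c: "0 < c" unfolding c_def by simp
  have h: "horizontal (mercator \<theta> v) = of_real c * cis \<theta>" unfolding c_def by (rule horizontal_mercator)
  have "norm (horizontal (mercator \<theta> v)) = c" unfolding h norm_mult using c by simp
  then show ?thesis unfolding h using c by (simp add: scaleR_conv_of_real cis_conv_exp)
qed

text \<open>The radius is the distance of \<open>p\<close> from the polar axis. Within it the
  quotient of horizontal parts has positive real part, so the principal logarithm provides a
  longitude.\<close>

lemma local_longitude:
  assumes "horizontal p \<noteq> 0"
  obtains B where "continuous_on {x. dist p x < norm (horizontal p)} B"
    "\<And>x. dist p x < norm (horizontal p) \<Longrightarrow> exp (\<i> * of_real (B x)) = horizontal x /\<^sub>R norm (horizontal x)"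
proof -
  have re: "0 < Re (horizontal x / horizontal p)" if "dist p x < norm (horizontal p)" for x
  proof -
    have "norm (horizontal p - horizontal x) < norm (horizontal p)"
      using horizontal_diff[of p x] that by linarith
    then have "norm ((horizontal p - horizontal x) / horizontal p) < 1"
      using assms by (simp add: norm_divide)
    then have "Re ((horizontal p - horizontal x) / horizontal p) < 1"
      using complex_Re_le_cmod[of "(horizontal p - horizontal x) / horizontal p"] by linarith
    then show ?thesis using assms by (simp add: diff_divide_distrib)
  qed
  define B where "B x = Im (Ln (horizontal x / horizontal p)) + Im (Ln (horizontal p))" for x
  show ?thesis
  proof (rule that[of B])
    show "continuous_on {x. dist p x < norm (horizontal p)} B"
      unfolding B_def
      by (intro continuous_intros continuous_on_horizontal)
        (use assms re in \<open>force simp: complex_nonpos_Reals_iff\<close>)+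
    fix x assume x: "dist p x < norm (horizontal p)"
    have nz: "horizontal x / horizontal p \<noteq> 0" using re[OF x] by auto
    then have "horizontal x \<noteq> 0" by auto
    have "exp (\<i> * of_real (B x)) = (horizontal x / horizontal p) /\<^sub>R norm (horizontal x / horizontal p) * (horizontal p /\<^sub>R norm (horizontal p))"
      unfolding B_def of_real_add distrib_left exp_add exp_Im_Ln[OF nz] exp_Im_Ln[OF assms] ..
    also have "\<dots> = horizontal x /\<^sub>R norm (horizontal x)"
      using assms \<open>horizontal x \<noteq> 0\<close> by (simp add: norm_divide scaleR_conv_of_real field_simps)
    finally show "exp (\<i> * of_real (B x)) = horizontal x /\<^sub>R norm (horizontal x)" .
  qed
qed

text \<open>Smoothing discs smaller than the distance of their centres to this set leave two quarter meridians
  free and carry a continuous longitude.\<close>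

definition six_forbidden :: "(real^3) set" where
  "six_forbidden = quarter (3 * six_time) \<union> uminus ` quarter (3 * six_time) \<union> {x. x $ 1 = 0 \<and> x $ 2 = 0}"

lemma six_forbidden_closed: "closed six_forbidden"
proof -
  have "closed {x::real^3. x $ 1 = 0 \<and> x $ 2 = 0}"
    by (intro closed_Collect_conj closed_Collect_eq continuous_intros)
  moreover have "compact (uminus ` quarter (3 * six_time))"
    by (intro compact_continuous_image continuous_intros quarter_compact)
  ultimately show ?thesis
    unfolding six_forbidden_def using quarter_compact by (intro closed_Un) (simp_all add: compact_imp_closed)
qed

text \<open>Passes are even multiples of pi/24; the parameters where the two quarter meridians can
  meet the curve are odd ones.\<close>

lemma six_pass_not_time:
  assumes "same_angle (six_pass i) (pi / 24 * of_int (2 * n + 1))" shows False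
proof -
  obtain k :: int where "six_pass i = pi / 24 * of_int (2 * n + 1) + 2*pi * of_int k"
    using assms unfolding same_angle_def by blast
  then have "pi * of_int (2 * six_index i) = pi * of_int (2 * n + 1 + 48 * k)"
    unfolding six_pass_def by (simp add: field_simps)
  then have "2 * six_index i = 2 * n + 1 + 48 * k" by (simp only: mult_cancel_left of_int_eq_iff pi_neq_zero simp_thms)
  then show False by presburger
qed

lemma six_times: "six_time = pi / 24 * of_int (2 * 3 + 1)" "six_time - 2*pi / 3 = pi / 24 * of_int (2 * (-5) + 1)"
  "six_time - pi = pi / 24 * of_int (2 * (-9) + 1)" "six_time - 2*pi / 3 - pi = pi / 24 * of_int (2 * (-17) + 1)"
  unfolding six_time_def by (simp_all add: field_simps)

lemma six_curve_minus_quarter: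
  assumes "six_curve t \<in> uminus ` quarter (3 * six_time)"
  shows "same_angle t (six_time - pi) \<or> same_angle t (six_time - 2*pi / 3 - pi)"
proof -
  have "six_curve (t + pi) \<in> quarter (3 * six_time)" unfolding six_curve_antipodal using assms by force
  then have "same_angle (t + pi) six_time \<or> same_angle (t + pi) (six_time - 2*pi / 3)" by (rule six_curve_quarter)
  moreover have "same_angle t (s - pi)" if "same_angle (t + pi) s" for s
    using that unfolding same_angle_def by (auto simp: algebra_simps)
  ultimately show ?thesis by blast
qed

lemma six_pass_not_forbidden: "six_curve (six_pass i) \<notin> six_forbidden"
proof
  assume "six_curve (six_pass i) \<in> six_forbidden"
  moreover have "horizontal (six_curve (six_pass i)) \<noteq> 0"
    unfolding six_curve_def horizontal_mercator using cosh_real_pos[of "six_height (six_pass i)"] by auto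
  then have "\<not> (six_curve (six_pass i) $ 1 = 0 \<and> six_curve (six_pass i) $ 2 = 0)"
    unfolding horizontal_def by (simp add: complex_eq_iff)
  ultimately have "same_angle (six_pass i) six_time \<or> same_angle (six_pass i) (six_time - 2*pi / 3)
     \<or> same_angle (six_pass i) (six_time - pi) \<or> same_angle (six_pass i) (six_time - 2*pi / 3 - pi)"
    unfolding six_forbidden_def using six_curve_quarter six_curve_minus_quarter by blast
  then show False
    using six_pass_not_time[of i 3, folded six_times(1)] six_pass_not_time[of i "-5", folded six_times(2)]
      six_pass_not_time[of i "-9", folded six_times(3)] six_pass_not_time[of i "-17", folded six_times(4)] by blast
qed

lemma connected_Un_closure:
  assumes "connected U" "connected c" "closure U \<inter> c \<noteq> {}"
  shows "connected (U \<union> c)"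
proof -
  obtain x where x: "x \<in> closure U" "x \<in> c" using assms(3) by blast
  have "connected (insert x U)"
    using x(1) closure_subset by (intro connected_intermediate_closure[OF assms(1)]) auto
  then have "connected (insert x U \<union> c)" using assms(2) x(2) by (intro connected_Un) auto
  moreover have "insert x U \<union> c = U \<union> c" using x(2) by blast
  ultimately show ?thesis by simp
qed

text \<open>The circle of colour 2 winds once around the polar axis, so it has the circles of colour 0 and 3
  on its two sides. If a region met all three, a continuous longitude along the circle of colour 2
  would exist; following it around once gives the contradiction.\<close>

lemma six_no_common_region:
  assumes res: "gauss_resolution six_curve 12 six_pass six_match r A"
    and small: "\<And>p y. p \<in> double_points six_curve \<Longrightarrow> y \<in> six_forbidden \<Longrightarrow> r p < dist p y"
  shows "\<not> common_region (components (gauss_resolution.resolved six_curve r A))"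
proof
  interpret coloured_resolution six_curve 12 six_pass six_match r A six_colour by (rule six_coloured[OF res])
  let ?Q = "quarter (3 * six_time)" and ?K = "circle 2"
  have nd: "x \<notin> disc i" if "x \<in> six_forbidden" for x i
    using small[of "six_curve (six_pass i)" x] that unfolding cap_def double_points_T by force
  \<comment> \<open>A point of the curve in the forbidden set is outside all discs, so it lies on
    the edge between its neighbouring passes and survives the smoothing.\<close>
  have on_edge: "six_curve u \<in> circle (six_colour i)"
    if "six_pass i < u" "u < six_pass (i + 1)" "six_curve u \<in> six_forbidden" for u i
  proof -
    have "u \<notin> {lo j..hi j}" for j using nd[OF that(3)] disc_strands[of j] by blast
    from this[of i] this[of "i + 1"] have "u \<in> {hi i..lo (i + 1)}"
      using that(1,2) lo_T[of i] T_hi[of "i + 1"] by auto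
    then show ?thesis unfolding circle_def piece_def edge_def by blast
  qed
  have QF: "?Q \<subseteq> six_forbidden" "uminus ` ?Q \<subseteq> six_forbidden" unfolding six_forbidden_def by blast+
  have curve: "x \<in> range six_curve" if "x \<in> resolved" "x \<in> six_forbidden" for x
    using that resolved_subset nd unfolding double_points_T by blast
  have resQ: "x \<in> circle 0" if xr: "x \<in> resolved" "x \<in> ?Q" for x
  proof -
    have xf: "x \<in> six_forbidden" using xr QF by blast
    obtain t where t: "x = six_curve t" using curve[OF xr(1) xf] by blast
    have "same_angle t six_time \<or> same_angle t (six_time - 2*pi / 3)"
      using xr(2) unfolding t by (rule six_curve_quarter)
    then show ?thesis
    proof
      assume "same_angle t six_time"
      then have x: "x = six_curve six_time" unfolding t by (rule gen_same_angle[OF gen])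
      have "six_curve six_time \<in> circle (six_colour 0)"
        using xf unfolding x by (intro on_edge) (simp_all add: six_pass_def six_index_def six_time_def)
      then show ?thesis unfolding x by (simp add: six_colour_def)
    next
      assume "same_angle t (six_time - 2*pi / 3)"
      then have x: "x = six_curve (six_time - 2*pi / 3)" unfolding t by (rule gen_same_angle[OF gen])
      have "six_curve (six_time - 2*pi / 3) \<in> circle (six_colour (-3))"
        using xf unfolding x by (intro on_edge) (simp_all add: six_pass_def six_index_def six_time_def)
      then show ?thesis unfolding x by (simp add: six_colour_def)
    qed
  qed
  have resQ': "x \<in> circle 3" if xr: "x \<in> resolved" "x \<in> uminus ` ?Q" for x
  proof -
    have xf: "x \<in> six_forbidden" using xr QF by blast
    obtain t where t: "x = six_curve t" using curve[OF xr(1) xf] by blast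
    have "same_angle t (six_time - pi) \<or> same_angle t (six_time - 2*pi / 3 - pi)"
      using xr(2) unfolding t by (rule six_curve_minus_quarter)
    then show ?thesis
    proof
      assume "same_angle t (six_time - pi)"
      then have x: "x = six_curve (six_time - pi)" unfolding t by (rule gen_same_angle[OF gen])
      have "six_curve (six_time - pi) \<in> circle (six_colour (-6))"
        using xf unfolding x by (intro on_edge) (simp_all add: six_pass_def six_index_def six_time_def)
      then show ?thesis unfolding x by (simp add: six_colour_def)
    next
      assume "same_angle t (six_time - 2*pi / 3 - pi)"
      then have x: "x = six_curve (six_time - 2*pi / 3 - pi)" unfolding t by (rule gen_same_angle[OF gen])
      have "six_curve (six_time - 2*pi / 3 - pi) \<in> circle (six_colour (-9))"
        using xf unfolding x by (intro on_edge) (simp_all add: six_pass_def six_index_def six_time_def)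
      then show ?thesis unfolding x by (simp add: six_colour_def)
    qed
  qed
  have top: "six_curve six_time \<in> ?Q"
    unfolding six_curve_def mercator_in_quarter_iff using six_height_time by simp
  have "six_curve (six_time - pi) = - six_curve six_time"
    using six_curve_antipodal[of "six_time - pi"] by simp
  then have bot: "six_curve (six_time - pi) \<in> uminus ` ?Q" using top by simp
  have top0: "six_curve six_time \<in> circle 0"
    using on_edge[of 0 six_time] top QF by (auto simp: six_pass_def six_index_def six_time_def six_colour_def)
  have bot3: "six_curve (six_time - pi) \<in> circle 3"
    using on_edge[of "-6" "six_time - pi"] bot QF by (auto simp: six_pass_def six_index_def six_time_def six_colour_def)
  assume "common_region (components resolved)"
  then obtain U where U: "connected U" "U \<subseteq> S2 - \<Union>(components resolved)"
    "\<And>c. c \<in> components resolved \<Longrightarrow> closure U \<inter> c \<noteq> {}" unfolding common_region_def by blast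
  have colours: "six_colour 0 = 0" "six_colour 3 = 3" "six_colour 2 = 2" by (simp_all add: six_colour_def)
  have comp: "circle 0 \<in> components resolved" "circle 3 \<in> components resolved" "?K \<in> components resolved"
    unfolding components_resolved using colours by (metis image_eqI rangeI)+
  have Kres: "?K \<subseteq> resolved" "circle 0 \<subseteq> resolved" "circle 3 \<subseteq> resolved"
    using comp in_components_subset by blast+
  have dis: "circle 0 \<inter> ?K = {}" "circle 3 \<inter> ?K = {}" by (simp_all add: circles_disjoint)
  \<comment> \<open>A path of sets from pole to pole off the circle of colour 2: quarter meridian,
    circle 0, the assumed region, circle 3, antipodal quarter meridian. The region is joined to the
    circles through its closure.\<close>
  define C where "C = (?Q \<union> circle 0) \<union> ((U \<union> circle 0) \<union> ((U \<union> circle 3) \<union> (uminus ` ?Q \<union> circle 3)))"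
  have "connected (uminus ` ?Q)" by (intro connected_continuous_image continuous_intros quarter_connected)
  then have c3: "connected (uminus ` ?Q \<union> circle 3)"
    using bot bot3 by (intro connected_Un circle_connected) blast+
  have "connected (?Q \<union> circle 0)"
    using top top0 by (intro connected_Un circle_connected quarter_connected) blast
  moreover have "connected (U \<union> circle 0)" "connected (U \<union> circle 3)"
    using connected_Un_closure[OF U(1) circle_connected] U(3) comp by blast+
  moreover have "circle 0 \<noteq> {}" "circle 3 \<noteq> {}" using top0 bot3 by blast+
  moreover have "U \<noteq> {}" using U(3)[OF comp(1)] by auto
  ultimately have "connected C" unfolding C_def
    using c3 by (intro connected_Un[of "?Q \<union> circle 0"] connected_Un[of "U \<union> circle 0"] connected_Un[of "U \<union> circle 3"]) blast+
  moreover have "C \<subseteq> S2 - ?K"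
  proof -
    have "U \<subseteq> S2 - ?K" using U(2) comp(3) by blast
    moreover have "?Q \<inter> ?K = {}" "uminus ` ?Q \<inter> ?K = {}" using resQ resQ' Kres dis by blast+
    moreover have "?Q \<subseteq> S2" "uminus ` ?Q \<subseteq> S2" using quarter_sphere[of "3 * six_time"] by auto
    moreover have "circle 0 \<subseteq> S2" "circle 3 \<subseteq> S2" using Kres resolved_sphere by blast+
    ultimately show ?thesis unfolding C_def using dis by blast
  qed
  moreover have "vector [0, 0, 1] \<in> C" unfolding C_def using north_in_quarter by blast
  moreover have "vector [0, 0, -1] \<in> C"
  proof -
    have "vector [0, 0, -1] = - (vector [0, 0, 1] :: real^3)" by (simp add: vec_eq_iff forall_3 vector_3)
    then have "vector [0, 0, -1] \<in> uminus ` ?Q" using north_in_quarter by blast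
    then show ?thesis unfolding C_def by blast
  qed
  moreover have "?K \<subseteq> S2" using Kres resolved_sphere by blast
  ultimately obtain L where L: "continuous_on ?K L"
    "\<And>x. x \<in> ?K \<Longrightarrow> exp (\<i> * of_real (L x)) = horizontal x /\<^sub>R norm (horizontal x)"
    using continuous_longitude[OF circle_compact] by blast
  have edgeK: "six_curve u \<in> ?K" if "six_colour i = 2" "u \<in> {hi i..lo (i + 1)}" for i u
    using that unfolding circle_def piece_def edge_def by blast
  have outK: "out i \<subseteq> ?K" and innK: "inn (i + 1) \<subseteq> ?K" if "six_colour i = 2" for i
    using that unfolding circle_def piece_def by blast+
  have unit: "horizontal (six_curve u) /\<^sub>R norm (horizontal (six_curve u)) = exp (\<i> * of_real (3 * u))" for u
    unfolding six_curve_def horizontal_mercator_unit by simp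
  \<comment> \<open>Along an edge the longitude of the curve is three times the parameter, so
    \<open>L\<close> follows it up to a constant, recorded below as \<kappa>.\<close>
  have along: "L (six_curve u) - 3 * u = L (six_curve v) - 3 * v"
    if i: "six_colour i = 2" and uv: "u \<in> {hi i..lo (i + 1)}" "v \<in> {hi i..lo (i + 1)}" for i u v
  proof (rule multiple_2pi_constant[of "{hi i..lo (i + 1)}" "\<lambda>u. L (six_curve u)" "\<lambda>u. 3 * u"])
    show "continuous_on {hi i..lo (i + 1)} (\<lambda>u. L (six_curve u))"
      using edgeK[OF i] by (intro continuous_on_compose2[OF L(1) gen_continuous[OF gen]]) blast
    show "same_angle (L (six_curve u)) (3 * u)" if "u \<in> {hi i..lo (i + 1)}" for u
      using L(2)[OF edgeK[OF i that]] unfolding unit by (rule exp_eq_same_angle)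
  qed (use uv in \<open>auto intro!: continuous_intros\<close>)
  define \<kappa> where "\<kappa> i = L (six_curve (hi i)) - 3 * hi i" for i
  have \<kappa>lo: "L (six_curve (lo (i + 1))) - 3 * lo (i + 1) = \<kappa> i" if "six_colour i = 2" for i
    unfolding \<kappa>_def using hi_lo[of i] by (intro along[OF that]) auto
  \<comment> \<open>After one turn of the parameter \<open>L\<close> returns to its value while
    \<open>3 * hi i\<close> has grown by 6 pi.\<close>
  have \<kappa>shift: "\<kappa> (i + 12) = \<kappa> i - 6 * pi" for i
    unfolding \<kappa>_def using hi_shift[of i 1] gen_periodic[OF gen, of "hi i" 1] by simp
  \<comment> \<open>In the disc, the local longitude \<open>G\<close> follows three times the
    parameter along both strands, which share the point \<open>?p\<close>; along the arc
    \<open>B\<close> it differs from \<open>L\<close> by a constant. So crossing over to the matched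
    strand costs three times the difference of the passes.\<close>
  have turn: "L (six_curve x) - 3 * x + 3 * six_pass i = L (six_curve y) - 3 * y + 3 * six_pass (six_match i)"
    if B: "connected B" "B \<subseteq> ?K" "B \<subseteq> disc i" "six_curve x \<in> B" "six_curve y \<in> B"
      and x: "x \<in> {lo i..hi i}" and y: "y \<in> {lo (six_match i)..hi (six_match i)}" for B i x y
  proof -
    let ?p = "six_curve (six_pass i)"
    have nz: "horizontal ?p \<noteq> 0"
      unfolding six_curve_def horizontal_mercator using cosh_real_pos[of "six_height (six_pass i)"] by auto
    \<comment> \<open>The point of the polar axis at the height of \<open>?p\<close>. It is
      forbidden, so the disc stays within the domain of the local longitude.\<close>
    define q :: "real^3" where "q = vector [0, 0, ?p $ 3]"
    have "q \<in> six_forbidden" unfolding six_forbidden_def q_def by (simp add: vector_3)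
    then have "r ?p < dist ?p q" by (intro small) (auto simp: double_points_T)
    also have "dist ?p q = norm (horizontal ?p)"
      unfolding q_def horizontal_def dist_norm norm_eq_sqrt_inner[where 'a = "real^3"] cmod_def
      by (simp add: inner_vec_def sum_3 vector_3 power2_eq_square)
    finally have r: "r ?p < norm (horizontal ?p)" .
    obtain G where G: "continuous_on {x. dist ?p x < norm (horizontal ?p)} G"
      "\<And>x. dist ?p x < norm (horizontal ?p) \<Longrightarrow> exp (\<i> * of_real (G x)) = horizontal x /\<^sub>R norm (horizontal x)"
      using local_longitude[OF nz] by blast
    have Dsub: "disc i \<subseteq> {x. dist ?p x < norm (horizontal ?p)}" unfolding cap_def using r by auto
    have GD: "exp (\<i> * of_real (G x)) = horizontal x /\<^sub>R norm (horizontal x)" if "x \<in> disc i" for x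
      using G(2) Dsub that by blast
    have Gc: "continuous_on S G" if "S \<subseteq> disc i" for S using G(1) Dsub that by (meson continuous_on_subset subset_trans)
    have strand: "G (six_curve u) - 3 * u = G ?p - 3 * six_pass j"
      if j: "six_curve (six_pass j) = ?p" "six_curve ` {lo j..hi j} \<subseteq> disc i" and u: "u \<in> {lo j..hi j}" for u j
    proof -
      have "G (six_curve u) - 3 * u = G (six_curve (six_pass j)) - 3 * six_pass j"
      proof (rule multiple_2pi_constant[of "{lo j..hi j}" "\<lambda>u. G (six_curve u)" "\<lambda>u. 3 * u"])
        show "continuous_on {lo j..hi j} (\<lambda>u. G (six_curve u))"
          by (rule continuous_on_compose2[OF Gc[OF j(2)] gen_continuous[OF gen]]) simp
        show "same_angle (G (six_curve u)) (3 * u)" if "u \<in> {lo j..hi j}" for u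
        proof -
          have "six_curve u \<in> disc i" using j(2) that by blast
          from GD[OF this] show ?thesis unfolding unit by (rule exp_eq_same_angle)
        qed
      qed (use u lo_T[of j] T_hi[of j] in \<open>auto intro!: continuous_intros\<close>)
      then show ?thesis using j(1) by simp
    qed
    have sub: "six_curve ` {lo i..hi i} \<subseteq> disc i" "six_curve ` {lo (six_match i)..hi (six_match i)} \<subseteq> disc i"
      using disc_strands[of i] by blast+
    have gx: "G (six_curve x) - 3 * x = G ?p - 3 * six_pass i"
      using sub(1) x by (intro strand) simp_all
    have gy: "G (six_curve y) - 3 * y = G ?p - 3 * six_pass (six_match i)"
      using sub(2) y by (intro strand g_T_m) simp_all
    have "L (six_curve x) - G (six_curve x) = L (six_curve y) - G (six_curve y)"
    proof (rule multiple_2pi_constant[OF B(1) _ _ _ B(4,5)])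
      show "continuous_on B L" by (rule continuous_on_subset[OF L(1) B(2)])
      show "continuous_on B G" by (rule Gc[OF B(3)])
      fix z assume z: "z \<in> B"
      have "z \<in> ?K" "z \<in> disc i" using z B by blast+
      then have "exp (\<i> * of_real (L z)) = exp (\<i> * of_real (G z))" using L(2)[of z] GD[of z] by simp
      then show "same_angle (L z) (G z)" by (rule exp_eq_same_angle)
    qed
    then show ?thesis using gx gy by linarith
  qed
  have R1: "\<kappa> (i - 1) + 3 * six_pass i = \<kappa> (six_match i - 1) + 3 * six_pass (six_match i)"
    if c: "six_colour (i - 1) = 2" for i
  proof -
    have "six_colour (six_match i - 1) = 2" using c col_inn by simp
    then have "L (six_curve (lo (six_match i))) - 3 * lo (six_match i) = \<kappa> (six_match i - 1)"
      using \<kappa>lo[of "six_match i - 1"] by simp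
    moreover have "L (six_curve (lo i)) - 3 * lo i = \<kappa> (i - 1)" using \<kappa>lo[OF c] by simp
    moreover have "inn i \<subseteq> ?K" using innK[OF c] by simp
    ultimately show ?thesis
      using turn[OF inn(2) _ inn(3,4,5), of i] lo_hi[of i] lo_hi[of "six_match i"] by simp
  qed
  have R2: "\<kappa> i + 3 * six_pass i = \<kappa> (six_match i) + 3 * six_pass (six_match i)"
    if c: "six_colour i = 2" for i
    unfolding \<kappa>_def
    using turn[OF out(2) outK[OF c] out(3,4,5)] lo_hi[of i] lo_hi[of "six_match i"] by simp
  \<comment> \<open>Around the circle of colour 2 the edges follow each other as 2, 5, 8, 11, 14.
    Each crossing over lowers \<kappa> by \<open>3 * (2*pi / 3)\<close>, which makes 8 pi in total,
    but the shift by one turn allows only 6 pi. The difference of 2 pi is the winding of the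
    circle.\<close>
  have "\<kappa> 2 = \<kappa> 5 + 2 * pi"
    using R1[of 3] by (simp add: six_colour_def six_match_def six_pass_def six_index_def)
  moreover have "\<kappa> 8 = \<kappa> 11 + 2 * pi"
    using R1[of 9] by (simp add: six_colour_def six_match_def six_pass_def six_index_def)
  moreover have "\<kappa> 5 = \<kappa> 8 + 2 * pi"
    using R2[of 5] by (simp add: six_colour_def six_match_def six_pass_def six_index_def)
  moreover have "\<kappa> 11 = \<kappa> 14 + 2 * pi"
    using R2[of 11] by (simp add: six_colour_def six_match_def six_pass_def six_index_def)
  moreover have "\<kappa> 14 = \<kappa> 2 - 6 * pi" using \<kappa>shift[of 2] by simp
  ultimately show False using pi_gt_zero by linarith
qed

section \<open>Circle numbers and the comparison of the two classes\<close>

text \<open>As \<open>circle_number\<close> is a definite description, the sizes must form a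
  singleton: \<open>small_resolution\<close> shows that \<tau> is nonempty, and the assumed count
  holds for every choice of discs and arcs.\<close>

lemma circle_number_eq:
  assumes gc: "gauss_curve g N T m"
    and n: "\<And>r A. gauss_resolution g N T m r A \<Longrightarrow> card (components (gauss_resolution.resolved g r A)) = n"
  shows "circle_number (range g) = n"
proof -
  have gen: "generic_immersion g" using gc unfolding gauss_curve_def by blast
  have card: "card C = n" if C: "C \<in> tau (range g)" for C
  proof -
    obtain R where R: "A_inv_resolution g R" "sphere_isotopic (components R) C"
      using C unfolding tau_eq[OF gen] by blast
    obtain r A where rA: "gauss_resolution g N T m r A" "R = gauss_resolution.resolved g r A"
      by (rule A_inv_resolutionE[OF gc R(1)])
    have "\<Union>(components R) \<subseteq> S2"
      using gauss_resolution.resolved_sphere[OF rA(1)] rA(2) Union_components[of R] by simp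
    then show ?thesis using isotopic_card[OF R(2)] n[OF rA(1)] rA(2) by simp
  qed
  have "tau (range g) \<noteq> {}"
  proof -
    obtain r A where rA: "\<And>p. p \<in> double_points g \<Longrightarrow> A_inv_smoothing g p (r p) (A p)"
      "disjoint_family_on (\<lambda>p. cap p (r p)) (double_points g)"
      using small_resolution[OF gen zero_less_one] by metis
    then have "A_inv_resolution g ((range g - (\<Union>p\<in>double_points g. cap p (r p))) \<union> (\<Union>p\<in>double_points g. A p))"
      unfolding A_inv_resolution_def by blast
    then show ?thesis unfolding tau_eq[OF gen] using sphere_isotopic_refl by blast
  qed
  then have "card ` tau (range g) = {n}" using card by auto
  then show ?thesis unfolding circle_number_def by simp
qed

lemma five_circle_number: "circle_number (range five_curve) = 5"
proof (rule circle_number_eq[OF five_gauss_curve])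
  fix r A assume "gauss_resolution five_curve 10 five_pass (\<lambda>i. i + 5) r A"
  then interpret coloured_resolution five_curve 10 five_pass "\<lambda>i. i + 5" r A "\<lambda>i. i mod 5"
    by (rule five_coloured)
  have "range (\<lambda>i::int. i mod 5) = {0..<5}"
  proof
    show "{0..<5} \<subseteq> range (\<lambda>i::int. i mod 5)"
    proof
      fix i :: int assume "i \<in> {0..<5}"
      then have "i = i mod 5" by simp
      then show "i \<in> range (\<lambda>i::int. i mod 5)" by (rule range_eqI)
    qed
  qed auto
  then show "card (components resolved) = 5" unfolding card_components by simp
qed

lemma six_circle_number: "circle_number (range six_curve) = 5"
proof (rule circle_number_eq[OF six_gauss_curve])
  fix r A assume "gauss_resolution six_curve 12 six_pass six_match r A"
  then interpret coloured_resolution six_curve 12 six_pass six_match r A six_colour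
    by (rule six_coloured)
  have "range six_colour = {0, 1, 2, 3, 4}"
  proof
    show "range six_colour \<subseteq> {0, 1, 2, 3, 4}"
    proof (rule image_subsetI)
      fix i :: int
      have "i mod 3 = 0 \<or> i mod 3 = 1 \<or> i mod 3 = 2" by presburger
      moreover have "(i div 3 + 1) div 2 mod 2 = 0 \<or> (i div 3 + 1) div 2 mod 2 = 1" by presburger
      ultimately show "six_colour i \<in> {0, 1, 2, 3, 4}" unfolding six_colour_def by auto
    qed
    have "six_colour 0 = 0" "six_colour 1 = 1" "six_colour 2 = 2" "six_colour 3 = 3" "six_colour 4 = 4"
      by (simp_all add: six_colour_def)
    then show "{0, 1, 2, 3, 4} \<subseteq> range six_colour" by (metis empty_subsetI insert_subset rangeI)
  qed
  then show "card (components resolved) = 5" unfolding card_components by simp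
qed

text \<open>A single resolution decides: one of the three-strand curve with discs smaller than the
  distance \<open>d\<close> of the double points from \<open>six_forbidden\<close>. It has no common
  region, while every resolution of the two-strand curve has one.\<close>

lemma tau_neq: "tau (range five_curve) \<noteq> tau (range six_curve)"
proof
  assume eq: "tau (range five_curve) = tau (range six_curve)"
  have gen5: "generic_immersion five_curve" using five_gauss_curve unfolding gauss_curve_def by blast
  interpret six: gauss_curve six_curve 12 six_pass six_match by (rule six_gauss_curve)
  have "compact (double_points six_curve)"
    using gen_finite_double[OF six.gen] by (rule finite_imp_compact)
  moreover have "double_points six_curve \<inter> six_forbidden = {}"
    unfolding six.double_points_T using six_pass_not_forbidden by blast
  ultimately obtain d where d: "0 < d" "\<And>p y. p \<in> double_points six_curve \<Longrightarrow> y \<in> six_forbidden \<Longrightarrow> d \<le> dist p y"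
    using separate_compact_closed[OF _ six_forbidden_closed] by metis
  obtain r A where rA: "\<And>p. p \<in> double_points six_curve \<Longrightarrow> A_inv_smoothing six_curve p (r p) (A p)"
    "\<And>p. p \<in> double_points six_curve \<Longrightarrow> r p < d"
    "disjoint_family_on (\<lambda>p. cap p (r p)) (double_points six_curve)"
    using small_resolution[OF six.gen d(1)] by metis
  interpret six: gauss_resolution six_curve 12 six_pass six_match r A
    by unfold_locales (use rA in blast)+
  have no: "\<not> common_region (components six.resolved)"
    using rA(2) d(2) by (intro six_no_common_region six.gauss_resolution_axioms) (meson less_le_trans)
  have "components six.resolved \<in> tau (range six_curve)"
    unfolding tau_eq[OF six.gen] using six.A_inv_resolution_resolved sphere_isotopic_refl by blast
  then obtain R where R: "A_inv_resolution five_curve R" "sphere_isotopic (components R) (components six.resolved)"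
    unfolding eq[symmetric] tau_eq[OF gen5] by blast
  obtain r' A' where rA': "gauss_resolution five_curve 10 five_pass (\<lambda>i. i + 5) r' A'"
    "R = gauss_resolution.resolved five_curve r' A'"
    by (rule A_inv_resolutionE[OF five_gauss_curve R(1)])
  have "\<Union>(components R) \<subseteq> S2"
    using gauss_resolution.resolved_sphere[OF rA'(1)] rA'(2) Union_components[of R] by simp
  moreover have "common_region (components R)" unfolding rA'(2) by (rule five_common_region[OF rA'(1)])
  ultimately have "common_region (components six.resolved)" by (rule common_region_isotopic[OF R(2)])
  then show False using no by blast
qed

theorem proposition1:
  shows "(\<forall>P P'. knot_projection P \<and> knot_projection P' \<and> tau P = tau P' \<longrightarrow>
            circle_number P = circle_number P') \<and>
         (\<exists>P P'. knot_projection P \<and> knot_projection P' \<and>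
            circle_number P = circle_number P' \<and> tau P \<noteq> tau P')"
proof (intro conjI allI impI)
  show "circle_number P = circle_number P'"
    if "knot_projection P \<and> knot_projection P' \<and> tau P = tau P'" for P P'
    using that unfolding circle_number_def by simp
  have "knot_projection (range five_curve)" "knot_projection (range six_curve)"
    using five_gauss_curve six_gauss_curve unfolding knot_projection_def gauss_curve_def by blast+
  then show "\<exists>P P'. knot_projection P \<and> knot_projection P' \<and> circle_number P = circle_number P' \<and> tau P \<noteq> tau P'"
    using five_circle_number six_circle_number tau_neq by metis
qed

end
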